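(* Let $\psi\in \mathcal{O}_M(\mathbb{R})$ be a real-valued function such that $\psi:\mathbb{R}\to\mathbb{R}$ is bijective, the operator $C_\psi\colon\mathcal{O}_M(\mathbb{R})\to \mathcal{O}_M(\mathbb{R})$, $f\mapsto f \circ \psi$, is mixing, and for every $v\in \mathcal{S}(\mathbb{R})$ $$\lim_{n\to\infty}v(\psi_n(0))\cdot n=0\quad\text{and}\quad\lim_{n\to\infty}v(\psi_{-n}(0))\cdot n=0.$$ Then $C_\psi$ is quasi-conjugate to the translation operator $C_{x+1}:\mathcal{O}_M(\mathbb{R})\to\mathcal{O}_M(\mathbb{R})$, $f\mapsto f(\cdot+1)$. Therefore $C_\psi$ is hypercyclic and chaotic.
   Context: $\mathbb{N}=\{1,2,3,\ldots\}$, $\mathbb{N}_0=\mathbb{N}\cup\{0\}$. $\mathcal{S}(\mathbb{R})$ is the Schwartz space of rapidly decreasing smooth functions. For $m,n\in\mathbb{N}$ let $\mathcal{O}_n^m(\mathbb{R})=\{f\in C^m(\mathbb{R}): |f|_{m,n}:=\sup_{x\in\mathbb{R},\,0\le j\le m}(1+|x|^2)^{-n}|f^{(j)}(x)|<\infty\}$, a Banach space under $|\cdot|_{m,n}$, and $\mathcal{O}_M(\mathbb{R})=\bigcap_{m=1}^\infty\bigcup_{n=1}^\infty\mathcal{O}_n^m(\mathbb{R})$ (slowly increasing smooth functions, the multipliers of $\mathcal{S}(\mathbb{R})$). It carries the locally convex topology of the projective limit over $m$ of the (LB)-spaces $\operatorname{ind}_{n\to\infty}\mathcal{O}_n^m(\mathbb{R})$;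 equivalently, the topology given by the seminorms $p_{m,v}(f)=\sup_{x\in\mathbb{R}}\max_{0\le j\le m}|v(x)f^{(j)}(x)|$, $m\ge 0$, $v\in\mathcal{S}(\mathbb{R})$. For a smooth $\psi:\mathbb{R}\to\mathbb{R}$, the operator $C_\psi$ is well defined (and then continuous) on $\mathcal{O}_M(\mathbb{R})$ if and only if $\psi\in\mathcal{O}_M(\mathbb{R})$. Iterates: $\psi_0(x)=x$, $\psi_n=\psi\circ\psi_{n-1}$ for $n\in\mathbb{N}$; for bijective $\psi$ and $n\in\mathbb{N}$, $\psi_{-n}$ is the inverse of $\psi_n$. Let $T$ be a continuous linear operator on a topological vector space $E$. $T$ is topologically transitive if for every pair of non-empty open sets $U,V\subseteq E$ one has $T^n(U)\cap V\neq\emptyset$ for some $n\in\mathbb{N}$; mixing if for every such pair $T^n(U)\cap V\neq\emptyset$ for all sufficiently large $n\in\mathbb{N}$; hypercyclic if there is $x\in E$ whose orbit $\{T^nx:n\in\mathbb{N}_0\}$ is dense in $E$; chaotic if it is topologically transitive and its set of periodic points is dense in $E$. $T:E\to E$ is quasi-conjugate to $S:F\to F$ if there is a continuous map $\Phi:F\to E$ with dense range such that $T\circ\Phi=\Phi\circ S$. *)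

theory Defs
  imports "HOL-Analysis.Analysis"
begin

section \<open>Smooth functions of a real variable\<close>

definition nth_deriv :: "nat \<Rightarrow> (real \<Rightarrow> complex) \<Rightarrow> real \<Rightarrow> complex" where
  "nth_deriv j f = ((\<lambda>g x. vector_derivative g (at x)) ^^ j) f"

text \<open>The library derivative is a total function, so differentiability is required
  at every stage below order m.\<close>

definition C_class :: "nat \<Rightarrow> (real \<Rightarrow> complex) set" where
  "C_class m = {f. (\<forall>j<m. \<forall>x. nth_deriv j f differentiable (at x)) \<and>
                   continuous_on UNIV (nth_deriv m f)}"

definition Schwartz :: "(real \<Rightarrow> complex) set" where
  "Schwartz = {v. (\<forall>m. v \<in> C_class m) \<and>
                  (\<forall>k j. bounded (range (\<lambda>x. x ^ k *\<^sub>R nth_deriv j v x)))}"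

section \<open>Slowly increasing smooth functions\<close>

definition O_space :: "nat \<Rightarrow> nat \<Rightarrow> (real \<Rightarrow> complex) set" where
  "O_space m n = {f \<in> C_class m.
     bdd_above {cmod (nth_deriv j f x) / (1 + \<bar>x\<bar>\<^sup>2) ^ n |x j. j \<le> m}}"

definition O_M :: "(real \<Rightarrow> complex) set" where
  "O_M = (\<Inter>m\<in>{1..}. \<Union>n\<in>{1..}. O_space m n)"

text \<open>The supremum is finite whenever f lies in O_M and v is a Schwartz function, which are
  the only arguments used below.\<close>

definition O_M_seminorm ::
    "nat \<Rightarrow> (real \<Rightarrow> complex) \<Rightarrow> (real \<Rightarrow> complex) \<Rightarrow> real" where
  "O_M_seminorm m v f = (SUP x. MAX j\<in>{..m}. cmod (v x * nth_deriv j f x))"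

text \<open>The open seminorm balls, with arbitrary centres in O_M, form a subbase of the locally
  convex topology given by the seminorms.\<close>

definition O_M_topology :: "(real \<Rightarrow> complex) topology" where
  "O_M_topology = topology_generated_by
     {{g \<in> O_M. O_M_seminorm m v (\<lambda>x. g x - f x) < e} |m v f e.
        v \<in> Schwartz \<and> f \<in> O_M \<and> e > 0}"

definition comp_op :: "(real \<Rightarrow> real) \<Rightarrow> (real \<Rightarrow> complex) \<Rightarrow> (real \<Rightarrow> complex)" where
  "comp_op \<psi> f = f \<circ> \<psi>"

section \<open>Dynamics of operators\<close>

text \<open>The space is the carrier of an abstract topology, and the operator is a function on the
  ambient type which is meant to map the carrier continuously into itself.\<close>

definition dense_in :: "'a topology \<Rightarrow> 'a set \<Rightarrow> bool" where
  "dense_in E A \<longleftrightarrow> A \<subseteq> topspace E \<and> E closure_of A = topspace E"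

definition topologically_transitive :: "'a topology \<Rightarrow> ('a \<Rightarrow> 'a) \<Rightarrow> bool" where
  "topologically_transitive E T \<longleftrightarrow>
     (\<forall>U V. openin E U \<and> U \<noteq> {} \<and> openin E V \<and> V \<noteq> {} \<longrightarrow>
        (\<exists>n\<ge>1. (T ^^ n) ` U \<inter> V \<noteq> {}))"

definition mixing :: "'a topology \<Rightarrow> ('a \<Rightarrow> 'a) \<Rightarrow> bool" where
  "mixing E T \<longleftrightarrow>
     (\<forall>U V. openin E U \<and> U \<noteq> {} \<and> openin E V \<and> V \<noteq> {} \<longrightarrow>
        (\<exists>N. \<forall>n\<ge>N. (T ^^ n) ` U \<inter> V \<noteq> {}))"

definition hypercyclic :: "'a topology \<Rightarrow> ('a \<Rightarrow> 'a) \<Rightarrow> bool" where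
  "hypercyclic E T \<longleftrightarrow> (\<exists>x\<in>topspace E. dense_in E (range (\<lambda>n. (T ^^ n) x)))"

definition periodic_points :: "'a topology \<Rightarrow> ('a \<Rightarrow> 'a) \<Rightarrow> 'a set" where
  "periodic_points E T = {x \<in> topspace E. \<exists>n\<ge>1. (T ^^ n) x = x}"

definition chaotic :: "'a topology \<Rightarrow> ('a \<Rightarrow> 'a) \<Rightarrow> bool" where
  "chaotic E T \<longleftrightarrow> topologically_transitive E T \<and> dense_in E (periodic_points E T)"

definition quasi_conjugate ::
    "'a topology \<Rightarrow> ('a \<Rightarrow> 'a) \<Rightarrow> 'b topology \<Rightarrow> ('b \<Rightarrow> 'b) \<Rightarrow> bool" where
  "quasi_conjugate E T F S \<longleftrightarrow>
     (\<exists>\<Phi>. continuous_map F E \<Phi> \<and> dense_in E (\<Phi> ` topspace F) \<and>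
          (\<forall>y\<in>topspace F. T (\<Phi> y) = \<Phi> (S y)))"

end

theory Submission
  imports Defs
begin

text \<open>Testing mixing with the constant 0 and the identity shows that \<open>\<psi>\<close> has neither fixed points
  nor critical points, and that the derivatives of all integer iterates of \<open>\<psi>\<close> are polynomially
  bounded at those points which they map into a given compact set.  Therefore the Abel equation
  \<open>H (\<psi> x) = H x + 1\<close> has a solution H which is a diffeomorphism and whose derivatives are slowly
  increasing; the growth condition on the orbit of 0 says that H itself is slowly increasing.
  Composition with H is then the required quasi-conjugacy, its range being dense because it
  contains all test functions.  For the translation, a hypercyclic vector and a dense set of
  periodic vectors are sums of widely separated translates of test functions.\<close>

section \<open>Calculus of iterated derivatives\<close>

text \<open>Mixing supplies a threshold N for each pair of balls, hence one that depends on the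
  weight v. The iterates are therefore first estimated against each Schwartz function v separately,
  over all pairs (n, x) at once. A single polynomial bound is extracted only afterwards, by
  constructing a Schwartz function that would detect its failure. The identity serves as a test
  function because a function h with h' close to 1 on a compact set lets the top derivative of an
  iterate q be read off from the chain rule as soon as h o q is small. Negative iterates are reached
  by exchanging the roles of 0 and the identity. If \<psi> moves points to the left, the
  construction is applied to its inverse and the sign of the solution is changed. No growth bound
  for the inverse of H is established, so composition with H gives a quasi-conjugacy rather than a
  conjugacy. Its continuity rests on the polynomial growth of H, which allows Schwartz weights to be
  transported along H; its dense range rests on H being a diffeomorphism, which preserves smoothness
  and compact support.\<close>

definition D :: "(real \<Rightarrow> complex) \<Rightarrow> real \<Rightarrow> complex" where
  "D f = (\<lambda>x. vector_derivative f (at x))"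

text \<open>A finite-order notion is needed because the closure properties go by induction on k: the
  derivative of a product, a reciprocal or an inverse function contains the function itself again,
  at lower order.\<close>

definition diff_upto :: "nat \<Rightarrow> (real \<Rightarrow> complex) \<Rightarrow> bool" where
  "diff_upto k f \<longleftrightarrow> (\<forall>j<k. \<forall>x. nth_deriv j f differentiable (at x))"

definition smooth :: "(real \<Rightarrow> complex) \<Rightarrow> bool" where
  "smooth f \<longleftrightarrow> (\<forall>j x. nth_deriv j f differentiable (at x))"

lemma nth_deriv_0 [simp]: "nth_deriv 0 f = f"
  by (simp add: nth_deriv_def)

lemma nth_deriv_Suc: "nth_deriv (Suc j) f = D (nth_deriv j f)"
  by (simp add: nth_deriv_def D_def)

lemma nth_deriv_Suc': "nth_deriv (Suc j) f = nth_deriv j (D f)"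
  by (simp add: nth_deriv_def D_def funpow_Suc_right del: funpow.simps(2))

lemma nth_deriv_add: "nth_deriv i (nth_deriv j f) = nth_deriv (i + j) f"
  by (simp add: nth_deriv_def funpow_add)

lemma has_D: "f differentiable (at x) \<Longrightarrow> (f has_vector_derivative D f x) (at x)"
  by (simp add: D_def vector_derivative_works)

lemma D_eqI: "(\<And>x. (f has_vector_derivative f' x) (at x)) \<Longrightarrow> D f = f'"
  by (rule ext) (simp add: D_def vector_derivative_at)

lemma diff_upto_0 [simp]: "diff_upto 0 f"
  by (simp add: diff_upto_def)

lemma all_less_Suc_split: "(\<forall>j<Suc k. P j) \<longleftrightarrow> P 0 \<and> (\<forall>j<k. P (Suc j))"
  using less_Suc_eq_0_disj by auto

lemma diff_upto_Suc: "diff_upto (Suc k) f \<longleftrightarrow> (\<forall>x. f differentiable (at x)) \<and> diff_upto k (D f)"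
  by (simp add: diff_upto_def all_less_Suc_split nth_deriv_Suc')

lemma diff_upto_SucI:
  "(\<And>x. (f has_vector_derivative f' x) (at x)) \<Longrightarrow> diff_upto k f' \<Longrightarrow> diff_upto (Suc k) f"
  by (metis D_eqI diff_upto_Suc differentiableI_vector)

lemma diff_upto_SucE:
  assumes "diff_upto (Suc k) f"
  obtains "\<And>x. (f has_vector_derivative D f x) (at x)" "diff_upto k (D f)"
  using assms by (auto simp: diff_upto_Suc intro: has_D)

lemma diff_upto_mono: "diff_upto k f \<Longrightarrow> j \<le> k \<Longrightarrow> diff_upto j f"
  by (auto simp: diff_upto_def)

lemma smooth_iff_diff_upto: "smooth f \<longleftrightarrow> (\<forall>k. diff_upto k f)"
  by (auto simp: smooth_def diff_upto_def)

lemma smoothI: "(\<And>x. (f has_vector_derivative f' x) (at x)) \<Longrightarrow> smooth f' \<Longrightarrow> smooth f"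
  unfolding smooth_iff_diff_upto
  by (metis diff_upto_0 diff_upto_SucI not0_implies_Suc)

lemma smooth_nth_deriv: "smooth f \<Longrightarrow> smooth (nth_deriv j f)"
  by (simp add: smooth_def nth_deriv_add)

lemma smooth_D: "smooth f \<Longrightarrow> smooth (D f)"
  using smooth_nth_deriv[of f 1] by (simp add: nth_deriv_Suc)

lemma smooth_has_D: "smooth f \<Longrightarrow> (f has_vector_derivative D f x) (at x)"
  by (metis has_D nth_deriv_0 smooth_def)

lemma smooth_has_nth_deriv:
  "smooth f \<Longrightarrow> (nth_deriv j f has_vector_derivative nth_deriv (Suc j) f x) (at x)"
  by (simp add: nth_deriv_Suc smooth_has_D smooth_nth_deriv)

lemma smooth_continuous_on: "smooth f \<Longrightarrow> continuous_on S (nth_deriv j f)"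
  by (meson continuous_at_imp_continuous_on differentiable_imp_continuous_within smooth_def)

lemma nth_deriv_const: "nth_deriv j (\<lambda>x. c) = (\<lambda>x. if j = 0 then c else 0)"
proof (induction j)
  case (Suc j)
  then show ?case by (auto simp: nth_deriv_Suc intro!: D_eqI)
qed simp

lemma smooth_const [simp]: "smooth (\<lambda>x. c)"
  by (simp add: smooth_def nth_deriv_const)

lemma diff_upto_const [simp]: "diff_upto k (\<lambda>x. c)"
  using smooth_const smooth_iff_diff_upto by blast

lemma nth_deriv_of_real:
  "nth_deriv j (\<lambda>x. complex_of_real x) =
   (\<lambda>x. if j = 0 then of_real x else if j = 1 then 1 else 0)"
proof (induction j)
  case (Suc j)
  have "D (\<lambda>x. complex_of_real x) = (\<lambda>x. 1)"
    by (rule D_eqI) (auto intro!: derivative_eq_intros simp: has_vector_derivative_def scaleR_conv_of_real)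
  then show ?case by (simp add: nth_deriv_Suc' nth_deriv_const)
qed simp

lemma smooth_of_real: "smooth complex_of_real"
proof (rule smoothI)
  show "(complex_of_real has_vector_derivative 1) (at x)" for x
    by (auto intro!: derivative_eq_intros simp: has_vector_derivative_def scaleR_conv_of_real)
qed simp

lemma diff_upto_add: "diff_upto k f \<Longrightarrow> diff_upto k g \<Longrightarrow> diff_upto k (\<lambda>x. f x + g x)"
proof (induction k arbitrary: f g)
  case (Suc k)
  from Suc.prems show ?case
    by (elim diff_upto_SucE) (rule diff_upto_SucI, rule has_vector_derivative_add, auto intro: Suc.IH)
qed simp

lemma diff_upto_mult: "diff_upto k f \<Longrightarrow> diff_upto k g \<Longrightarrow> diff_upto k (\<lambda>x. f x * g x)"
proof (induction k arbitrary: f g)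
  case (Suc k)
  have k: "diff_upto k f" "diff_upto k g" using Suc.prems by (auto intro: diff_upto_mono)
  from Suc.prems show ?case
    by (elim diff_upto_SucE)
       (rule diff_upto_SucI, rule has_vector_derivative_mult, auto intro!: Suc.IH diff_upto_add k)
qed simp

text \<open>The derivative -f' (1/f)^2 is a product of f' with copies of 1/f, for which order k is
  already known.\<close>

lemma diff_upto_inverse:
  assumes "diff_upto k f" "\<And>x. f x \<noteq> 0"
  shows "diff_upto k (\<lambda>x. inverse (f x))"
  using assms(1)
proof (induction k)
  case (Suc k)
  have k: "diff_upto k f" using Suc.prems by (auto intro: diff_upto_mono)
  from Suc.prems have d: "(f has_vector_derivative D f x) (at x)" and D: "diff_upto k (D f)" for x
    by (auto elim: diff_upto_SucE)
  have "((\<lambda>x. inverse (f x)) has_vector_derivative ((- 1) * D f x) * (inverse (f x) * inverse (f x))) (at x)" for x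
    using field_vector_diff_chain_at[OF d[of x] DERIV_inverse[OF assms(2)]]
    by (simp add: o_def power2_eq_square)
  then show ?case
    by (rule diff_upto_SucI) (intro diff_upto_mult Suc.IH k D diff_upto_const)
qed simp

lemma smooth_add: "smooth f \<Longrightarrow> smooth g \<Longrightarrow> smooth (\<lambda>x. f x + g x)"
  by (simp add: smooth_iff_diff_upto diff_upto_add)

lemma smooth_mult: "smooth f \<Longrightarrow> smooth g \<Longrightarrow> smooth (\<lambda>x. f x * g x)"
  by (simp add: smooth_iff_diff_upto diff_upto_mult)

lemma smooth_inverse: "smooth f \<Longrightarrow> (\<And>x. f x \<noteq> 0) \<Longrightarrow> smooth (\<lambda>x. inverse (f x))"
  by (simp add: smooth_iff_diff_upto diff_upto_inverse)

lemma smooth_minus: "smooth f \<Longrightarrow> smooth (\<lambda>x. - f x)"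
  using smooth_mult[of "\<lambda>x. - 1" f] by simp

lemma smooth_diff: "smooth f \<Longrightarrow> smooth g \<Longrightarrow> smooth (\<lambda>x. f x - g x)"
  using smooth_add[of f "\<lambda>x. - g x"] smooth_minus by simp

lemma smooth_sum: "(\<And>i. i \<in> I \<Longrightarrow> smooth (f i)) \<Longrightarrow> smooth (\<lambda>x. \<Sum>i\<in>I. f i x)"
  by (induction I rule: infinite_finite_induct) (auto intro: smooth_add)

lemma nth_deriv_plus:
  assumes "smooth f" "smooth g"
  shows "nth_deriv j (\<lambda>x. f x + g x) = (\<lambda>x. nth_deriv j f x + nth_deriv j g x)"
proof (induction j)
  case (Suc j)
  show ?case unfolding nth_deriv_Suc Suc.IH
    by (intro D_eqI has_vector_derivative_add smooth_has_D smooth_nth_deriv assms)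
qed simp

lemma nth_deriv_cmult:
  assumes "smooth f"
  shows "nth_deriv j (\<lambda>x. c * f x) = (\<lambda>x. c * nth_deriv j f x)"
proof (induction j)
  case (Suc j)
  show ?case unfolding nth_deriv_Suc Suc.IH
    by (intro D_eqI has_vector_derivative_mult_right smooth_has_D smooth_nth_deriv assms)
qed simp

lemma nth_deriv_diff:
  assumes "smooth f" "smooth g"
  shows "nth_deriv j (\<lambda>x. f x - g x) = (\<lambda>x. nth_deriv j f x - nth_deriv j g x)"
proof (induction j)
  case (Suc j)
  show ?case unfolding nth_deriv_Suc Suc.IH
    by (intro D_eqI has_vector_derivative_diff smooth_has_D smooth_nth_deriv assms)
qed simp

lemma nth_deriv_sum:
  assumes "\<And>i. i \<in> I \<Longrightarrow> smooth (f i)"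
  shows "nth_deriv j (\<lambda>x. \<Sum>i\<in>I. f i x) = (\<lambda>x. \<Sum>i\<in>I. nth_deriv j (f i) x)"
  using assms
  by (induction I rule: infinite_finite_induct)
     (auto simp: nth_deriv_const nth_deriv_plus smooth_sum)

lemma nth_deriv_mult:
  assumes "smooth f" "smooth g"
  shows "nth_deriv j (\<lambda>x. f x * g x) =
         (\<lambda>x. \<Sum>l\<le>j. of_nat (j choose l) * nth_deriv (j - l) f x * nth_deriv l g x)"
  using assms
proof (induction j arbitrary: f g)
  case (Suc j)
  have D: "D (\<lambda>x. f x * g x) = (\<lambda>x. f x * D g x + D f x * g x)"
    by (intro D_eqI has_vector_derivative_mult smooth_has_D Suc.prems)
  have s: "smooth (\<lambda>x. f x * D g x)" "smooth (\<lambda>x. D f x * g x)" "smooth (D f)" "smooth (D g)"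
    by (intro smooth_mult smooth_D Suc.prems)+
  show ?case
  proof
    fix x
    let ?a = "\<lambda>l. nth_deriv (Suc j - l) f x * nth_deriv l g x"
    have 1: "(\<Sum>l\<le>j. of_nat (j choose l) * nth_deriv (j - l) (D f) x * nth_deriv l g x)
           = (\<Sum>l\<le>j. of_nat (j choose l) * ?a l)"
      by (intro sum.cong refl) (simp add: Suc_diff_le nth_deriv_Suc' mult.assoc)
    have 2: "(\<Sum>l\<le>j. of_nat (j choose l) * nth_deriv (j - l) f x * nth_deriv l (D g) x)
           = (\<Sum>l\<le>j. of_nat (j choose l) * ?a (Suc l))"
      by (intro sum.cong refl) (simp add: nth_deriv_Suc' mult.assoc)
    have "nth_deriv (Suc j) (\<lambda>x. f x * g x) x
        = (\<Sum>l\<le>j. of_nat (j choose l) * ?a (Suc l)) + (\<Sum>l\<le>j. of_nat (j choose l) * ?a l)"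
      by (simp only: nth_deriv_Suc' D nth_deriv_plus[OF s(1,2)] Suc.IH[OF Suc.prems(1) s(4)]
            Suc.IH[OF s(3) Suc.prems(2)] 1 2)
    also have "(\<Sum>l\<le>j. of_nat (j choose l) * ?a l) = (\<Sum>l\<le>Suc j. of_nat (j choose l) * ?a l)"
      by simp
    also have "\<dots> = ?a 0 + (\<Sum>l\<le>j. of_nat (j choose Suc l) * ?a (Suc l))"
      by (subst sum.atMost_Suc_shift) simp
    finally show "nth_deriv (Suc j) (\<lambda>x. f x * g x) x
        = (\<Sum>l\<le>Suc j. of_nat (Suc j choose l) * nth_deriv (Suc j - l) f x * nth_deriv l g x)"
      by (subst sum.atMost_Suc_shift) (simp add: sum.distrib algebra_simps)
  qed
qed simp

lemma nth_deriv_cong_open: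
  assumes "open S" "\<And>x. x \<in> S \<Longrightarrow> f x = g x" "x \<in> S"
  shows "nth_deriv j f x = nth_deriv j g x"
  using assms(3)
proof (induction j arbitrary: x)
  case (Suc j)
  have "\<forall>\<^sub>F y in nhds x. nth_deriv j f y = nth_deriv j g y"
    using eventually_nhds_in_open[OF assms(1) Suc.prems] by eventually_elim (rule Suc.IH)
  then show ?case unfolding nth_deriv_Suc D_def
    by (intro vector_derivative_cong_eq) (auto simp: eventually_nhds)
qed (simp add: assms)

lemma nth_deriv_zero_open:
  assumes "open S" "\<And>x. x \<in> S \<Longrightarrow> f x = 0" "x \<in> S"
  shows "nth_deriv j f x = 0"
  using nth_deriv_cong_open[OF assms(1), of f "\<lambda>x. 0" x j] assms(2,3) by (auto simp: nth_deriv_const)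

lemma smooth_local:
  assumes "\<And>x. \<exists>S g. open S \<and> x \<in> S \<and> smooth g \<and> (\<forall>y\<in>S. f y = g y)"
  shows "smooth f"
  unfolding smooth_def
proof (intro allI)
  fix j x
  obtain S g where *: "open S" "x \<in> S" "smooth g" "\<forall>y\<in>S. f y = g y" using assms by blast
  have "(nth_deriv j f has_vector_derivative nth_deriv (Suc j) g x) (at x)"
    using smooth_has_nth_deriv[OF *(3), of j x]
    by (rule has_vector_derivative_transform_within_open[where S=S])
       (use * in \<open>auto intro!: nth_deriv_cong_open[symmetric]\<close>)
  then show "nth_deriv j f differentiable at x" by (rule differentiableI_vector)
qed

subsection \<open>Composition with real functions\<close>

abbreviation cplx :: "(real \<Rightarrow> real) \<Rightarrow> real \<Rightarrow> complex" where
  "cplx q \<equiv> (\<lambda>x. complex_of_real (q x))"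

text \<open>The imaginary part is constantly 0 and so is its derivative; hence the complex
  derivative is the real one.\<close>

lemma D_cplx:
  assumes "cplx q differentiable (at x)"
  shows "(q has_real_derivative deriv q x) (at x)" "D (cplx q) x = of_real (deriv q x)"
proof -
  have d: "(cplx q has_vector_derivative D (cplx q) x) (at x)" using assms by (rule has_D)
  have r: "(q has_real_derivative Re (D (cplx q) x)) (at x)"
    using bounded_linear.has_vector_derivative[OF bounded_linear_Re d]
    by (simp add: has_real_derivative_iff_has_vector_derivative)
  then show "(q has_real_derivative deriv q x) (at x)" by (simp add: DERIV_imp_deriv)
  have "((\<lambda>x. 0) has_vector_derivative Im (D (cplx q) x)) (at x)"
    using bounded_linear.has_vector_derivative[OF bounded_linear_Im d] by simp
  then have "Im (D (cplx q) x) = 0"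
    using vector_derivative_unique_at has_vector_derivative_const by blast
  then show "D (cplx q) x = of_real (deriv q x)"
    using DERIV_imp_deriv[OF r] by (simp add: complex_eq_iff)
qed

lemma has_vector_derivative_cplx:
  "(q has_real_derivative d) (at x) \<Longrightarrow> (cplx q has_vector_derivative of_real d) (at x)"
  by (simp add: has_real_derivative_iff_has_vector_derivative has_vector_derivative_of_real)

lemma has_vector_derivative_compose:
  assumes "(f has_vector_derivative f') (at (q x))" "cplx q differentiable (at x)"
  shows "((\<lambda>x. f (q x)) has_vector_derivative f' * D (cplx q) x) (at x)"
  using vector_diff_chain_at[OF D_cplx(1)[OF assms(2), unfolded has_real_derivative_iff_has_vector_derivative] assms(1)]
  by (simp add: D_cplx[OF assms(2)] o_def scaleR_conv_of_real mult.commute)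

lemma diff_upto_compose:
  "diff_upto k f \<Longrightarrow> diff_upto k (cplx q) \<Longrightarrow> diff_upto k (\<lambda>x. f (q x))"
proof (induction k arbitrary: f)
  case (Suc k)
  have q: "diff_upto k (cplx q)" "diff_upto k (D (cplx q))" "\<And>x. cplx q differentiable (at x)"
    using Suc.prems(2) diff_upto_mono[of "Suc k" "cplx q" k] by (auto simp: diff_upto_Suc)
  from Suc.prems(1) show ?case
    by (elim diff_upto_SucE)
       (rule diff_upto_SucI, rule has_vector_derivative_compose, auto intro!: diff_upto_mult Suc.IH q)
qed simp

lemma smooth_compose: "smooth f \<Longrightarrow> smooth (cplx q) \<Longrightarrow> smooth (\<lambda>x. f (q x))"
  by (simp add: smooth_iff_diff_upto diff_upto_compose)

lemma D_compose:
  assumes "smooth f" "smooth (cplx q)"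
  shows "D (\<lambda>x. f (q x)) = (\<lambda>x. D f (q x) * D (cplx q) x)"
  by (intro D_eqI has_vector_derivative_compose smooth_has_D assms)
     (metis assms(2) nth_deriv_0 smooth_def)

lemma smooth_cplx_deriv:
  assumes "smooth (cplx q)"
  shows "(q has_real_derivative deriv q x) (at x)" "D (cplx q) x = of_real (deriv q x)"
  by (metis assms nth_deriv_0 smooth_def D_cplx)+

lemma smooth_cplx_continuous: "smooth (cplx q) \<Longrightarrow> continuous_on S q"
  using smooth_cplx_deriv(1)[of q] DERIV_isCont continuous_at_imp_continuous_on by blast

text \<open>The derivative of the inverse is the composition of the smooth function 1/q' with the
  inverse, so each order of differentiability gives the next one.\<close>

lemma smooth_inv:
  assumes q: "smooth (cplx q)" "bij q" "\<And>x. deriv q x \<noteq> 0"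
  shows "smooth (cplx (inv q))"
proof -
  have c: "isCont q x" for x
    using smooth_cplx_deriv(1)[OF q(1)] DERIV_isCont by blast
  have inv: "inv q (q x) = x" "q (inv q x) = x" for x
    using q(2) by (simp_all add: bij_is_inj bij_is_surj surj_f_inv_f)
  have ic: "isCont (inv q) x" for x
    using isCont_inverse_function[of 1 "inv q x" "inv q" q] by (simp add: inv c)
  have "(inv q has_real_derivative inverse (deriv q (inv q x))) (at x)" for x
    using DERIV_inverse_function[where a="x-1" and b="x+1", OF smooth_cplx_deriv(1)[OF q(1)] q(3) _ _ inv(2) ic]
    by simp
  then have d: "(cplx (inv q) has_vector_derivative inverse (D (cplx q) (inv q x))) (at x)" for x
    using has_vector_derivative_cplx by (simp add: smooth_cplx_deriv(2)[OF q(1)] flip: of_real_inverse)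
  have s: "smooth (\<lambda>x. inverse (D (cplx q) x))"
    by (intro smooth_inverse smooth_D q(1)) (simp add: smooth_cplx_deriv(2)[OF q(1)] q(3))
  have "diff_upto k (cplx (inv q))" for k
  proof (induction k)
    case (Suc k)
    show ?case
      by (rule diff_upto_SucI[OF d], rule diff_upto_compose[of k "\<lambda>x. inverse (D (cplx q) x)"])
         (use s Suc smooth_iff_diff_upto in blast)+
  qed simp
  then show ?thesis by (simp add: smooth_iff_diff_upto)
qed

lemma smooth_affine: "smooth (cplx (\<lambda>x. a * x + b))"
proof (rule smoothI)
  show "(cplx (\<lambda>x. a * x + b) has_vector_derivative of_real a) (at x)" for x
    by (rule has_vector_derivative_cplx) (auto intro!: derivative_eq_intros)
qed simp

lemma nth_deriv_affine:
  assumes "smooth f"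
  shows "nth_deriv j (\<lambda>x. f (a * x + b)) = (\<lambda>x. of_real a ^ j * nth_deriv j f (a * x + b))"
  using assms
proof (induction j arbitrary: f)
  case (Suc j)
  have "deriv (\<lambda>x. a * x + b) x = a" for x
    by (rule DERIV_imp_deriv) (auto intro!: derivative_eq_intros)
  then have "D (\<lambda>x. f (a * x + b)) = (\<lambda>x. of_real a * D f (a * x + b))"
    using D_compose[OF Suc.prems smooth_affine] smooth_cplx_deriv(2)[OF smooth_affine] by auto
  then show ?case
    using Suc.IH[OF smooth_D[OF Suc.prems]] smooth_compose[OF smooth_D[OF Suc.prems] smooth_affine]
    by (simp add: nth_deriv_Suc' nth_deriv_cmult mult.assoc)
qed simp

lemma nth_deriv_shift: "smooth f \<Longrightarrow> nth_deriv j (\<lambda>x. f (x + b)) = (\<lambda>x. nth_deriv j f (x + b))"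
  using nth_deriv_affine[of f j 1 b] by simp

lemma smooth_shift: "smooth f \<Longrightarrow> smooth (\<lambda>x. f (x + b))"
  using smooth_compose[OF _ smooth_affine[of 1 b], of f] by simp

text \<open>Quantitative Faa di Bruno formula, by induction on the order through
  (h o q)' = (h' o q) q' and the Leibniz rule.\<close>

lemma nth_deriv_compose_bound:
  "\<exists>C\<ge>0. \<forall>h q x A B. smooth h \<longrightarrow> smooth (cplx q) \<longrightarrow> 1 \<le> B \<longrightarrow>
     (\<forall>i\<le>j. cmod (nth_deriv i h (q x)) \<le> A) \<longrightarrow>
     (\<forall>i\<in>{1..j}. cmod (nth_deriv i (cplx q) x) \<le> B) \<longrightarrow>
     cmod (nth_deriv j (\<lambda>x. h (q x)) x) \<le> C * A * B ^ j"
proof (induction j rule: less_induct)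
  case (less j)
  show ?case
  proof (cases j)
    case 0
    then show ?thesis by (intro exI[of _ 1]) auto
  next
    case (Suc k)
    from less[unfolded Suc] obtain C where C0: "\<And>i. i \<le> k \<Longrightarrow> C i \<ge> (0::real)" and
      C: "\<And>i h q x A B. i \<le> k \<Longrightarrow> smooth h \<Longrightarrow> smooth (cplx q) \<Longrightarrow> 1 \<le> B \<Longrightarrow>
         (\<forall>l\<le>i. cmod (nth_deriv l h (q x)) \<le> A) \<Longrightarrow>
         (\<forall>l\<in>{1..i}. cmod (nth_deriv l (cplx q) x) \<le> B) \<Longrightarrow>
         cmod (nth_deriv i (\<lambda>x. h (q x)) x) \<le> C i * A * B ^ i"
      unfolding less_Suc_eq_le by metis
    let ?K = "\<Sum>l\<le>k. real (k choose l) * C (k - l)"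
    show ?thesis
    proof (intro exI[of _ ?K] conjI allI impI)
      show "0 \<le> ?K" by (intro sum_nonneg mult_nonneg_nonneg C0) auto
      fix h q x A B
      assume h: "smooth h" and q: "smooth (cplx q)" and B: "(1::real) \<le> B"
        and A: "\<forall>i\<le>j. cmod (nth_deriv i h (q x)) \<le> A"
        and Bq: "\<forall>i\<in>{1..j}. cmod (nth_deriv i (cplx q) x) \<le> B"
      have A0: "0 \<le> A" using A norm_ge_zero order_trans by blast
      have s: "smooth (\<lambda>x. D h (q x))" "smooth (D (cplx q))"
        using smooth_compose[OF smooth_D[OF h] q] smooth_D[OF q] by simp_all
      have "cmod (of_nat (k choose l) * nth_deriv (k - l) (\<lambda>x. D h (q x)) x * nth_deriv l (D (cplx q)) x)
        \<le> real (k choose l) * C (k - l) * (A * B ^ j)" if l: "l \<le> k" for l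
      proof -
        have 1: "cmod (nth_deriv (k - l) (\<lambda>x. D h (q x)) x) \<le> C (k - l) * A * B ^ (k - l)"
          using A Bq Suc by (intro C smooth_D h q B) (auto simp flip: nth_deriv_Suc')
        have 2: "cmod (nth_deriv l (D (cplx q)) x) \<le> B"
          using Bq l Suc by (auto simp flip: nth_deriv_Suc')
        have "cmod (of_nat (k choose l) * nth_deriv (k - l) (\<lambda>x. D h (q x)) x * nth_deriv l (D (cplx q)) x)
          \<le> real (k choose l) * (C (k - l) * A * B ^ (k - l)) * B"
          unfolding norm_mult norm_of_nat using C0[of "k-l"] A0 B
          by (intro mult_mono 1 2 order_refl mult_nonneg_nonneg) auto
        also have "\<dots> = real (k choose l) * C (k - l) * A * B ^ Suc (k - l)" by (simp add: algebra_simps)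
        also have "\<dots> \<le> real (k choose l) * C (k - l) * A * B ^ j"
          using B A0 C0[of "k-l"] Suc by (intro mult_left_mono power_increasing mult_nonneg_nonneg) auto
        finally show ?thesis by (simp add: mult.assoc)
      qed
      then have "cmod (\<Sum>l\<le>k. of_nat (k choose l) * nth_deriv (k - l) (\<lambda>x. D h (q x)) x * nth_deriv l (D (cplx q)) x)
          \<le> (\<Sum>l\<le>k. real (k choose l) * C (k - l) * (A * B ^ j))"
        by (intro sum_norm_le) auto
      then show "cmod (nth_deriv j (\<lambda>x. h (q x)) x) \<le> ?K * A * B ^ j"
        by (simp add: Suc nth_deriv_Suc' D_compose[OF h q] nth_deriv_mult[OF s] sum_distrib_right mult.assoc)
    qed
  qed
qed

text \<open>The leading term is split off so that the remainder only involves lower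
  derivatives of q.\<close>

lemma nth_deriv_compose_remainder:
  "\<exists>C\<ge>0. \<forall>h q x A B. smooth h \<longrightarrow> smooth (cplx q) \<longrightarrow> 1 \<le> B \<longrightarrow>
     (\<forall>i\<in>{1..Suc k}. cmod (nth_deriv i h (q x)) \<le> A) \<longrightarrow>
     (\<forall>i\<in>{1..k}. cmod (nth_deriv i (cplx q) x) \<le> B) \<longrightarrow>
     cmod (nth_deriv (Suc k) (\<lambda>x. h (q x)) x - D h (q x) * nth_deriv (Suc k) (cplx q) x)
       \<le> C * A * B ^ Suc k"
proof -
  obtain C where C0: "\<And>i. C i \<ge> (0::real)" and
    C: "\<And>i h q x A B. smooth h \<Longrightarrow> smooth (cplx q) \<Longrightarrow> 1 \<le> B \<Longrightarrow>
         (\<forall>l\<le>i. cmod (nth_deriv l h (q x)) \<le> A) \<Longrightarrow>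
         (\<forall>l\<in>{1..i}. cmod (nth_deriv l (cplx q) x) \<le> B) \<Longrightarrow>
         cmod (nth_deriv i (\<lambda>x. h (q x)) x) \<le> C i * A * B ^ i"
    using nth_deriv_compose_bound by metis
  let ?K = "\<Sum>l<k. real (k choose l) * C (k - l)"
  show ?thesis
  proof (intro exI[of _ ?K] conjI allI impI)
    show "0 \<le> ?K" by (intro sum_nonneg mult_nonneg_nonneg C0) auto
    fix h q x A B
    assume h: "smooth h" and q: "smooth (cplx q)" and B: "(1::real) \<le> B"
      and A: "\<forall>i\<in>{1..Suc k}. cmod (nth_deriv i h (q x)) \<le> A"
      and Bq: "\<forall>i\<in>{1..k}. cmod (nth_deriv i (cplx q) x) \<le> B"
    have "cmod (nth_deriv 1 h (q x)) \<le> A" using A by auto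
    then have A0: "0 \<le> A" using norm_ge_zero order_trans by blast
    have s: "smooth (\<lambda>x. D h (q x))" "smooth (D (cplx q))"
      using smooth_compose[OF smooth_D[OF h] q] smooth_D[OF q] by simp_all
    let ?t = "\<lambda>l. of_nat (k choose l) * nth_deriv (k - l) (\<lambda>x. D h (q x)) x * nth_deriv l (D (cplx q)) x"
    have "cmod (?t l) \<le> real (k choose l) * C (k - l) * (A * B ^ Suc k)" if l: "l < k" for l
    proof -
      have 1: "cmod (nth_deriv (k - l) (\<lambda>x. D h (q x)) x) \<le> C (k - l) * A * B ^ (k - l)"
        using A Bq by (intro C smooth_D h q B) (auto simp flip: nth_deriv_Suc')
      have 2: "cmod (nth_deriv l (D (cplx q)) x) \<le> B"
        using Bq l by (auto simp flip: nth_deriv_Suc')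
      have "cmod (?t l) \<le> real (k choose l) * (C (k - l) * A * B ^ (k - l)) * B"
        unfolding norm_mult norm_of_nat using C0[of "k-l"] A0 B
        by (intro mult_mono 1 2 order_refl mult_nonneg_nonneg) auto
      also have "\<dots> = real (k choose l) * C (k - l) * A * B ^ Suc (k - l)" by (simp add: algebra_simps)
      also have "\<dots> \<le> real (k choose l) * C (k - l) * A * B ^ Suc k"
        using B A0 C0[of "k-l"] by (intro mult_left_mono power_increasing mult_nonneg_nonneg) auto
      finally show ?thesis by (simp add: mult.assoc)
    qed
    then have "cmod (\<Sum>l<k. ?t l) \<le> (\<Sum>l<k. real (k choose l) * C (k - l) * (A * B ^ Suc k))"
      by (intro sum_norm_le) auto
    moreover have "nth_deriv (Suc k) (\<lambda>x. h (q x)) x = (\<Sum>l<k. ?t l) + D h (q x) * nth_deriv (Suc k) (cplx q) x"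
      by (simp add: nth_deriv_Suc' D_compose[OF h q] nth_deriv_mult[OF s] flip: lessThan_Suc_atMost)
    ultimately show "cmod (nth_deriv (Suc k) (\<lambda>x. h (q x)) x - D h (q x) * nth_deriv (Suc k) (cplx q) x)
       \<le> ?K * A * B ^ Suc k"
      by (simp add: sum_distrib_right mult.assoc)
  qed
qed

section \<open>Cut-off functions and locally finite sums\<close>

text \<open>Carrying a polynomial in 1/x in front of exp(-1/x) makes the family closed under
  differentiation; \<open>flat 1\<close> is the classical flat function.\<close>

definition flat :: "real poly \<Rightarrow> real \<Rightarrow> real" where
  "flat p x = (if 0 < x then poly p (1 / x) * exp (- (1 / x)) else 0)"

lemma poly_exp_tendsto_0: "((\<lambda>t::real. poly p t * exp (- t)) \<longlongrightarrow> 0) at_top"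
proof -
  have "((\<lambda>t. \<Sum>i\<le>degree p. coeff p i * (t ^ i / exp t)) \<longlongrightarrow> (\<Sum>i\<le>degree p. coeff p i * 0)) at_top"
    by (intro tendsto_sum tendsto_mult tendsto_const tendsto_power_div_exp_0)
  then show ?thesis
    by (simp add: poly_altdef sum_distrib_right exp_minus divide_inverse mult.assoc)
qed

lemma flat_tendsto_0: "(flat p \<longlongrightarrow> 0) (at 0)"
proof -
  have "((\<lambda>x. poly p (inverse x) * exp (- inverse x)) \<longlongrightarrow> 0) (at_right 0)"
    by (rule filterlim_compose[OF poly_exp_tendsto_0 filterlim_inverse_at_top_right])
  moreover have "\<forall>\<^sub>F x in at_right 0. poly p (inverse x) * exp (- inverse x) = flat p x"
    using eventually_at_right_less[of 0] by eventually_elim (simp add: flat_def divide_inverse)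
  ultimately have "(flat p \<longlongrightarrow> 0) (at_right 0)"
    by (rule Lim_transform_eventually)
  moreover have "(flat p \<longlongrightarrow> 0) (at_left 0)"
    by (rule Lim_transform_eventually[OF tendsto_const])
       (auto simp: flat_def eventually_at_filter)
  ultimately show ?thesis by (simp add: filterlim_at_split)
qed

text \<open>With t = 1/x and dt/dx = -t^2, the derivative of p(t) exp(-t) is t^2 (p(t) - p'(t))
  exp(-t).\<close>

lemma DERIV_flat: "(flat p has_real_derivative flat ([:0, 0, 1:] * (p - pderiv p)) x) (at x)"
proof -
  consider "x > 0" | "x < 0" | "x = 0" by linarith
  then show ?thesis
  proof cases
    case 1
    have "((\<lambda>x. poly p (1 / x) * exp (- (1 / x))) has_real_derivative
        flat ([:0, 0, 1:] * (p - pderiv p)) x) (at x)"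
      using 1 by (auto intro!: derivative_eq_intros simp: flat_def field_simps power2_eq_square)
    then show ?thesis
      by (rule has_field_derivative_transform_within_open[where S="{0<..}"]) (use 1 in \<open>auto simp: flat_def\<close>)
  next
    case 2
    have "((\<lambda>x. 0) has_real_derivative flat ([:0, 0, 1:] * (p - pderiv p)) x) (at x)"
      using 2 by (simp add: flat_def)
    then show ?thesis
      by (rule has_field_derivative_transform_within_open[where S="{..<0}"]) (use 2 in \<open>auto simp: flat_def\<close>)
  next
    case 3
    \<comment> \<open>The difference quotient at 0 belongs to the family again, with p multiplied by
      its variable, so it tends to 0.\<close>
    have "flat (pCons 0 p) = (\<lambda>h. flat p h / h)"
      by (auto simp: flat_def)
    moreover have "flat q 0 = 0" for q
      by (simp add: flat_def)
    ultimately show ?thesis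
      using flat_tendsto_0[of "pCons 0 p"] 3 by (simp add: DERIV_def)
  qed
qed

lemma smooth_flat: "smooth (cplx (flat p))"
proof -
  have "diff_upto k (cplx (flat p))" for k
  proof (induction k arbitrary: p)
    case (Suc k)
    show ?case by (rule diff_upto_SucI[OF has_vector_derivative_cplx[OF DERIV_flat] Suc.IH])
  qed simp
  then show ?thesis by (simp add: smooth_iff_diff_upto)
qed

definition transition :: "real \<Rightarrow> real \<Rightarrow> real \<Rightarrow> real" where
  "transition a b x = flat 1 (x - a) / (flat 1 (x - a) + flat 1 (b - x))"

lemma transition_denom_pos: "a < b \<Longrightarrow> 0 < flat 1 (x - a) + flat 1 (b - x)"
  by (auto simp: flat_def intro: add_pos_nonneg add_nonneg_pos)

lemma transition_left: "x \<le> a \<Longrightarrow> transition a b x = 0"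
  by (simp add: transition_def flat_def)

lemma transition_right: "a < b \<Longrightarrow> b \<le> x \<Longrightarrow> transition a b x = 1"
  by (simp add: transition_def flat_def)

lemma transition_nonneg: "0 \<le> transition a b x"
  by (auto simp: transition_def flat_def)

lemma smooth_transition:
  assumes "a < b" shows "smooth (cplx (transition a b))"
proof -
  have 1: "smooth (cplx (\<lambda>x. flat 1 (x - a)))"
    using smooth_shift[OF smooth_flat, of 1 "- a"] by simp
  have 2: "smooth (cplx (\<lambda>x. flat 1 (b - x)))"
    using smooth_compose[OF smooth_flat smooth_affine[of "-1" b], of 1] by simp
  have "smooth (\<lambda>x. inverse (complex_of_real (flat 1 (x - a)) + of_real (flat 1 (b - x))))"
    by (intro smooth_inverse smooth_add 1 2)
       (metis transition_denom_pos[OF assms] of_real_add of_real_eq_0_iff less_irrefl)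
  from smooth_mult[OF 1 this] show ?thesis
    by (simp add: transition_def divide_inverse)
qed

text \<open>The strict sign inside the interval is what later makes the derivative of the Abel
  function positive everywhere.\<close>

lemma DERIV_transition:
  assumes "a < b"
  obtains d where "(transition a b has_real_derivative d) (at x)" "0 \<le> d" "a < x \<Longrightarrow> x < b \<Longrightarrow> 0 < d"
proof
  \<comment> \<open>\<open>?g\<close> is the derivative of \<open>?f\<close>: for p = 1 the
    polynomial t^2 (p - p') is t^2.\<close>
  let ?f = "flat 1" and ?g = "flat [:0, 0, 1:]"
  let ?s = "?f (x - a) + ?f (b - x)"
  let ?d = "(?g (x - a) * ?f (b - x) + ?f (x - a) * ?g (b - x)) / ?s\<^sup>2"
  have D: "(?f has_real_derivative ?g y) (at y)" for y
    using DERIV_flat[of 1 y] by simp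
  have 1: "((\<lambda>x. ?f (x - a)) has_real_derivative ?g (x - a)) (at x)"
    by (rule DERIV_chain2[OF D, THEN DERIV_cong]) (auto intro!: derivative_eq_intros)
  have 2: "((\<lambda>x. ?f (b - x)) has_real_derivative - ?g (b - x)) (at x)"
    by (rule DERIV_chain2[OF D, THEN DERIV_cong]) (auto intro!: derivative_eq_intros)
  show "(transition a b has_real_derivative ?d) (at x)"
    unfolding transition_def[abs_def] using transition_denom_pos[OF assms, of x]
    by (auto intro!: derivative_eq_intros 1 2 simp: field_simps power2_eq_square)
  show "0 \<le> ?d" by (intro divide_nonneg_nonneg add_nonneg_nonneg mult_nonneg_nonneg) (auto simp: flat_def)
  show "0 < ?d" if "a < x" "x < b"
    using that transition_denom_pos[OF assms, of x]
    by (intro divide_pos_pos add_pos_pos mult_pos_pos) (auto simp: flat_def)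
qed

definition bump :: "real \<Rightarrow> real" where
  "bump x = transition (- 2) (- 1) x * transition (- 2) (- 1) (- x)"

lemma smooth_bump: "smooth (cplx bump)"
  using smooth_mult[OF smooth_transition[of "-2" "-1"]
      smooth_compose[OF smooth_transition[of "-2" "-1"] smooth_affine[of "-1" 0]]]
  by (simp add: bump_def)

lemma bump_eq_1: "\<bar>x\<bar> \<le> 1 \<Longrightarrow> bump x = 1"
  by (simp add: bump_def transition_right)

lemma bump_eq_0: "2 \<le> \<bar>x\<bar> \<Longrightarrow> bump x = 0"
  by (auto simp: bump_def transition_left abs_if split: if_splits)

lemma bump_nonneg: "0 \<le> bump x"
  by (simp add: bump_def transition_nonneg)

lemma compact_support_nth_deriv_bounded:
  assumes "smooth f" "\<And>x. R < \<bar>x\<bar> \<Longrightarrow> f x = 0"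
  obtains M where "0 \<le> M" "\<And>x. cmod (nth_deriv j f x) \<le> M"
proof -
  have "compact (nth_deriv j f ` {-R..R})"
    by (intro compact_continuous_image smooth_continuous_on assms compact_Icc)
  then obtain M where M: "\<And>y. y \<in> nth_deriv j f ` {-R..R} \<Longrightarrow> cmod y \<le> M"
    using compact_imp_bounded bounded_iff by metis
  show thesis
  proof
    fix x
    show "cmod (nth_deriv j f x) \<le> max 0 M"
    proof (cases "R < \<bar>x\<bar>")
      case True
      have "open {x. R < \<bar>x\<bar>}" by (intro open_Collect_less continuous_intros)
      then have "nth_deriv j f x = 0"
        by (rule nth_deriv_zero_open) (use assms True in auto)
      then show ?thesis by simp
    next
      case False
      then show ?thesis using M[of "nth_deriv j f x"] by fastforce
    qed
  qed simp
qed

section \<open>Locally finite sums of smooth functions\<close>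

definition lsum :: "('i \<Rightarrow> real \<Rightarrow> complex) \<Rightarrow> real \<Rightarrow> complex" where
  "lsum F x = (\<Sum>n | F n x \<noteq> 0. F n x)"

definition locally_finite_family :: "('i \<Rightarrow> real \<Rightarrow> complex) \<Rightarrow> bool" where
  "locally_finite_family F \<longleftrightarrow>
     (\<forall>M. \<exists>I. finite I \<and> (\<forall>n x. \<bar>x\<bar> < M \<longrightarrow> n \<notin> I \<longrightarrow> F n x = 0))"

text \<open>Only where some finite index set carries all non-zero terms is \<open>lsum\<close> a
  genuine sum; with infinitely many it would take the default value 0. Local finiteness supplies
  such a set on every bounded interval.\<close>

lemma lsum_eq_sum: "finite I \<Longrightarrow> (\<And>n. n \<notin> I \<Longrightarrow> F n x = 0) \<Longrightarrow> lsum F x = (\<Sum>n\<in>I. F n x)"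
  unfolding lsum_def by (rule sum.mono_neutral_left) auto

lemma locally_finite_family_obtain:
  assumes "locally_finite_family F"
  obtains I where "finite I" "\<And>n x j. \<bar>x\<bar> < M \<Longrightarrow> n \<notin> I \<Longrightarrow> nth_deriv j (F n) x = 0"
proof -
  obtain I where I: "finite I" "\<And>n x. \<bar>x\<bar> < M \<Longrightarrow> n \<notin> I \<Longrightarrow> F n x = 0"
    using assms unfolding locally_finite_family_def by metis
  have "open {x. \<bar>x\<bar> < M}" by (intro open_Collect_less continuous_intros)
  then have "nth_deriv j (F n) x = 0" if "\<bar>x\<bar> < M" "n \<notin> I" for n x j
    by (rule nth_deriv_zero_open) (use that I in auto)
  with I(1) that show thesis by blast
qed

text \<open>On each bounded interval the sum coincides with one fixed finite sum, and both
  smoothness and derivatives are local.\<close>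

lemma
  assumes lf: "locally_finite_family F" and s: "\<And>n. smooth (F n)"
  shows smooth_lsum: "smooth (lsum F)"
    and nth_deriv_lsum: "nth_deriv j (lsum F) = lsum (\<lambda>n. nth_deriv j (F n))"
proof -
  have *: "\<exists>I. finite I \<and> (\<forall>x. \<bar>x\<bar> < M \<longrightarrow> lsum F x = (\<Sum>n\<in>I. F n x)) \<and>
      (\<forall>x. \<bar>x\<bar> < M \<longrightarrow> lsum (\<lambda>n. nth_deriv j (F n)) x = (\<Sum>n\<in>I. nth_deriv j (F n) x))" for M j
  proof -
    obtain I where I: "finite I" "\<And>n x j. \<bar>x\<bar> < M \<Longrightarrow> n \<notin> I \<Longrightarrow> nth_deriv j (F n) x = 0"
      using locally_finite_family_obtain[OF lf] by metis
    show ?thesis using I(1) I(2)[where j=0] I(2)[where j=j] by (intro exI[of _ I]) (auto intro!: lsum_eq_sum)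
  qed
  have o: "open {x::real. \<bar>x\<bar> < M}" for M by (intro open_Collect_less continuous_intros)
  show "smooth (lsum F)"
  proof (rule smooth_local)
    fix x :: real
    obtain I where "\<forall>y. \<bar>y\<bar> < \<bar>x\<bar> + 1 \<longrightarrow> lsum F y = (\<Sum>n\<in>I. F n y)"
      using * by metis
    then show "\<exists>S g. open S \<and> x \<in> S \<and> smooth g \<and> (\<forall>y\<in>S. lsum F y = g y)"
      using o[of "\<bar>x\<bar> + 1"] smooth_sum[of I F] s by (intro exI[of _ "{y. \<bar>y\<bar> < \<bar>x\<bar> + 1}"]) auto
  qed
  show "nth_deriv j (lsum F) = lsum (\<lambda>n. nth_deriv j (F n))"
  proof
    fix x :: real
    obtain I where I: "\<forall>y. \<bar>y\<bar> < \<bar>x\<bar> + 1 \<longrightarrow> lsum F y = (\<Sum>n\<in>I. F n y)"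
      "\<forall>y. \<bar>y\<bar> < \<bar>x\<bar> + 1 \<longrightarrow> lsum (\<lambda>n. nth_deriv j (F n)) y = (\<Sum>n\<in>I. nth_deriv j (F n) y)"
      using * by metis
    have "nth_deriv j (lsum F) x = nth_deriv j (\<lambda>y. \<Sum>n\<in>I. F n y) x"
      by (rule nth_deriv_cong_open[OF o[of "\<bar>x\<bar> + 1"]]) (use I in auto)
    also have "\<dots> = (\<Sum>n\<in>I. nth_deriv j (F n) x)"
      by (subst nth_deriv_sum) (auto intro: s)
    finally show "nth_deriv j (lsum F) x = lsum (\<lambda>n. nth_deriv j (F n)) x"
      using I(2) by simp
  qed
qed

section \<open>Rapidly decreasing majorants\<close>

lemma one_plus_power_le: "(1 + t) ^ k \<le> 2 ^ k * (1 + t ^ k)" if "0 \<le> t" for t :: real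
proof -
  have "(1 + t) ^ k \<le> (2 * max 1 t) ^ k" using that by (intro power_mono) auto
  also have "\<dots> = 2 ^ k * (max 1 t) ^ k" by (simp add: power_mult_distrib)
  also have "\<dots> \<le> 2 ^ k * (1 + t ^ k)" using that by (intro mult_left_mono) (auto simp: max_def)
  finally show ?thesis .
qed

text \<open>The weights (1 + |x|)^k, unlike x^k, are at least 1 and increase with k, so exponents
  can be added and compared freely.\<close>

lemma Schwartz_iff:
  "v \<in> Schwartz \<longleftrightarrow> smooth v \<and> (\<forall>k j. \<exists>C. \<forall>x. (1 + \<bar>x\<bar>) ^ k * cmod (nth_deriv j v x) \<le> C)"
proof
  assume v: "v \<in> Schwartz"
  have s: "smooth v" using v by (auto simp: Schwartz_def C_class_def smooth_def)
  have "\<exists>C. \<forall>x. (1 + \<bar>x\<bar>) ^ k * cmod (nth_deriv j v x) \<le> C" for k j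
  proof -
    have "bounded (range (\<lambda>x. x ^ 0 *\<^sub>R nth_deriv j v x))" "bounded (range (\<lambda>x. x ^ k *\<^sub>R nth_deriv j v x))"
      using v unfolding Schwartz_def by blast+
    then obtain a b where "\<And>x. cmod (nth_deriv j v x) \<le> a" "\<And>x. \<bar>x\<bar> ^ k * cmod (nth_deriv j v x) \<le> b"
      by (force simp: bounded_iff power_abs)
    then have "2 ^ k * (cmod (nth_deriv j v x) + \<bar>x\<bar> ^ k * cmod (nth_deriv j v x)) \<le> 2 ^ k * (a + b)" for x
      by (intro mult_left_mono add_mono) auto
    moreover have "(1 + \<bar>x\<bar>) ^ k * cmod (nth_deriv j v x)
        \<le> 2 ^ k * (cmod (nth_deriv j v x) + \<bar>x\<bar> ^ k * cmod (nth_deriv j v x))" for x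
      using mult_right_mono[OF one_plus_power_le[of "\<bar>x\<bar>" k], of "cmod (nth_deriv j v x)"]
      by (simp add: algebra_simps)
    ultimately show ?thesis using order_trans by blast
  qed
  with s show "smooth v \<and> (\<forall>k j. \<exists>C. \<forall>x. (1 + \<bar>x\<bar>) ^ k * cmod (nth_deriv j v x) \<le> C)" by blast
next
  assume v: "smooth v \<and> (\<forall>k j. \<exists>C. \<forall>x. (1 + \<bar>x\<bar>) ^ k * cmod (nth_deriv j v x) \<le> C)"
  have "bounded (range (\<lambda>x. x ^ k *\<^sub>R nth_deriv j v x))" for k j
  proof -
    obtain C where "\<And>x. (1 + \<bar>x\<bar>) ^ k * cmod (nth_deriv j v x) \<le> C" using v by blast
    moreover have "\<bar>x\<bar> ^ k * cmod (nth_deriv j v x) \<le> (1 + \<bar>x\<bar>) ^ k * cmod (nth_deriv j v x)" for x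
      by (intro mult_right_mono power_mono) auto
    ultimately have "norm (x ^ k *\<^sub>R nth_deriv j v x) \<le> C" for x
      by (simp add: power_abs) (meson order_trans)
    then show ?thesis by (auto simp: bounded_iff)
  qed
  then show "v \<in> Schwartz"
    using v smooth_continuous_on by (auto simp: Schwartz_def C_class_def smooth_def)
qed

lemma Schwartz_bound:
  assumes "v \<in> Schwartz"
  obtains C where "0 \<le> C" "\<And>x. (1 + \<bar>x\<bar>) ^ k * cmod (v x) \<le> C"
proof -
  obtain C where C: "\<And>x. (1 + \<bar>x\<bar>) ^ k * cmod (nth_deriv 0 v x) \<le> C"
    using assms unfolding Schwartz_iff by metis
  have "0 \<le> C" using C[of 0] by (auto intro: order_trans[rotated])
  with C that show thesis by auto
qed

definition rapid :: "(real \<Rightarrow> real) \<Rightarrow> bool" where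
  "rapid u \<longleftrightarrow> (\<forall>k. \<exists>C. \<forall>x. (1 + \<bar>x\<bar>) ^ k * u x \<le> C)"

text \<open>Since u may be irregular, it is first replaced by its suprema \<open>c n\<close> on the
  intervals [n, n+1], which still decay rapidly, and these are spread out smoothly by bumps centred
  at n + 1/2.\<close>

lemma Schwartz_majorant:
  assumes u: "rapid u" "\<And>x. 0 \<le> u x"
  obtains w where "w \<in> Schwartz" "\<And>x. u x \<le> cmod (w x)"
proof -
  define c where "c n = (SUP y\<in>{of_int n..of_int n + 1}. u y)" for n :: int
  define F where "F n x = complex_of_real (c n) * cplx bump (x + (- of_int n - 1/2))" for n x
  obtain C where C: "\<And>k x. (1 + \<bar>x\<bar>) ^ k * u x \<le> C k"
    using u(1) unfolding rapid_def by metis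
  have bdd: "bdd_above (u ` S)" for S using C[of _ 0] by (auto simp: bdd_above_def)
  have c_ge: "u x \<le> c n" if "of_int n \<le> x" "x \<le> of_int n + 1" for x n
    unfolding c_def using that by (intro cSUP_upper bdd) auto
  have c0: "0 \<le> c n" for n using c_ge[of n "of_int n"] u(2)[of "of_int n"] by simp
  \<comment> \<open>A point x in the support of the n-th bump is at distance at most 5/2 from every
    y in [n, n+1], so that 1 + |x| \<le> 4 (1 + |y|).\<close>
  have c_le: "(1 + \<bar>x\<bar>) ^ k * c n \<le> 4 ^ k * C k" if "\<bar>x - of_int n - 1/2\<bar> \<le> 2" for x n k
  proof -
    have "u y \<le> 4 ^ k * C k / (1 + \<bar>x\<bar>) ^ k" if y: "y \<in> {of_int n..of_int n + 1}" for y
    proof -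
      have "1 + \<bar>x\<bar> \<le> 4 * (1 + \<bar>y\<bar>)" using y \<open>\<bar>x - of_int n - 1/2\<bar> \<le> 2\<close> by (auto simp: abs_le_iff)
      then have "(1 + \<bar>x\<bar>) ^ k * u y \<le> (4 * (1 + \<bar>y\<bar>)) ^ k * u y"
        by (intro mult_right_mono power_mono u) auto
      also have "\<dots> = 4 ^ k * ((1 + \<bar>y\<bar>) ^ k * u y)" by (simp only: power_mult_distrib mult.assoc)
      also have "\<dots> \<le> 4 ^ k * C k" by (intro mult_left_mono C) auto
      finally show ?thesis by (simp add: field_simps add_pos_nonneg)
    qed
    then have "c n \<le> 4 ^ k * C k / (1 + \<bar>x\<bar>) ^ k" unfolding c_def by (intro cSUP_least) auto
    then show ?thesis by (simp add: field_simps add_pos_nonneg)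
  qed
  have sF: "smooth (F n)" for n
    unfolding F_def[abs_def] by (intro smooth_mult smooth_const smooth_shift smooth_bump)
  have nF: "nth_deriv j (F n) x = of_real (c n) * nth_deriv j (cplx bump) (x - of_int n - 1/2)" for j n x
    unfolding F_def[abs_def] nth_deriv_cmult[OF smooth_shift[OF smooth_bump]] nth_deriv_shift[OF smooth_bump]
    by (simp add: algebra_simps)
  have F0: "nth_deriv j (F n) x = 0" if "2 < \<bar>x - of_int n - 1/2\<bar>" for n x j
  proof -
    have "open {y::real. 2 < \<bar>y\<bar>}" by (intro open_Collect_less continuous_intros)
    then have "nth_deriv j (cplx bump) (x - of_int n - 1/2) = 0"
      by (rule nth_deriv_zero_open) (use that in \<open>auto simp: bump_eq_0\<close>)
    then show ?thesis by (simp add: nF)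
  qed
  \<comment> \<open>At most 7 bumps are non-zero at a given point; this is the factor 7 in the
    estimate of the derivatives.\<close>
  have near: "n \<in> {\<lfloor>x\<rfloor> - 3..\<lfloor>x\<rfloor> + 3}" if "\<bar>x - of_int n - 1/2\<bar> \<le> 2" for x :: real and n
    using that by (simp add: abs_le_iff) linarith
  have lf: "locally_finite_family F"
    unfolding locally_finite_family_def
  proof
    fix M :: real
    have "F n x = 0" if "\<bar>x\<bar> < M" "n \<notin> {- \<lceil>M\<rceil> - 5..\<lceil>M\<rceil> + 5}" for n x
    proof -
      have "n < - \<lceil>M\<rceil> - 5 \<or> \<lceil>M\<rceil> + 5 < n" using that by auto
      then have "real_of_int n < - M - 4 \<or> M + 4 < real_of_int n" by linarith
      then have "2 < \<bar>x - of_int n - 1/2\<bar>" using that(1) by linarith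
      then show ?thesis using F0[of x n 0] by simp
    qed
    then show "\<exists>I. finite I \<and> (\<forall>n x. \<bar>x\<bar> < M \<longrightarrow> n \<notin> I \<longrightarrow> F n x = 0)"
      by (intro exI[of _ "{- \<lceil>M\<rceil> - 5..\<lceil>M\<rceil> + 5}"]) auto
  qed
  have ls: "nth_deriv j (lsum F) x = (\<Sum>n\<in>{\<lfloor>x\<rfloor> - 3..\<lfloor>x\<rfloor> + 3}. nth_deriv j (F n) x)" for j x
    unfolding nth_deriv_lsum[OF lf sF]
  proof (rule lsum_eq_sum)
    show "nth_deriv j (F n) x = 0" if "n \<notin> {\<lfloor>x\<rfloor> - 3..\<lfloor>x\<rfloor> + 3}" for n
      using that near F0 by (meson not_le)
  qed simp
  have "lsum F \<in> Schwartz"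
    unfolding Schwartz_iff
  proof (intro conjI allI smooth_lsum lf sF)
    fix k j
    obtain M where M: "0 \<le> M" "\<And>x. cmod (nth_deriv j (cplx bump) x) \<le> M"
      by (rule compact_support_nth_deriv_bounded[OF smooth_bump, of 2 j]) (auto simp: bump_eq_0)
    have "(1 + \<bar>x\<bar>) ^ k * cmod (nth_deriv j (lsum F) x) \<le> 7 * (4 ^ k * C k * M)" for x
    proof -
      have "(1 + \<bar>x\<bar>) ^ k * cmod (nth_deriv j (F n) x) \<le> 4 ^ k * C k * M" for n
      proof (cases "\<bar>x - of_int n - 1/2\<bar> \<le> 2")
        case True
        have "(1 + \<bar>x\<bar>) ^ k * cmod (nth_deriv j (F n) x)
            = ((1 + \<bar>x\<bar>) ^ k * c n) * cmod (nth_deriv j (cplx bump) (x - of_int n - 1/2))"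
          using c0 by (simp add: nF norm_mult)
        also have "\<dots> \<le> 4 ^ k * C k * M"
        proof (rule mult_mono[OF c_le[OF True] M(2)])
          show "0 \<le> 4 ^ k * C k" using c_le[OF True, of k] c0[of n] by (auto intro: order_trans[rotated])
        qed simp
        finally show ?thesis .
      next
        case False
        have "0 \<le> C k" using C[of 0 k] u(2)[of 0] by simp
        then show ?thesis using False F0 M(1) by simp
      qed
      then have "(\<Sum>n\<in>{\<lfloor>x\<rfloor> - 3..\<lfloor>x\<rfloor> + 3}. (1 + \<bar>x\<bar>) ^ k * cmod (nth_deriv j (F n) x))
          \<le> (\<Sum>n\<in>{\<lfloor>x\<rfloor> - 3..\<lfloor>x\<rfloor> + 3}. 4 ^ k * C k * M)" by (intro sum_mono)
      then have "(1 + \<bar>x\<bar>) ^ k * (\<Sum>n\<in>{\<lfloor>x\<rfloor> - 3..\<lfloor>x\<rfloor> + 3}. cmod (nth_deriv j (F n) x)) \<le> 7 * (4 ^ k * C k * M)"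
        by (simp add: sum_distrib_left)
      moreover have "(1 + \<bar>x\<bar>) ^ k * cmod (nth_deriv j (lsum F) x)
          \<le> (1 + \<bar>x\<bar>) ^ k * (\<Sum>n\<in>{\<lfloor>x\<rfloor> - 3..\<lfloor>x\<rfloor> + 3}. cmod (nth_deriv j (F n) x))"
        unfolding ls by (intro mult_left_mono norm_sum) auto
      ultimately show ?thesis by linarith
    qed
    then show "\<exists>C. \<forall>x. (1 + \<bar>x\<bar>) ^ k * cmod (nth_deriv j (lsum F) x) \<le> C" by blast
  qed
  moreover have "u x \<le> cmod (lsum F x)" for x
  proof -
    let ?I = "{\<lfloor>x\<rfloor> - 3..\<lfloor>x\<rfloor> + 3}"
    let ?t = "\<lambda>n. c n * bump (x - of_int n - 1/2)"
    have "\<bar>x - of_int \<lfloor>x\<rfloor> - 1/2\<bar> \<le> 1" by linarith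
    \<comment> \<open>All terms are non-negative, so nothing cancels and the bump over the unit
      interval containing x already dominates u.\<close>
    then have "u x \<le> ?t \<lfloor>x\<rfloor>" using c_ge[of "\<lfloor>x\<rfloor>" x] by (simp add: bump_eq_1)
    also have "\<dots> \<le> sum ?t ?I"
      by (rule member_le_sum) (auto intro!: mult_nonneg_nonneg c0 bump_nonneg)
    also have "\<dots> \<le> cmod (lsum F x)"
      using ls[of 0 x] complex_Re_le_cmod[of "lsum F x"]
      by (simp add: F_def algebra_simps Re_sum flip: of_real_mult)
    finally show ?thesis .
  qed
  ultimately show thesis by (rule that)
qed

lemma rapid_Schwartz: "v \<in> Schwartz \<Longrightarrow> rapid (\<lambda>x. cmod (v x) * (C * (1 + \<bar>x\<bar>) ^ l))"
  unfolding rapid_def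
proof
  fix k
  assume "v \<in> Schwartz"
  then obtain B where B: "\<And>x. (1 + \<bar>x\<bar>) ^ (k + l) * cmod (v x) \<le> B" using Schwartz_bound by blast
  have "(1 + \<bar>x\<bar>) ^ k * (cmod (v x) * (C * (1 + \<bar>x\<bar>) ^ l)) \<le> \<bar>C\<bar> * B" for x
  proof -
    have "(1 + \<bar>x\<bar>) ^ k * (cmod (v x) * (C * (1 + \<bar>x\<bar>) ^ l)) = C * ((1 + \<bar>x\<bar>) ^ (k + l) * cmod (v x))"
      by (simp add: power_add algebra_simps)
    also have "\<dots> \<le> \<bar>C\<bar> * ((1 + \<bar>x\<bar>) ^ (k + l) * cmod (v x))" by (intro mult_right_mono) auto
    also have "\<dots> \<le> \<bar>C\<bar> * B" by (intro mult_left_mono B) auto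
    finally show ?thesis .
  qed
  then show "\<exists>B. \<forall>x. (1 + \<bar>x\<bar>) ^ k * (cmod (v x) * (C * (1 + \<bar>x\<bar>) ^ l)) \<le> B" by blast
qed

lemma rapid_add: "rapid u \<Longrightarrow> rapid w \<Longrightarrow> rapid (\<lambda>x. u x + w x)"
  unfolding rapid_def by (simp add: distrib_left) (meson add_mono)

lemma rapid_bounded_support:
  assumes "\<And>x. R < \<bar>x\<bar> \<Longrightarrow> u x = 0" "\<And>x. u x \<le> B"
  shows "rapid u"
  unfolding rapid_def
proof
  fix k
  have "(1 + \<bar>x\<bar>) ^ k * u x \<le> (1 + \<bar>R\<bar>) ^ k * \<bar>B\<bar>" for x
  proof (cases "R < \<bar>x\<bar>")
    case False
    then have "(1 + \<bar>x\<bar>) ^ k * u x \<le> (1 + \<bar>x\<bar>) ^ k * \<bar>B\<bar>"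
      using assms(2)[of x] by (intro mult_left_mono) auto
    also have "\<dots> \<le> (1 + \<bar>R\<bar>) ^ k * \<bar>B\<bar>" using False by (intro mult_right_mono power_mono) auto
    finally show ?thesis .
  qed (simp add: assms(1))
  then show "\<exists>C. \<forall>x. (1 + \<bar>x\<bar>) ^ k * u x \<le> C" by blast
qed

text \<open>Such a weight turns a seminorm estimate into a uniform estimate on a bounded
  interval.\<close>

lemma Schwartz_ge_indicator:
  obtains w where "w \<in> Schwartz" "\<And>x. \<bar>x\<bar> \<le> R \<Longrightarrow> 1 \<le> cmod (w x)"
proof -
  obtain w where w: "w \<in> Schwartz" "\<And>x. indicat_real {x. \<bar>x\<bar> \<le> R} x \<le> cmod (w x)"
    by (rule Schwartz_majorant[of "indicat_real {x. \<bar>x\<bar> \<le> R}"])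
       (auto intro!: rapid_bounded_support[of R _ 1] simp: indicator_def)
  have "1 \<le> cmod (w x)" if "\<bar>x\<bar> \<le> R" for x using w(2)[of x] that by simp
  with w(1) show thesis by (rule that)
qed

text \<open>If no power of 1 + |x| dominates the values, then pairs (X k, Y k) violating the k-th
  bound escape to infinity, and a Schwartz majorant of the function equal to
  (1 + |X k|)^(-k) at X k detects them.\<close>

lemma polynomial_bound_if_Schwartz_bounded:
  fixes Z :: "(real \<times> real) set"
  assumes Z: "\<And>v. v \<in> Schwartz \<Longrightarrow> \<exists>B. \<forall>(x, y)\<in>Z. cmod (v x) * y \<le> B"
  shows "\<exists>C k. 0 \<le> C \<and> (\<forall>(x, y)\<in>Z. y \<le> C * (1 + \<bar>x\<bar>) ^ k)"
proof (rule ccontr)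
  assume neg: "\<not> ?thesis"
  have "\<exists>B\<ge>0. \<forall>(x, y)\<in>Z. \<bar>x\<bar> \<le> real k \<longrightarrow> y \<le> B" for k :: nat
  proof -
    obtain v where v: "v \<in> Schwartz" "\<And>x. \<bar>x\<bar> \<le> real k \<Longrightarrow> 1 \<le> cmod (v x)"
      using Schwartz_ge_indicator[of "real k"] by blast
    obtain B where B: "\<And>x y. (x, y) \<in> Z \<Longrightarrow> cmod (v x) * y \<le> B" using Z[OF v(1)] by blast
    have "y \<le> \<bar>B\<bar>" if "(x, y) \<in> Z" "\<bar>x\<bar> \<le> real k" for x y
    proof (cases "0 \<le> y")
      case True
      then have "1 * y \<le> cmod (v x) * y" using v(2)[OF that(2)] by (intro mult_right_mono) auto
      then show ?thesis using B[OF that(1)] by linarith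
    qed simp
    then show ?thesis by (intro exI[of _ "\<bar>B\<bar>"]) auto
  qed
  then obtain b where b: "\<And>k. 0 \<le> b k" "\<And>k x y. (x, y) \<in> Z \<Longrightarrow> \<bar>x\<bar> \<le> real k \<Longrightarrow> y \<le> b k"
    by (metis (no_types, lifting) case_prodD)
  have "\<exists>x y. (x, y) \<in> Z \<and> (real k + b k) * (1 + \<bar>x\<bar>) ^ k < y" for k
  proof (rule ccontr)
    assume "\<nexists>x y. (x, y) \<in> Z \<and> (real k + b k) * (1 + \<bar>x\<bar>) ^ k < y"
    then have "0 \<le> real k + b k \<and> (\<forall>(x, y)\<in>Z. y \<le> (real k + b k) * (1 + \<bar>x\<bar>) ^ k)"
      using b(1)[of k] by (auto simp: not_less)
    with neg show False by blast
  qed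
  then obtain X Y where XY: "\<And>k. (X k, Y k) \<in> Z" "\<And>k. (real k + b k) * (1 + \<bar>X k\<bar>) ^ k < Y k"
    by metis
  have ge1: "1 \<le> (1 + \<bar>x\<bar>) ^ k" for x :: real and k by (rule one_le_power) simp
  have Yk: "b k < Y k" for k
    using XY(2)[of k] mult_left_mono[OF ge1[of "X k" k], of "real k + b k"] b(1)[of k] by simp
  have X: "real k < \<bar>X k\<bar>" for k using b(2)[OF XY(1), of k k] Yk[of k] by linarith
  \<comment> \<open>A point may occur as \<open>X k\<close> for several k. The least such index
    gives the largest value, so \<open>u (X k)\<close> is at least (1 + |X k|)^(-k) for every
    k.\<close>
  define u where "u x = (if x \<in> range X then 1 / (1 + \<bar>x\<bar>) ^ (LEAST k. X k = x) else 0)" for x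
  have u0: "0 \<le> u x" for x by (simp add: u_def)
  have "rapid u" unfolding rapid_def
  proof
    fix k
    \<comment> \<open>For an index l \<ge> k the weight is absorbed by the definition of u; the sum
      takes care of the finitely many indices below k.\<close>
    let ?B = "1 + (\<Sum>i<k. (1 + \<bar>X i\<bar>) ^ k)"
    have B1: "1 \<le> ?B" by (simp add: sum_nonneg)
    have "(1 + \<bar>x\<bar>) ^ k * u x \<le> ?B" for x
    proof (cases "x \<in> range X")
      case True
      define l where "l = (LEAST k. X k = x)"
      have Xl: "X l = x" using True LeastI[of "\<lambda>k. X k = x"] unfolding l_def by blast
      have ux: "u x = 1 / (1 + \<bar>x\<bar>) ^ l" using True by (simp add: u_def l_def)
      show ?thesis
      proof (cases "k \<le> l")
        case True
        then have "(1 + \<bar>x\<bar>) ^ k * u x \<le> 1"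
          by (simp add: ux divide_le_eq_1 add_pos_nonneg power_increasing)
        then show ?thesis using B1 by linarith
      next
        case False
        have "u x \<le> 1" using ge1[of x l] by (simp add: ux)
        then have "(1 + \<bar>x\<bar>) ^ k * u x \<le> (1 + \<bar>X l\<bar>) ^ k" unfolding Xl
          by (intro mult_left_le) auto
        also have "\<dots> \<le> (\<Sum>i<k. (1 + \<bar>X i\<bar>) ^ k)" using False by (intro member_le_sum) auto
        finally show ?thesis by linarith
      qed
    next
      case False
      then show ?thesis using B1 by (simp add: u_def)
    qed
    then show "\<exists>C. \<forall>x. (1 + \<bar>x\<bar>) ^ k * u x \<le> C" by blast
  qed
  then obtain w where w: "w \<in> Schwartz" "\<And>x. u x \<le> cmod (w x)"
    by (rule Schwartz_majorant[OF _ u0]) auto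
  obtain B where B: "\<And>x y. (x, y) \<in> Z \<Longrightarrow> cmod (w x) * y \<le> B" using Z[OF w(1)] by blast
  have "real k \<le> B" for k
  proof -
    have "(LEAST l. X l = X k) \<le> k" by (rule Least_le) simp
    then have "(1 + \<bar>X k\<bar>) ^ (LEAST l. X l = X k) \<le> (1 + \<bar>X k\<bar>) ^ k"
      by (rule power_increasing) simp
    then have "1 / (1 + \<bar>X k\<bar>) ^ k \<le> 1 / (1 + \<bar>X k\<bar>) ^ (LEAST l. X l = X k)"
      using ge1 by (intro divide_left_mono) (auto intro: order_less_le_trans[OF zero_less_one])
    also have "\<dots> = u (X k)" by (simp add: u_def)
    finally have w': "1 / (1 + \<bar>X k\<bar>) ^ k \<le> cmod (w (X k))" using w(2)[of "X k"] by linarith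
    have "real k \<le> (1 / (1 + \<bar>X k\<bar>) ^ k) * ((real k + b k) * (1 + \<bar>X k\<bar>) ^ k)"
      using b(1)[of k] by (simp add: add_pos_nonneg)
    also have "\<dots> \<le> cmod (w (X k)) * Y k"
      using XY(2)[of k] b(1)[of k] by (intro mult_mono w') auto
    also have "\<dots> \<le> B" by (rule B[OF XY(1)])
    finally show ?thesis .
  qed
  then show False using reals_Archimedean2[of B] by (meson not_le)
qed

section \<open>The space of slowly increasing functions\<close>

text \<open>The parameter set is abstract so that pairs (n, x) with \<open>\<rho> = snd\<close> are
  covered, where the constants must be independent of n.\<close>

lemma polynomial_bound_common:
  fixes g :: "'i \<Rightarrow> 'a \<Rightarrow> real" and \<rho> :: "'a \<Rightarrow> real"
  assumes "finite I" "\<And>i. i \<in> I \<Longrightarrow> \<exists>C k. \<forall>x\<in>X i. g i x \<le> C * (1 + \<bar>\<rho> x\<bar>) ^ k"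
  shows "\<exists>C k. 1 \<le> C \<and> (\<forall>i\<in>I. \<forall>x\<in>X i. g i x \<le> C * (1 + \<bar>\<rho> x\<bar>) ^ k)"
proof -
  obtain c k where ck: "\<And>i x. i \<in> I \<Longrightarrow> x \<in> X i \<Longrightarrow> g i x \<le> c i * (1 + \<bar>\<rho> x\<bar>) ^ k i"
    using assms(2) by metis
  have "g i x \<le> (1 + (\<Sum>i\<in>I. \<bar>c i\<bar>)) * (1 + \<bar>\<rho> x\<bar>) ^ (\<Sum>i\<in>I. k i)" if "i \<in> I" "x \<in> X i" for i x
  proof -
    have 1: "\<bar>c i\<bar> \<le> (\<Sum>i\<in>I. \<bar>c i\<bar>)" using that assms(1) by (intro member_le_sum) auto
    have 2: "k i \<le> (\<Sum>i\<in>I. k i)" using that assms(1) by (intro member_le_sum) auto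
    have "g i x \<le> c i * (1 + \<bar>\<rho> x\<bar>) ^ k i" by (rule ck[OF that])
    also have "\<dots> \<le> (1 + (\<Sum>i\<in>I. \<bar>c i\<bar>)) * (1 + \<bar>\<rho> x\<bar>) ^ (\<Sum>i\<in>I. k i)"
      using 1 2 by (intro mult_mono power_increasing) (auto intro!: add_nonneg_nonneg sum_nonneg)
    finally show ?thesis .
  qed
  moreover have "1 \<le> 1 + (\<Sum>i\<in>I. \<bar>c i\<bar>)" by (simp add: sum_nonneg)
  ultimately show ?thesis by blast
qed

text \<open>Exponents that vary with the order suffice, since each stage m involves finitely many
  orders. Passing between the weights 1 + x^2 and 1 + |x| costs a doubled exponent in one direction
  and a power of 2 in the other.\<close>

lemma O_M_iff:
  "f \<in> O_M \<longleftrightarrow> smooth f \<and> (\<forall>j. \<exists>C k. \<forall>x. cmod (nth_deriv j f x) \<le> C * (1 + \<bar>x\<bar>) ^ k)"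
proof
  assume f: "f \<in> O_M"
  have C: "f \<in> C_class (Suc m)" for m
    using f by (auto simp: O_M_def O_space_def)
  have "nth_deriv j f differentiable (at x)" for j x using C[of j] by (simp add: C_class_def)
  then have s: "smooth f" by (simp add: smooth_def)
  have "\<exists>C k. \<forall>x. cmod (nth_deriv j f x) \<le> C * (1 + \<bar>x\<bar>) ^ k" for j
  proof -
    have "f \<in> (\<Union>n\<in>{1..}. O_space (Suc j) n)" using f unfolding O_M_def by (rule INT_D) simp
    then obtain n where "bdd_above {cmod (nth_deriv i f x) / (1 + \<bar>x\<bar>\<^sup>2) ^ n |x i. i \<le> Suc j}"
      by (auto simp: O_space_def)
    then obtain B where B: "\<And>x i. i \<le> Suc j \<Longrightarrow> cmod (nth_deriv i f x) / (1 + \<bar>x\<bar>\<^sup>2) ^ n \<le> B"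
      unfolding bdd_above_def by blast
    have "cmod (nth_deriv j f x) \<le> \<bar>B\<bar> * (1 + \<bar>x\<bar>) ^ (2 * n)" for x
    proof -
      have pos: "0 < (1 + \<bar>x\<bar>\<^sup>2) ^ n" by (intro zero_less_power add_pos_nonneg) auto
      have "cmod (nth_deriv j f x) \<le> B * (1 + \<bar>x\<bar>\<^sup>2) ^ n"
        using B[of j x] pos by (simp add: divide_le_eq)
      also have "\<dots> \<le> \<bar>B\<bar> * ((1 + \<bar>x\<bar>)\<^sup>2) ^ n"
        by (intro mult_mono power_mono) (auto simp: power2_eq_square algebra_simps)
      finally show ?thesis by (simp add: power_mult)
    qed
    then show ?thesis by blast
  qed
  with s show "smooth f \<and> (\<forall>j. \<exists>C k. \<forall>x. cmod (nth_deriv j f x) \<le> C * (1 + \<bar>x\<bar>) ^ k)" by blast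
next
  assume f: "smooth f \<and> (\<forall>j. \<exists>C k. \<forall>x. cmod (nth_deriv j f x) \<le> C * (1 + \<bar>x\<bar>) ^ k)"
  have "\<exists>n\<in>{1..}. f \<in> O_space m n" for m
  proof -
    have "\<exists>C k. 1 \<le> C \<and> (\<forall>i\<in>{..m}. \<forall>x\<in>UNIV. cmod (nth_deriv i f x) \<le> C * (1 + \<bar>x\<bar>) ^ k)"
      by (rule polynomial_bound_common[where \<rho> = "\<lambda>x. x"]) (use f in simp_all)
    then obtain C k where C: "1 \<le> C" "\<And>i x. i \<le> m \<Longrightarrow> cmod (nth_deriv i f x) \<le> C * (1 + \<bar>x\<bar>) ^ k"
      by auto
    have "cmod (nth_deriv i f x) / (1 + \<bar>x\<bar>\<^sup>2) ^ Suc k \<le> C * 2 ^ Suc k" if "i \<le> m" for x i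
    proof -
      have "0 \<le> (\<bar>x\<bar> - 1 / 2)\<^sup>2" by simp
      then have le: "1 + \<bar>x\<bar> \<le> 2 * (1 + \<bar>x\<bar>\<^sup>2)"
        by (simp only: power2_diff) (simp add: power2_eq_square)
      have "cmod (nth_deriv i f x) \<le> C * (1 + \<bar>x\<bar>) ^ k" using C(2) that by simp
      also have "\<dots> \<le> C * (1 + \<bar>x\<bar>) ^ Suc k" using C(1) by (intro mult_left_mono power_increasing) auto
      also have "\<dots> \<le> C * (2 * (1 + \<bar>x\<bar>\<^sup>2)) ^ Suc k"
        using C(1) by (intro mult_left_mono power_mono le) auto
      also have "\<dots> = C * 2 ^ Suc k * (1 + \<bar>x\<bar>\<^sup>2) ^ Suc k" by (simp only: power_mult_distrib mult.assoc)
      finally have "cmod (nth_deriv i f x) \<le> C * 2 ^ Suc k * (1 + \<bar>x\<bar>\<^sup>2) ^ Suc k" .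
      moreover have "0 < (1 + \<bar>x\<bar>\<^sup>2) ^ Suc k" by (intro zero_less_power add_pos_nonneg) auto
      ultimately show ?thesis by (simp only: pos_divide_le_eq)
    qed
    then have "bdd_above {cmod (nth_deriv i f x) / (1 + \<bar>x\<bar>\<^sup>2) ^ Suc k |x i. i \<le> m}"
      unfolding bdd_above_def by blast
    moreover have "f \<in> C_class m" using f smooth_continuous_on by (auto simp: C_class_def smooth_def)
    ultimately show ?thesis unfolding O_space_def by (intro bexI[of _ "Suc k"]) auto
  qed
  then show "f \<in> O_M" by (auto simp: O_M_def)
qed

lemma O_M_smooth: "f \<in> O_M \<Longrightarrow> smooth f"
  by (simp add: O_M_iff)

lemma O_M_bound:
  assumes "f \<in> O_M"
  obtains C k where "1 \<le> C" "\<And>i x. i \<le> m \<Longrightarrow> cmod (nth_deriv i f x) \<le> C * (1 + \<bar>x\<bar>) ^ k"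
proof -
  have "\<exists>C k. 1 \<le> C \<and> (\<forall>i\<in>{..m}. \<forall>x\<in>UNIV. cmod (nth_deriv i f x) \<le> C * (1 + \<bar>x\<bar>) ^ k)"
    by (rule polynomial_bound_common[where \<rho> = "\<lambda>x. x"]) (use assms in \<open>simp_all add: O_M_iff\<close>)
  with that show thesis by auto
qed

lemma O_M_plus:
  assumes "f \<in> O_M" "g \<in> O_M" shows "(\<lambda>x. f x + g x) \<in> O_M"
  unfolding O_M_iff
proof (intro conjI allI smooth_add O_M_smooth assms)
  fix j
  obtain C k where f: "1 \<le> C" "\<And>i x. i \<le> j \<Longrightarrow> cmod (nth_deriv i f x) \<le> C * (1 + \<bar>x\<bar>) ^ k"
    using O_M_bound[OF assms(1), of j] by blast
  obtain D l where g: "1 \<le> D" "\<And>i x. i \<le> j \<Longrightarrow> cmod (nth_deriv i g x) \<le> D * (1 + \<bar>x\<bar>) ^ l"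
    using O_M_bound[OF assms(2), of j] by blast
  have "cmod (nth_deriv j (\<lambda>x. f x + g x) x) \<le> (C + D) * (1 + \<bar>x\<bar>) ^ (k + l)" for x
  proof -
    have "C * (1 + \<bar>x\<bar>) ^ k \<le> C * (1 + \<bar>x\<bar>) ^ (k + l)" "D * (1 + \<bar>x\<bar>) ^ l \<le> D * (1 + \<bar>x\<bar>) ^ (k + l)"
      using f(1) g(1) by (auto intro!: mult_left_mono power_increasing)
    then show ?thesis
      using f(2)[of j x] g(2)[of j x] norm_triangle_ineq[of "nth_deriv j f x" "nth_deriv j g x"]
      by (simp add: nth_deriv_plus O_M_smooth assms distrib_right)
  qed
  then show "\<exists>C k. \<forall>x. cmod (nth_deriv j (\<lambda>x. f x + g x) x) \<le> C * (1 + \<bar>x\<bar>) ^ k" by blast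
qed

lemma O_M_uminus:
  assumes "f \<in> O_M" shows "(\<lambda>x. - f x) \<in> O_M"
  using assms nth_deriv_cmult[of f _ "- 1"] by (simp add: O_M_iff smooth_minus)

lemma O_M_minus: "f \<in> O_M \<Longrightarrow> g \<in> O_M \<Longrightarrow> (\<lambda>x. f x - g x) \<in> O_M"
  using O_M_plus[OF _ O_M_uminus] by simp

lemma O_M_const: "(\<lambda>x. c) \<in> O_M"
  unfolding O_M_iff
proof (intro conjI allI)
  show "\<exists>C k. \<forall>x. cmod (nth_deriv j (\<lambda>x. c) x) \<le> C * (1 + \<bar>x\<bar>) ^ k" for j
    by (intro exI[of _ "cmod c"] exI[of _ 0]) (simp add: nth_deriv_const)
qed simp

lemma O_M_id: "complex_of_real \<in> O_M"
  unfolding O_M_iff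
proof (intro conjI allI smooth_of_real)
  show "\<exists>C k. \<forall>x. cmod (nth_deriv j complex_of_real x) \<le> C * (1 + \<bar>x\<bar>) ^ k" for j
    by (intro exI[of _ 1]) (simp add: nth_deriv_of_real)
qed

lemma O_M_compact_support:
  assumes "smooth f" "\<And>x. R < \<bar>x\<bar> \<Longrightarrow> f x = 0"
  shows "f \<in> O_M"
  unfolding O_M_iff
proof (intro conjI allI assms(1))
  fix j
  obtain M where "\<And>x. cmod (nth_deriv j f x) \<le> M"
    using compact_support_nth_deriv_bounded[OF assms] by metis
  then show "\<exists>C k. \<forall>x. cmod (nth_deriv j f x) \<le> C * (1 + \<bar>x\<bar>) ^ k"
    by (intro exI[of _ M] exI[of _ 0]) simp
qed

lemma O_M_compose:
  assumes f: "f \<in> O_M" and q: "cplx q \<in> O_M"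
  shows "(\<lambda>x. f (q x)) \<in> O_M"
  unfolding O_M_iff
proof (intro conjI allI)
  show "smooth (\<lambda>x. f (q x))" by (rule smooth_compose[OF O_M_smooth[OF f] O_M_smooth[OF q]])
  fix j
  obtain A k where A: "1 \<le> A" "\<And>i x. i \<le> j \<Longrightarrow> cmod (nth_deriv i f x) \<le> A * (1 + \<bar>x\<bar>) ^ k"
    using O_M_bound[OF f, of j] by blast
  obtain B l where B: "1 \<le> B" "\<And>i x. i \<le> j \<Longrightarrow> cmod (nth_deriv i (cplx q) x) \<le> B * (1 + \<bar>x\<bar>) ^ l"
    using O_M_bound[OF q, of j] by blast
  obtain K where K: "0 \<le> K" "\<And>h q x A B. smooth h \<Longrightarrow> smooth (cplx q) \<Longrightarrow> 1 \<le> B \<Longrightarrow>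
     (\<forall>i\<le>j. cmod (nth_deriv i h (q x)) \<le> A) \<Longrightarrow>
     (\<forall>i\<in>{1..j}. cmod (nth_deriv i (cplx q) x) \<le> B) \<Longrightarrow>
     cmod (nth_deriv j (\<lambda>x. h (q x)) x) \<le> K * A * B ^ j"
    using nth_deriv_compose_bound[of j] by blast
  \<comment> \<open>The exponent l k comes from the growth of f at q x, where 1 + |q x| \<le> 2 B (1
    + |x|)^l; the exponent l j comes from the derivatives of q.\<close>
  have "cmod (nth_deriv j (\<lambda>x. f (q x)) x) \<le> K * (A * (2 * B) ^ k) * B ^ j * (1 + \<bar>x\<bar>) ^ (l * k + l * j)" for x
  proof -
    have ge1: "1 \<le> (1 + \<bar>x\<bar>) ^ i" for i by (rule one_le_power) simp
    have B1: "1 \<le> B * (1 + \<bar>x\<bar>) ^ l" using mult_mono[OF B(1) ge1[of l]] B(1) by simp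
    have "\<bar>q x\<bar> \<le> B * (1 + \<bar>x\<bar>) ^ l" using B(2)[of 0 x] by simp
    then have "1 + \<bar>q x\<bar> \<le> 2 * B * (1 + \<bar>x\<bar>) ^ l" using B1 by linarith
    then have "A * (1 + \<bar>q x\<bar>) ^ k \<le> A * (2 * B * (1 + \<bar>x\<bar>) ^ l) ^ k"
      using A(1) by (intro mult_left_mono power_mono) auto
    then have "cmod (nth_deriv j (\<lambda>x. f (q x)) x) \<le> K * (A * (2 * B * (1 + \<bar>x\<bar>) ^ l) ^ k) * (B * (1 + \<bar>x\<bar>) ^ l) ^ j"
      using A(2) B(2) by (intro K(2) O_M_smooth f q B1) (auto intro: order_trans)
    moreover have "(1 + \<bar>x\<bar>) ^ (l * k + l * j) = ((1 + \<bar>x\<bar>) ^ l) ^ k * ((1 + \<bar>x\<bar>) ^ l) ^ j"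
      by (simp add: power_add power_mult)
    ultimately show ?thesis by (simp only: power_mult_distrib mult_ac)
  qed
  then show "\<exists>C k. \<forall>x. cmod (nth_deriv j (\<lambda>x. f (q x)) x) \<le> C * (1 + \<bar>x\<bar>) ^ k" by blast
qed

subsection \<open>Seminorms and topology\<close>

lemma O_M_seminorm_le:
  assumes "\<And>x j. j \<le> m \<Longrightarrow> cmod (v x) * cmod (nth_deriv j f x) \<le> e"
  shows "O_M_seminorm m v f \<le> e"
  unfolding O_M_seminorm_def
proof (rule cSUP_least)
  fix x
  have "finite ((\<lambda>j. cmod (v x * nth_deriv j f x)) ` {..m})" by simp
  then show "(MAX j\<in>{..m}. cmod (v x * nth_deriv j f x)) \<le> e"
    by (subst Max_le_iff) (auto simp: norm_mult assms)
qed simp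

text \<open>The supremum bounds its terms because the decay of v absorbs the polynomial growth of f,
  which makes the family bounded above.\<close>

lemma O_M_seminorm_ge:
  assumes "f \<in> O_M" "v \<in> Schwartz" "j \<le> m"
  shows "cmod (v x) * cmod (nth_deriv j f x) \<le> O_M_seminorm m v f"
proof -
  obtain C k where C: "1 \<le> C" "\<And>i x. i \<le> m \<Longrightarrow> cmod (nth_deriv i f x) \<le> C * (1 + \<bar>x\<bar>) ^ k"
    using O_M_bound[OF assms(1), of m] by blast
  obtain B where B: "\<And>x. (1 + \<bar>x\<bar>) ^ k * cmod (v x) \<le> B"
    using Schwartz_bound[OF assms(2), of k] by blast
  have "cmod (v x * nth_deriv i f x) \<le> C * B" if "i \<le> m" for i x
  proof -
    have "cmod (v x * nth_deriv i f x) \<le> cmod (v x) * (C * (1 + \<bar>x\<bar>) ^ k)"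
      unfolding norm_mult by (intro mult_left_mono C that) auto
    also have "\<dots> = C * ((1 + \<bar>x\<bar>) ^ k * cmod (v x))" by simp
    also have "\<dots> \<le> C * B" using C(1) by (intro mult_left_mono B) auto
    finally show ?thesis .
  qed
  then have "bdd_above (range (\<lambda>x. MAX j\<in>{..m}. cmod (v x * nth_deriv j f x)))"
    by (intro bdd_aboveI[of _ "C * B"]) (auto simp: Max_le_iff)
  then have "(MAX j\<in>{..m}. cmod (v x * nth_deriv j f x)) \<le> O_M_seminorm m v f"
    unfolding O_M_seminorm_def by (intro cSUP_upper) auto
  moreover have "cmod (v x * nth_deriv j f x) \<le> (MAX j\<in>{..m}. cmod (v x * nth_deriv j f x))"
    using assms(3) by (intro Max_ge) auto
  ultimately show ?thesis unfolding norm_mult by (rule order_trans[rotated])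
qed

definition O_M_ball :: "nat \<Rightarrow> (real \<Rightarrow> complex) \<Rightarrow> (real \<Rightarrow> complex) \<Rightarrow> real \<Rightarrow> (real \<Rightarrow> complex) set" where
  "O_M_ball m v f e = {g \<in> O_M. O_M_seminorm m v (\<lambda>x. g x - f x) < e}"

lemma O_M_ball_subset: "O_M_ball m v f e \<subseteq> O_M"
  by (auto simp: O_M_ball_def)

lemma O_M_ballD:
  assumes "g \<in> O_M_ball m v f e" "f \<in> O_M" "v \<in> Schwartz" "j \<le> m"
  shows "cmod (v x) * cmod (nth_deriv j g x - nth_deriv j f x) < e"
proof -
  have g: "g \<in> O_M" "O_M_seminorm m v (\<lambda>x. g x - f x) < e" using assms(1) by (auto simp: O_M_ball_def)
  show ?thesis
    using O_M_seminorm_ge[OF O_M_minus[OF g(1) assms(2)] assms(3,4), of x] g assms(2)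
    by (simp add: nth_deriv_diff O_M_smooth)
qed

text \<open>A supremum of terms below e may equal e, hence the intermediate bound d < e.\<close>

lemma O_M_ballI:
  assumes "f \<in> O_M" "g \<in> O_M" "d < e"
    "\<And>x j. j \<le> m \<Longrightarrow> cmod (v x) * cmod (nth_deriv j g x - nth_deriv j f x) \<le> d"
  shows "g \<in> O_M_ball m v f e"
proof -
  have "O_M_seminorm m v (\<lambda>x. g x - f x) \<le> d"
    using assms by (intro O_M_seminorm_le) (simp add: nth_deriv_diff O_M_smooth)
  with assms show ?thesis by (simp add: O_M_ball_def)
qed

lemma O_M_ball_centre:
  assumes "f \<in> O_M" "0 < e" shows "f \<in> O_M_ball m v f e"
  by (rule O_M_ballI[of _ _ 0]) (use assms in auto)

lemma O_M_topology_balls: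
  "O_M_topology = topology_generated_by
     {O_M_ball m v f e |m v f e. v \<in> Schwartz \<and> f \<in> O_M \<and> 0 < e}"
  by (simp add: O_M_topology_def O_M_ball_def)

lemma openin_O_M_ball: "v \<in> Schwartz \<Longrightarrow> f \<in> O_M \<Longrightarrow> 0 < e \<Longrightarrow> openin O_M_topology (O_M_ball m v f e)"
  unfolding O_M_topology_balls by (rule topology_generated_by_Basis) blast

lemma zero_Schwartz: "(\<lambda>x. 0) \<in> Schwartz"
  by (auto simp: Schwartz_iff nth_deriv_const)

lemma topspace_O_M [simp]: "topspace O_M_topology = O_M"
proof
  show "topspace O_M_topology \<subseteq> O_M"
    unfolding O_M_topology_balls topology_generated_by_topspace using O_M_ball_subset by blast
  show "O_M \<subseteq> topspace O_M_topology"
  proof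
    fix f assume f: "f \<in> O_M"
    show "f \<in> topspace O_M_topology"
      using openin_subset[OF openin_O_M_ball[OF zero_Schwartz f, of 1 0]] O_M_ball_centre[OF f, of 1] by force
  qed
qed

lemma O_M_ball_mono:
  assumes "v \<in> Schwartz" "w \<in> Schwartz" "f \<in> O_M" "\<And>x. cmod (v x) \<le> cmod (w x)" "m \<le> m'" "e' < e"
  shows "O_M_ball m' w f e' \<subseteq> O_M_ball m v f e"
proof
  fix g assume g: "g \<in> O_M_ball m' w f e'"
  have "cmod (v x) * cmod (nth_deriv j g x - nth_deriv j f x) \<le> e'" if "j \<le> m" for x j
  proof -
    have "cmod (v x) * cmod (nth_deriv j g x - nth_deriv j f x)
        \<le> cmod (w x) * cmod (nth_deriv j g x - nth_deriv j f x)"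
      by (intro mult_right_mono assms) auto
    then show ?thesis
      using O_M_ballD[OF g assms(3,2) order_trans[OF that assms(5)], of x] by linarith
  qed
  then show "g \<in> O_M_ball m v f e"
    using O_M_ballI[OF assms(3) _ assms(6)] g O_M_ball_subset by blast
qed

lemma Schwartz_majorant2:
  assumes "v \<in> Schwartz" "w \<in> Schwartz"
  obtains u where "u \<in> Schwartz" "\<And>x. cmod (v x) \<le> cmod (u x)" "\<And>x. cmod (w x) \<le> cmod (u x)"
proof -
  have "rapid (\<lambda>x. cmod (v x) + cmod (w x))"
    using rapid_add[OF rapid_Schwartz[OF assms(1), of 1 0] rapid_Schwartz[OF assms(2), of 1 0]] by simp
  then obtain u where u: "u \<in> Schwartz" "\<And>x. cmod (v x) + cmod (w x) \<le> cmod (u x)"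
    by (rule Schwartz_majorant) auto
  have "cmod (v x) \<le> cmod (u x)" "cmod (w x) \<le> cmod (u x)" for x
    using u(2)[of x] norm_ge_zero[of "v x"] norm_ge_zero[of "w x"] by linarith+
  with u(1) show thesis by (rule that)
qed

text \<open>By passing to a common Schwartz majorant of the weights, finite intersections of seminorm
  balls are not needed.\<close>

lemma openin_O_M_contains_ball:
  assumes "openin O_M_topology U" "f \<in> U"
  shows "\<exists>m v e. v \<in> Schwartz \<and> 0 < e \<and> O_M_ball m v f e \<subseteq> U"
proof -
  have "generate_topology_on {O_M_ball m v f e |m v f e. v \<in> Schwartz \<and> f \<in> O_M \<and> 0 < e} U"
    using assms(1) by (simp add: O_M_topology_balls openin_topology_generated_by_iff)
  then show ?thesis using assms(2)
  proof (induction rule: generate_topology_on.induct)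
    case Empty
    then show ?case by simp
  next
    case (Int a b)
    then obtain m v e m' v' e' where
      1: "v \<in> Schwartz" "0 < e" "O_M_ball m v f e \<subseteq> a" and
      2: "v' \<in> Schwartz" "0 < e'" "O_M_ball m' v' f e' \<subseteq> b" by blast
    obtain u where u: "u \<in> Schwartz" "\<And>x. cmod (v x) \<le> cmod (u x)" "\<And>x. cmod (v' x) \<le> cmod (u x)"
      using Schwartz_majorant2[OF 1(1) 2(1)] by blast
    have f: "f \<in> O_M"
    proof -
      have "openin O_M_topology a" using Int.hyps(1) by (simp add: O_M_topology_balls openin_topology_generated_by_iff)
      then show ?thesis using openin_subset Int.prems by fastforce
    qed
    have "O_M_ball (max m m') u f (min e e' / 2) \<subseteq> O_M_ball m v f e"
      "O_M_ball (max m m') u f (min e e' / 2) \<subseteq> O_M_ball m' v' f e'"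
      using 1 2 u f by (intro O_M_ball_mono; simp)+
    then show ?case using u(1) 1 2 by (intro exI[of _ "max m m'"] exI[of _ u] exI[of _ "min e e' / 2"]) auto
  next
    case (UN K)
    then show ?case by (meson Sup_upper UnionE order_trans)
  next
    case (Basis s)
    then obtain m v g e where s: "s = O_M_ball m v g e" "v \<in> Schwartz" "g \<in> O_M" "0 < e" by blast
    then have f: "f \<in> O_M" "O_M_seminorm m v (\<lambda>x. f x - g x) < e"
      using Basis.prems by (auto simp: O_M_ball_def)
    \<comment> \<open>Half of the remaining gap: d plus the seminorm of f - g equals e - d, still
      strictly below e.\<close>
    define d where "d = (e - O_M_seminorm m v (\<lambda>x. f x - g x)) / 2"
    have "O_M_ball m v f d \<subseteq> s"
    proof
      fix h assume h: "h \<in> O_M_ball m v f d"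
      have "cmod (v x) * cmod (nth_deriv j h x - nth_deriv j g x) \<le> e - d" if j: "j \<le> m" for x j
      proof -
        have "cmod (v x) * cmod (nth_deriv j h x - nth_deriv j g x)
          \<le> cmod (v x) * (cmod (nth_deriv j h x - nth_deriv j f x) + cmod (nth_deriv j f x - nth_deriv j g x))"
          by (intro mult_left_mono) (use norm_triangle_ineq[of "nth_deriv j h x - nth_deriv j f x" "nth_deriv j f x - nth_deriv j g x"] in auto)
        also have "\<dots> \<le> d + O_M_seminorm m v (\<lambda>x. f x - g x)"
          using O_M_ballD[OF h f(1) s(2) j, of x] O_M_seminorm_ge[OF O_M_minus[OF f(1) s(3)] s(2) j, of x]
          by (simp add: distrib_left nth_deriv_diff O_M_smooth f(1) s(3))
        also have "\<dots> = e - d" by (simp add: d_def field_simps)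
        finally show ?thesis .
      qed
      then show "h \<in> s"
        unfolding s(1) using O_M_ballI[OF s(3), of h "e - d" e m v] h O_M_ball_subset f(2) by (force simp: d_def)
    qed
    then show ?case using s(2) f(2) by (intro exI[of _ m] exI[of _ v] exI[of _ d]) (auto simp: d_def)
  qed
qed

lemma dense_in_O_M:
  assumes "A \<subseteq> O_M"
    and "\<And>f m v e. f \<in> O_M \<Longrightarrow> v \<in> Schwartz \<Longrightarrow> 0 < e \<Longrightarrow>
      \<exists>g\<in>A. \<forall>x. \<forall>j\<le>m. cmod (v x) * cmod (nth_deriv j g x - nth_deriv j f x) \<le> e"
  shows "dense_in O_M_topology A"
  unfolding dense_in_def
proof
  show "A \<subseteq> topspace O_M_topology" using assms(1) by simp
  have "f \<in> O_M_topology closure_of A" if f: "f \<in> O_M" for f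
    unfolding in_closure_of
  proof (intro conjI allI impI)
    fix U assume "f \<in> U \<and> openin O_M_topology U"
    then obtain m v e where *: "v \<in> Schwartz" "0 < e" "O_M_ball m v f e \<subseteq> U"
      using openin_O_M_contains_ball by blast
    obtain g where g: "g \<in> A" "\<forall>x. \<forall>j\<le>m. cmod (v x) * cmod (nth_deriv j g x - nth_deriv j f x) \<le> e / 2"
      using assms(2)[OF f *(1), of "e/2" m] *(2) by auto
    have "g \<in> O_M_ball m v f e"
      using O_M_ballI[OF f, of g "e/2" e m v] g assms(1) *(2) by auto
    then show "\<exists>y. y \<in> A \<and> y \<in> U" using g(1) *(3) by blast
  qed (simp add: f)
  then show "O_M_topology closure_of A = topspace O_M_topology"
    using closure_of_subset_topspace[of O_M_topology A] by auto
qed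

text \<open>The chain rule for f o H costs a factor (1 + |x|)^(l m) from the derivatives of H. The
  hypothesis on Schwartz functions dominates v together with this factor by a weight evaluated at H
  x, where the estimate for g - f is available.\<close>

lemma continuous_map_comp_op:
  assumes H: "cplx H \<in> O_M"
    and dom: "\<And>v k. v \<in> Schwartz \<Longrightarrow> \<exists>w\<in>Schwartz. \<forall>x. cmod (v x) * (1 + \<bar>x\<bar>) ^ k \<le> cmod (w (H x))"
  shows "continuous_map O_M_topology O_M_topology (comp_op H)"
proof -
  have maps: "comp_op H f \<in> O_M" if "f \<in> O_M" for f
    using O_M_compose[OF that H] by (simp add: comp_op_def o_def)
  have "openin O_M_topology (comp_op H -` U \<inter> topspace O_M_topology)"
    if U: "openin O_M_topology U" for U
  proof (subst openin_subopen, intro ballI)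
    fix f assume "f \<in> comp_op H -` U \<inter> topspace O_M_topology"
    then have f: "f \<in> O_M" "comp_op H f \<in> U" by auto
    obtain m v e where v: "v \<in> Schwartz" "0 < e" "O_M_ball m v (comp_op H f) e \<subseteq> U"
      using openin_O_M_contains_ball[OF U f(2)] by blast
    obtain B l where B: "1 \<le> B" "\<And>i x. i \<le> m \<Longrightarrow> cmod (nth_deriv i (cplx H) x) \<le> B * (1 + \<bar>x\<bar>) ^ l"
      using O_M_bound[OF H, of m] by blast
    obtain K where K0: "\<And>j. 0 \<le> K j" and K: "\<And>j h q x A B. smooth h \<Longrightarrow> smooth (cplx q) \<Longrightarrow> (1::real) \<le> B \<Longrightarrow>
     (\<forall>i\<le>j. cmod (nth_deriv i h (q x)) \<le> A) \<Longrightarrow>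
     (\<forall>i\<in>{1..j}. cmod (nth_deriv i (cplx q) x) \<le> B) \<Longrightarrow>
     cmod (nth_deriv j (\<lambda>x. h (q x)) x) \<le> K j * A * B ^ j"
      using nth_deriv_compose_bound by metis
    define L where "L = 1 + (\<Sum>j\<le>m. K j)"
    have KL: "K j \<le> L" if "j \<le> m" for j
      using member_le_sum[of j "{..m}" K] K0 that by (simp add: L_def)
    have L: "0 < L" using K0 by (simp add: L_def add_pos_nonneg sum_nonneg)
    obtain w where w: "w \<in> Schwartz" "\<And>x. cmod (v x) * (1 + \<bar>x\<bar>) ^ (l * m) \<le> cmod (w (H x))"
      using dom[OF v(1)] by blast
    \<comment> \<open>Chosen so that L d B^m = e/2, with L bounding all chain rule constants up to
      order m.\<close>
    define d where "d = e / (2 * L * B ^ m)"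
    have d: "0 < d" using v(2) L B(1) by (simp add: d_def)
    have "O_M_ball m w f d \<subseteq> comp_op H -` U \<inter> topspace O_M_topology"
    proof
      fix g assume g: "g \<in> O_M_ball m w f d"
      then have gO: "g \<in> O_M" using O_M_ball_subset by blast
      have s: "smooth (\<lambda>x. g x - f x)" by (intro smooth_diff O_M_smooth gO f)
      have "cmod (v x) * cmod (nth_deriv j (comp_op H g) x - nth_deriv j (comp_op H f) x) \<le> e / 2"
        if j: "j \<le> m" for x j
      \<comment> \<open>The estimate divides by |w (H x)|; where this vanishes, the domination
        forces v x = 0.\<close>
      proof (cases "w (H x) = 0")
        case True
        have "1 \<le> (1 + \<bar>x\<bar>) ^ (l * m)" by (rule one_le_power) simp
        then have "cmod (v x) \<le> cmod (v x) * (1 + \<bar>x\<bar>) ^ (l * m)"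
          using mult_left_mono[of 1 _ "cmod (v x)"] by simp
        moreover have "cmod (v x) * (1 + \<bar>x\<bar>) ^ (l * m) \<le> 0" using w(2)[of x] True by simp
        ultimately have "cmod (v x) \<le> 0" by linarith
        then show ?thesis using v(2) by simp
      next
        case False
        have ge1: "1 \<le> B * (1 + \<bar>x\<bar>) ^ l"
          using mult_mono[OF B(1) one_le_power[of "1 + \<bar>x\<bar>" l]] B(1) by simp
        have A: "cmod (nth_deriv i (\<lambda>x. g x - f x) (H x)) \<le> d / cmod (w (H x))" if "i \<le> m" for i
          using O_M_ballD[OF g f(1) w(1) that, of "H x"] False gO f(1)
          by (simp add: nth_deriv_diff O_M_smooth field_simps)
        have "cmod (nth_deriv j (\<lambda>x. g (H x) - f (H x)) x)
            \<le> K j * (d / cmod (w (H x))) * (B * (1 + \<bar>x\<bar>) ^ l) ^ j"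
          by (rule K[OF s O_M_smooth[OF H] ge1]) (use A B(2) j in auto)
        also have "\<dots> \<le> L * (d / cmod (w (H x))) * (B * (1 + \<bar>x\<bar>) ^ l) ^ m"
          using KL[OF j] K0 L d j ge1 by (intro mult_mono power_increasing) auto
        finally have "cmod (v x) * cmod (nth_deriv j (\<lambda>x. g (H x) - f (H x)) x)
           \<le> cmod (v x) * (L * (d / cmod (w (H x))) * (B * (1 + \<bar>x\<bar>) ^ l) ^ m)"
          by (rule mult_left_mono) simp
        also have "\<dots> = (cmod (v x) * (1 + \<bar>x\<bar>) ^ (l * m)) * (L * (d / cmod (w (H x))) * B ^ m)"
          by (simp add: power_mult_distrib power_mult)
        also have "\<dots> \<le> cmod (w (H x)) * (L * (d / cmod (w (H x))) * B ^ m)"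
          using L d B(1) by (intro mult_right_mono w mult_nonneg_nonneg) auto
        also have "\<dots> = e / 2" using False L B(1) by (simp add: d_def)
        finally show ?thesis
          using nth_deriv_diff[OF smooth_compose[OF O_M_smooth[OF gO] O_M_smooth[OF H]]
              smooth_compose[OF O_M_smooth[OF f(1)] O_M_smooth[OF H]]]
          by (simp add: comp_op_def o_def)
      qed
      then have "comp_op H g \<in> O_M_ball m v (comp_op H f) e"
        using v(2) by (intro O_M_ballI[of _ _ "e/2"] maps f gO) auto
      then show "g \<in> comp_op H -` U \<inter> topspace O_M_topology" using v(3) gO by auto
    qed
    then show "\<exists>T. openin O_M_topology T \<and> f \<in> T \<and> T \<subseteq> comp_op H -` U \<inter> topspace O_M_topology"
      by (intro exI[of _ "O_M_ball m w f d"] conjI openin_O_M_ball O_M_ball_centre w f d)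
  qed
  moreover have "{x \<in> topspace O_M_topology. comp_op H x \<in> U} = comp_op H -` U \<inter> topspace O_M_topology" for U
    by auto
  ultimately show ?thesis using maps by (simp add: continuous_map_def Pi_iff)
qed

section \<open>Test functions and dynamics of the translation\<close>

definition test_fun :: "(real \<Rightarrow> complex) \<Rightarrow> bool" where
  "test_fun g \<longleftrightarrow> smooth g \<and> (\<exists>R. \<forall>x. R < \<bar>x\<bar> \<longrightarrow> g x = 0)"

lemma test_fun_smooth: "test_fun g \<Longrightarrow> smooth g"
  by (simp add: test_fun_def)

lemma test_fun_O_M: "test_fun g \<Longrightarrow> g \<in> O_M"
  using O_M_compact_support by (auto simp: test_fun_def)

lemma test_fun_support:
  assumes "test_fun g"
  shows "\<exists>R::nat. \<forall>x. real R < \<bar>x\<bar> \<longrightarrow> g x = 0"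
proof -
  obtain R where R: "\<And>x. R < \<bar>x\<bar> \<Longrightarrow> g x = 0" using assms by (auto simp: test_fun_def)
  obtain n :: nat where "R \<le> real n" using real_arch_simple by blast
  with R have "\<forall>x. real n < \<bar>x\<bar> \<longrightarrow> g x = 0" by auto
  then show ?thesis by blast
qed

lemma test_fun_bound:
  assumes "test_fun g"
  shows "\<exists>M::nat. \<forall>j\<le>m. \<forall>x. cmod (nth_deriv j g x) \<le> real M"
proof -
  obtain R where R: "smooth g" "\<And>x. R < \<bar>x\<bar> \<Longrightarrow> g x = 0" using assms by (auto simp: test_fun_def)
  have "\<exists>M. \<forall>x. cmod (nth_deriv j g x) \<le> M" for j
    using compact_support_nth_deriv_bounded[OF R, where j=j] by blast
  then obtain M where M: "\<And>j x. cmod (nth_deriv j g x) \<le> M j" by metis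
  obtain n :: nat where n: "(\<Sum>j\<le>m. \<bar>M j\<bar>) \<le> real n" using real_arch_simple by blast
  have "cmod (nth_deriv j g x) \<le> real n" if "j \<le> m" for j x
  proof -
    have "\<bar>M j\<bar> \<le> (\<Sum>j\<le>m. \<bar>M j\<bar>)" using that by (intro member_le_sum) auto
    then show ?thesis using M[of j x] n by linarith
  qed
  then show ?thesis by blast
qed

lemma nth_deriv_outside_support:
  assumes "\<And>x. R < \<bar>x\<bar> \<Longrightarrow> g x = 0" "R < \<bar>x\<bar>"
  shows "nth_deriv j g x = 0"
proof -
  have "open {x. R < \<bar>x\<bar>}" by (intro open_Collect_less continuous_intros)
  then show ?thesis by (rule nth_deriv_zero_open) (use assms in auto)
qed

lemma weighted_small_at_infinity:
  assumes v: "v \<in> Schwartz" and e: "0 < (e::real)"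
  obtains n :: nat where "1 \<le> n"
    "\<And>x. real n \<le> \<bar>x\<bar> \<Longrightarrow> cmod (v x) * (C * (1 + \<bar>x\<bar>) ^ k) \<le> e"
proof -
  \<comment> \<open>One spare power of 1 + |x| turns boundedness into smallness at infinity.\<close>
  obtain B where B: "0 \<le> B" "\<And>x. (1 + \<bar>x\<bar>) ^ Suc k * cmod (v x) \<le> B"
    using Schwartz_bound[OF v, of "Suc k"] by blast
  obtain n :: nat where n: "\<bar>C\<bar> * B / e \<le> real n" using real_arch_simple by blast
  have *: "cmod (v x) * (C * (1 + \<bar>x\<bar>) ^ k) \<le> e" if "real (Suc n) \<le> \<bar>x\<bar>" for x
  proof -
    have "(1 + \<bar>x\<bar>) * (cmod (v x) * (C * (1 + \<bar>x\<bar>) ^ k)) = C * ((1 + \<bar>x\<bar>) ^ Suc k * cmod (v x))"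
      by simp
    also have "\<dots> \<le> \<bar>C\<bar> * ((1 + \<bar>x\<bar>) ^ Suc k * cmod (v x))" by (intro mult_right_mono) auto
    also have "\<dots> \<le> \<bar>C\<bar> * B" by (intro mult_left_mono B) auto
    also have "\<dots> \<le> e * real n" using n e by (simp add: field_simps)
    also have "\<dots> \<le> (1 + \<bar>x\<bar>) * e" using that e by (simp add: mult.commute)
    finally show ?thesis by (simp add: add_pos_nonneg)
  qed
  show thesis by (rule that[of "Suc n"]) (use * in auto)
qed

text \<open>f is cut off by bump(x/n). As 1/n \<le> 1, the derivatives of the cut-off are bounded
  independently of n, and the error vanishes for |x| < n; beyond that the weight is small.\<close>

lemma test_fun_dense:
  assumes f: "f \<in> O_M" and v: "v \<in> Schwartz" and e: "0 < e"
  shows "\<exists>g. test_fun g \<and> (\<forall>x. \<forall>j\<le>m. cmod (v x) * cmod (nth_deriv j g x - nth_deriv j f x) \<le> e)"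
proof -
  obtain C k where C: "1 \<le> C" "\<And>i x. i \<le> m \<Longrightarrow> cmod (nth_deriv i f x) \<le> C * (1 + \<bar>x\<bar>) ^ k"
    using O_M_bound[OF f, of m] by blast
  have "test_fun (cplx bump)" unfolding test_fun_def
    using smooth_bump bump_eq_0 by (intro conjI exI[of _ 2]) auto
  then obtain M where M: "\<And>l x. l \<le> m \<Longrightarrow> cmod (nth_deriv l (cplx bump) x) \<le> real M"
    using test_fun_bound by blast
  \<comment> \<open>2^m bounds the sum of the binomial coefficients in the Leibniz rule, M + 1 the
    derivatives of the cut-off minus 1.\<close>
  obtain n :: nat where n: "1 \<le> n"
    "\<And>x. real n \<le> \<bar>x\<bar> \<Longrightarrow> cmod (v x) * ((2 ^ m * (C * (M + 1))) * (1 + \<bar>x\<bar>) ^ k) \<le> e"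
    using weighted_small_at_infinity[OF v e, of "2 ^ m * (C * (M + 1))" k] by blast
  define a where "a = 1 / real n"
  have a: "0 < a" "a \<le> 1" using n(1) by (auto simp: a_def)
  define b where "b x = cplx bump (a * x + 0)" for x
  define h where "h x = b x - 1" for x
  define g where "g x = f x * b x" for x
  have sb: "smooth b" unfolding b_def[abs_def] by (rule smooth_compose[OF smooth_bump smooth_affine])
  have sh: "smooth h" unfolding h_def[abs_def] by (intro smooth_diff sb smooth_const)
  have sf: "smooth f" by (rule O_M_smooth[OF f])
  have sg: "smooth g" unfolding g_def[abs_def] by (rule smooth_mult[OF sf sb])
  have "test_fun g" unfolding test_fun_def
  proof (intro conjI sg exI allI impI)
    fix x assume "2 * real n < \<bar>x\<bar>"
    then have "2 \<le> \<bar>a * x + 0\<bar>" using n(1) by (simp add: a_def abs_mult field_simps)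
    then show "g x = 0" by (simp add: g_def b_def bump_eq_0)
  qed
  moreover have "cmod (v x) * cmod (nth_deriv j g x - nth_deriv j f x) \<le> e" if j: "j \<le> m" for x j
  proof -
    have "nth_deriv j g x - nth_deriv j f x = nth_deriv j (\<lambda>x. g x - f x) x"
      by (simp add: nth_deriv_diff sg sf)
    also have "(\<lambda>x. g x - f x) = (\<lambda>x. f x * h x)" by (auto simp: g_def h_def algebra_simps)
    also have "nth_deriv j (\<lambda>x. f x * h x) x
        = (\<Sum>l\<le>j. of_nat (j choose l) * nth_deriv (j - l) f x * nth_deriv l h x)"
      by (simp add: nth_deriv_mult sf sh)
    finally have eq: "nth_deriv j g x - nth_deriv j f x
        = (\<Sum>l\<le>j. of_nat (j choose l) * nth_deriv (j - l) f x * nth_deriv l h x)" .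
    show ?thesis
    proof (cases "real n \<le> \<bar>x\<bar>")
      case True
      have h: "cmod (nth_deriv l h x) \<le> real M + 1" if "l \<le> m" for l
      proof -
        have "nth_deriv l h x = of_real a ^ l * nth_deriv l (cplx bump) (a * x + 0) - (if l = 0 then 1 else 0)"
          unfolding h_def[abs_def] nth_deriv_diff[OF sb smooth_const] nth_deriv_const
          by (simp only: b_def[abs_def] nth_deriv_affine[OF smooth_bump])
        then have "cmod (nth_deriv l h x) \<le> a ^ l * cmod (nth_deriv l (cplx bump) (a * x + 0)) + 1"
          using norm_triangle_ineq4[of "of_real a ^ l * nth_deriv l (cplx bump) (a * x + 0)" "if l = 0 then 1 else 0"] a
          by (simp add: norm_mult norm_power split: if_splits)
        also have "\<dots> \<le> 1 * real M + 1"
          using a by (intro add_mono mult_mono M that power_le_one) auto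
        finally show ?thesis by simp
      qed
      have "cmod (nth_deriv j g x - nth_deriv j f x)
          \<le> (\<Sum>l\<le>j. real (j choose l) * (C * (1 + \<bar>x\<bar>) ^ k) * (real M + 1))"
        unfolding eq
      proof (rule sum_norm_le)
        fix l assume "l \<in> {..j}"
        then show "cmod (of_nat (j choose l) * nth_deriv (j - l) f x * nth_deriv l h x)
            \<le> real (j choose l) * (C * (1 + \<bar>x\<bar>) ^ k) * (real M + 1)"
          unfolding norm_mult norm_of_nat using j C(1)
          by (intro mult_mono C(2) h order_refl) auto
      qed
      also have "\<dots> = real (\<Sum>l\<le>j. j choose l) * ((C * (real M + 1)) * (1 + \<bar>x\<bar>) ^ k)"
        unfolding of_nat_sum sum_distrib_right by (intro sum.cong) (simp_all add: mult_ac)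
      also have "\<dots> \<le> 2 ^ m * ((C * (real M + 1)) * (1 + \<bar>x\<bar>) ^ k)"
        unfolding choose_row_sum using C(1) j
        by (intro mult_right_mono mult_nonneg_nonneg) (auto intro: power_increasing)
      finally have "cmod (v x) * cmod (nth_deriv j g x - nth_deriv j f x)
          \<le> cmod (v x) * ((2 ^ m * (C * (M + 1))) * (1 + \<bar>x\<bar>) ^ k)"
        by (intro mult_left_mono) (simp_all add: mult.assoc add.commute)
      then show ?thesis using n(2)[OF True] by linarith
    next
      case False
      have "open {x. \<bar>x\<bar> < real n}" by (intro open_Collect_less continuous_intros)
      then have "nth_deriv l h x = 0" for l
      proof (rule nth_deriv_zero_open)
        fix y assume "y \<in> {x. \<bar>x\<bar> < real n}"
        then have "\<bar>a * y + 0\<bar> \<le> 1" by (simp add: a_def abs_mult)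
        then show "h y = 0" by (simp add: h_def b_def bump_eq_1)
      qed (use False in auto)
      then show ?thesis using e by (simp add: eq)
    qed
  qed
  ultimately show ?thesis by blast
qed

subsection \<open>A countable dense set\<close>

lemma nth_deriv_Lipschitz:
  assumes "smooth f" "\<And>x. cmod (nth_deriv (Suc j) f x) \<le> M"
  shows "cmod (nth_deriv j f x - nth_deriv j f y) \<le> M * \<bar>x - y\<bar>"
proof -
  have "norm (nth_deriv j f x - nth_deriv j f y) \<le> M * norm (x - y)"
  proof (rule differentiable_bound[of UNIV])
    show "(nth_deriv j f has_derivative (\<lambda>h. h *\<^sub>R nth_deriv (Suc j) f z)) (at z within UNIV)" for z
      using smooth_has_nth_deriv[OF assms(1), of j z] by (simp add: has_vector_derivative_def)
    show "onorm (\<lambda>h. h *\<^sub>R nth_deriv (Suc j) f z) \<le> M" for z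
      by (rule onorm_le) (simp add: mult.commute[of M] mult_left_mono[OF assms(2)])
  qed auto
  then show ?thesis by simp
qed

text \<open>A function of one of the classes below is determined, up to a small error in finitely many
  derivatives, by the rounded values of these derivatives on a fine grid.\<close>

definition test_class :: "nat \<Rightarrow> nat \<Rightarrow> nat \<Rightarrow> (real \<Rightarrow> complex) set" where
  "test_class m R M = {f. smooth f \<and> (\<forall>x. real R < \<bar>x\<bar> \<longrightarrow> f x = 0) \<and>
     (\<forall>j\<le>Suc m. \<forall>x. cmod (nth_deriv j f x) \<le> real M)}"

definition grid_code :: "nat \<Rightarrow> nat \<Rightarrow> nat \<Rightarrow> (real \<Rightarrow> complex) \<Rightarrow> (int \<times> int) list" where
  "grid_code m N R f = map (\<lambda>(j, i). let z = nth_deriv j f (of_int i / real N)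
       in (\<lfloor>real N * Re z\<rfloor>, \<lfloor>real N * Im z\<rfloor>))
     (List.product [0..<Suc m] [- int (R * N)..int (R * N)])"

lemma floor_eq_imp_close:
  assumes "\<lfloor>real N * a\<rfloor> = \<lfloor>real N * b\<rfloor>" "1 \<le> N"
  shows "\<bar>a - b\<bar> \<le> 1 / real N"
proof -
  have "\<bar>real N * a - real N * b\<bar> \<le> 1" using assms(1) by linarith
  then have "real N * \<bar>a - b\<bar> \<le> 1" using assms(2) by (simp add: abs_mult flip: right_diff_distrib)
  then show ?thesis using assms(2) by (simp add: field_simps)
qed

text \<open>Rounding the real and the imaginary part costs 1/N each. Moving from x to the grid point
  costs M/N for each of f and g, by the Lipschitz bound from the next derivative; this is why
  \<open>test_class m\<close> controls order m + 1.\<close>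

lemma grid_code_close:
  assumes f: "f \<in> test_class m R M" and g: "g \<in> test_class m R M"
    and code: "grid_code m N R f = grid_code m N R g" and N: "1 \<le> N" and j: "j \<le> m"
  shows "cmod (nth_deriv j f x - nth_deriv j g x) \<le> (2 + 2 * real M) / real N"
proof (cases "real R < \<bar>x\<bar>")
  case True
  have "nth_deriv j f x = 0" "nth_deriv j g x = 0"
    using f g by (auto intro!: nth_deriv_outside_support[OF _ True] simp: test_class_def)
  then show ?thesis by simp
next
  case False
  define i where "i = \<lfloor>x * real N\<rfloor>"
  define y where "y = of_int i / real N"
  have "- (real R * real N) \<le> x * real N" "x * real N \<le> real R * real N"
    using False N mult_right_mono[of "- real R" x "real N"] mult_right_mono[of x "real R" "real N"]
    by (auto simp: abs_le_iff)
  then have "- int (R * N) \<le> i" "i \<le> int (R * N)"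
    unfolding i_def by (simp_all add: le_floor_iff floor_le_iff)
  then have "(j, i) \<in> set (List.product [0..<Suc m] [- int (R * N)..int (R * N)])"
    using j by auto
  then have "\<lfloor>real N * Re (nth_deriv j f y)\<rfloor> = \<lfloor>real N * Re (nth_deriv j g y)\<rfloor>"
    "\<lfloor>real N * Im (nth_deriv j f y)\<rfloor> = \<lfloor>real N * Im (nth_deriv j g y)\<rfloor>"
    using code unfolding grid_code_def map_eq_conv y_def by (force simp: Let_def)+
  then have y: "cmod (nth_deriv j f y - nth_deriv j g y) \<le> 1 / real N + 1 / real N"
    using cmod_le[of "nth_deriv j f y - nth_deriv j g y"] floor_eq_imp_close[OF _ N]
    by (smt (verit) minus_complex.simps)
  have "\<bar>x * real N - of_int i\<bar> \<le> 1" unfolding i_def by linarith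
  moreover have "\<bar>x - y\<bar> = \<bar>x * real N - of_int i\<bar> / real N" using N by (simp add: y_def field_simps)
  ultimately have xy: "\<bar>x - y\<bar> \<le> 1 / real N" using N by (simp add: divide_right_mono)
  have "cmod (nth_deriv j f x - nth_deriv j f y) \<le> real M * \<bar>x - y\<bar>"
    "cmod (nth_deriv j g y - nth_deriv j g x) \<le> real M * \<bar>y - x\<bar>"
    using f g j by (auto intro!: nth_deriv_Lipschitz simp: test_class_def)
  moreover have "real M * \<bar>x - y\<bar> \<le> real M * (1 / real N)" by (intro mult_left_mono xy) auto
  ultimately have "cmod (nth_deriv j f x - nth_deriv j f y) \<le> real M / real N"
    "cmod (nth_deriv j g y - nth_deriv j g x) \<le> real M / real N" by (simp_all add: abs_minus_commute)
  moreover have "cmod (nth_deriv j f x - nth_deriv j g x) \<le> cmod (nth_deriv j f x - nth_deriv j f y)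
      + cmod (nth_deriv j f y - nth_deriv j g y) + cmod (nth_deriv j g y - nth_deriv j g x)"
    using norm_triangle_ineq[of "nth_deriv j f x - nth_deriv j f y" "nth_deriv j f y - nth_deriv j g x"]
      norm_triangle_ineq[of "nth_deriv j f y - nth_deriv j g y" "nth_deriv j g y - nth_deriv j g x"] by simp
  ultimately show ?thesis using y by (simp add: add_divide_distrib)
qed

lemma countable_dense_test_funs:
  obtains \<D> where "countable \<D>" "\<D> \<noteq> {}" "\<And>g. g \<in> \<D> \<Longrightarrow> test_fun g"
    "\<And>f m e. test_fun f \<Longrightarrow> 0 < e \<Longrightarrow> \<exists>g\<in>\<D>. \<forall>x. \<forall>j\<le>m. cmod (nth_deriv j g x - nth_deriv j f x) \<le> e"
proof
  \<comment> \<open>One representative is kept for every code that occurs; the codes are lists of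
    pairs of integers, hence countably many.\<close>
  define P where "P m N R M = inv_into (test_class m R M) (grid_code m N R) ` grid_code m N R ` test_class m R M"
    for m N R M
  define \<D> where "\<D> = (\<Union>m. \<Union>N. \<Union>R. \<Union>M. P m N R M)"
  have sub: "P m N R M \<subseteq> test_class m R M" for m N R M
    unfolding P_def by (auto intro: inv_into_into)
  have "countable (P m N R M)" for m N R M
    unfolding P_def by (rule countable_image[OF countableI_type])
  then show "countable \<D>" unfolding \<D>_def by (intro countable_UN) auto
  have "(\<lambda>x. 0) \<in> test_class 0 0 0" by (simp add: test_class_def nth_deriv_const)
  then have "P 0 0 0 0 \<noteq> {}" unfolding P_def by blast
  then show "\<D> \<noteq> {}" unfolding \<D>_def by blast
  show "test_fun g" if "g \<in> \<D>" for g
  proof -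
    obtain m N R M where "g \<in> P m N R M" using \<open>g \<in> \<D>\<close> unfolding \<D>_def by blast
    then have "g \<in> test_class m R M" using sub by blast
    then show ?thesis unfolding test_class_def test_fun_def by blast
  qed
  show "\<exists>g\<in>\<D>. \<forall>x. \<forall>j\<le>m. cmod (nth_deriv j g x - nth_deriv j f x) \<le> e" if tf: "test_fun f" and e0: "0 < e" for f m e
  proof -
    obtain R :: nat where "\<forall>x. real R < \<bar>x\<bar> \<longrightarrow> f x = 0"
      using test_fun_support[OF tf] by blast
    moreover obtain M :: nat where "\<forall>j\<le>Suc m. \<forall>x. cmod (nth_deriv j f x) \<le> real M"
      using test_fun_bound[OF tf, of "Suc m"] by blast
    ultimately have f: "f \<in> test_class m R M" using tf by (auto simp: test_class_def test_fun_def)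
    obtain N :: nat where N0: "(2 + 2 * real M) / e \<le> real N" using real_arch_simple by blast
    moreover have "0 < (2 + 2 * real M) / e" using e0 by (intro divide_pos_pos) auto
    ultimately have "0 < real N" by linarith
    then have N: "1 \<le> N" "(2 + 2 * real M) / real N \<le> e"
      using N0 e0 by (simp_all add: field_simps Suc_le_eq)
    define g where "g = inv_into (test_class m R M) (grid_code m N R) (grid_code m N R f)"
    have g: "g \<in> P m N R M" using f unfolding P_def g_def by blast
    have "grid_code m N R g = grid_code m N R f" unfolding g_def by (rule f_inv_into_f[OF imageI[OF f]])
    then have "\<forall>x. \<forall>j\<le>m. cmod (nth_deriv j g x - nth_deriv j f x) \<le> e"
      using grid_code_close[OF subsetD[OF sub g] f _ N(1)] N(2) order_trans by blast
    moreover have "g \<in> \<D>" using g unfolding \<D>_def by blast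
    ultimately show ?thesis by blast
  qed
qed

lemma dense_test_fun_sequence:
  obtains G :: "nat \<Rightarrow> real \<Rightarrow> complex" where "\<And>k. test_fun (G k)"
    "\<And>f m v e K. f \<in> O_M \<Longrightarrow> v \<in> Schwartz \<Longrightarrow> 0 < e \<Longrightarrow>
      \<exists>k\<ge>K. \<forall>x. \<forall>j\<le>m. cmod (v x) * cmod (nth_deriv j (G k) x - nth_deriv j f x) \<le> e"
proof -
  obtain \<D> where D: "countable \<D>" "\<D> \<noteq> {}" "\<And>g. g \<in> \<D> \<Longrightarrow> test_fun g"
    "\<And>f m e. test_fun f \<Longrightarrow> 0 < e \<Longrightarrow> \<exists>g\<in>\<D>. \<forall>x. \<forall>j\<le>m. cmod (nth_deriv j g x - nth_deriv j f x) \<le> e"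
    using countable_dense_test_funs by blast
  \<comment> \<open>Ignoring the second component of the decoded pair makes every member recur at
    arbitrarily large indices, so k \<ge> K can be demanded.\<close>
  define G where "G k = from_nat_into \<D> (fst (prod_decode k))" for k
  show thesis
  proof
    show "test_fun (G k)" for k unfolding G_def by (intro D(3) from_nat_into D(2))
    fix f m v e K assume f: "f \<in> O_M" and v: "v \<in> Schwartz" and e: "0 < (e::real)"
    obtain g where g: "test_fun g" "\<And>x j. j \<le> m \<Longrightarrow> cmod (v x) * cmod (nth_deriv j g x - nth_deriv j f x) \<le> e / 2"
      using test_fun_dense[OF f v, of "e / 2" m] e by auto
    obtain B where B: "0 \<le> B" "\<And>x. cmod (v x) \<le> B" using Schwartz_bound[OF v, of 0] by auto
    have "0 < e / 2 / (B + 1)" using e B(1) by simp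
    then obtain h where h: "h \<in> \<D>" "\<And>x j. j \<le> m \<Longrightarrow> cmod (nth_deriv j h x - nth_deriv j g x) \<le> e / 2 / (B + 1)"
      using D(4)[OF g(1)] by blast
    define k where "k = prod_encode (to_nat_on \<D> h, K)"
    have "G k = h" unfolding G_def k_def using D(1) h(1) by simp
    moreover have "K \<le> k" unfolding k_def by (rule le_prod_encode_2)
    moreover have "cmod (v x) * cmod (nth_deriv j h x - nth_deriv j f x) \<le> e" if "j \<le> m" for x j
    proof -
      have "cmod (v x) * cmod (nth_deriv j h x - nth_deriv j g x) \<le> (B + 1) * (e / 2 / (B + 1))"
        using B(1) B(2)[of x] by (intro mult_mono h that) auto
      also have "\<dots> = e / 2" using B(1) by (simp add: field_simps)
      finally have "cmod (v x) * (cmod (nth_deriv j h x - nth_deriv j g x) + cmod (nth_deriv j g x - nth_deriv j f x)) \<le> e"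
        using g(2)[OF that, of x] by (simp add: distrib_left)
      moreover have "cmod (v x) * cmod (nth_deriv j h x - nth_deriv j f x) \<le>
        cmod (v x) * (cmod (nth_deriv j h x - nth_deriv j g x) + cmod (nth_deriv j g x - nth_deriv j f x))"
        using norm_triangle_ineq[of "nth_deriv j h x - nth_deriv j g x" "nth_deriv j g x - nth_deriv j f x"]
        by (intro mult_left_mono) auto
      ultimately show ?thesis by linarith
    qed
    ultimately show "\<exists>k\<ge>K. \<forall>x. \<forall>j\<le>m. cmod (v x) * cmod (nth_deriv j (G k) x - nth_deriv j f x) \<le> e"
      by blast
  qed
qed

subsection \<open>Sums of separated translates\<close>

text \<open>The intervals of radius \<open>r n\<close> around \<open>c n\<close> are pairwise
  disjoint, so at each point at most one summand contributes to the sum or its derivatives;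
  \<open>fin\<close> yields local finiteness.\<close>

lemma separated_lsum:
  assumes s: "\<And>n. smooth (F n)"
    and supp: "\<forall>n x. r n < \<bar>x - c n\<bar> \<longrightarrow> F n x = 0"
    and sep: "\<forall>n n'. n \<noteq> n' \<longrightarrow> r n + r n' < \<bar>c n - c n'\<bar>"
    and fin: "\<And>M. finite {n. \<bar>c n\<bar> \<le> M + r n}"
  shows "smooth (lsum F)"
    and "\<bar>x - c n\<bar> \<le> r n \<Longrightarrow> nth_deriv j (lsum F) x = nth_deriv j (F n) x"
    and "(\<And>n. r n < \<bar>x - c n\<bar>) \<Longrightarrow> nth_deriv j (lsum F) x = 0"
proof -
  have lf: "locally_finite_family F" unfolding locally_finite_family_def
  proof
    fix M
    have "F n x = 0" if "\<bar>x\<bar> < M" "n \<notin> {n. \<bar>c n\<bar> \<le> M + r n}" for n x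
      using that supp by auto
    with fin show "\<exists>I. finite I \<and> (\<forall>n x. \<bar>x\<bar> < M \<longrightarrow> n \<notin> I \<longrightarrow> F n x = 0)" by blast
  qed
  have z: "nth_deriv j (F n) x = 0" if "r n < \<bar>x - c n\<bar>" for n x j
  proof -
    have "open {x. r n < \<bar>x - c n\<bar>}" by (intro open_Collect_less continuous_intros)
    then show ?thesis by (rule nth_deriv_zero_open) (use supp that in auto)
  qed
  show "smooth (lsum F)" by (rule smooth_lsum[OF lf s])
  show "nth_deriv j (lsum F) x = nth_deriv j (F n) x" if x: "\<bar>x - c n\<bar> \<le> r n"
  proof -
    have "nth_deriv j (F n') x = 0" if "n' \<notin> {n}" for n'
      using sep[rule_format, of n n'] x that by (intro z) auto
    then have "lsum (\<lambda>n. nth_deriv j (F n)) x = (\<Sum>n\<in>{n}. nth_deriv j (F n) x)"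
      by (intro lsum_eq_sum) auto
    then show ?thesis by (simp add: nth_deriv_lsum[OF lf s])
  qed
  show "nth_deriv j (lsum F) x = 0" if "\<And>n. r n < \<bar>x - c n\<bar>"
    using z[OF that] by (simp add: nth_deriv_lsum[OF lf s] lsum_def)
qed

lemma comp_op_shift_power: "(comp_op (\<lambda>x. x + 1) ^^ n) f = (\<lambda>x. f (x + real n))"
  by (induction n) (auto simp: comp_op_def fun_eq_iff add_ac)

text \<open>A test function near f is periodised with a period so long that the additional copies
  only live where the weight is small.\<close>

lemma translation_periodic_dense:
  "dense_in O_M_topology (periodic_points O_M_topology (comp_op (\<lambda>x. x + 1)))"
proof (rule dense_in_O_M)
  show "periodic_points O_M_topology (comp_op (\<lambda>x. x + 1)) \<subseteq> O_M"
    by (auto simp: periodic_points_def)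
  fix f m v e assume f: "f \<in> O_M" and v: "v \<in> Schwartz" and e: "0 < (e::real)"
  obtain g where g: "test_fun g" "\<And>x j. j \<le> m \<Longrightarrow> cmod (v x) * cmod (nth_deriv j g x - nth_deriv j f x) \<le> e / 2"
    using test_fun_dense[OF f v, of "e / 2" m] e by auto
  obtain R :: nat where R: "\<And>x. real R < \<bar>x\<bar> \<Longrightarrow> g x = 0" using test_fun_support[OF g(1)] by blast
  obtain M :: nat where M: "\<And>x j. j \<le> m \<Longrightarrow> cmod (nth_deriv j g x) \<le> real M" using test_fun_bound[OF g(1)] by blast
  obtain n :: nat where n: "\<And>x. real n \<le> \<bar>x\<bar> \<Longrightarrow> cmod (v x) * (real M * (1 + \<bar>x\<bar>) ^ 0) \<le> e / 2"
    using weighted_small_at_infinity[OF v, of "e / 2" "real M" 0] e by auto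
  \<comment> \<open>More than 2 R, so that the copies are disjoint; and at least R + n, so that
    every copy but the central one lies in |x| \<ge> n.\<close>
  define k where "k = 2 * R + n + 1"
  define F where "F l x = g (x + (- (of_int l * real k)))" for l :: int and x
  have sF: "smooth (F l)" for l
    unfolding F_def[abs_def] by (rule smooth_shift[OF test_fun_smooth[OF g(1)]])
  have dF: "nth_deriv j (F l) x = nth_deriv j g (x - of_int l * real k)" for j l x
    unfolding F_def[abs_def] nth_deriv_shift[OF test_fun_smooth[OF g(1)]] by simp
  have dist: "real k \<le> \<bar>of_int l * real k - of_int l' * real k\<bar>" if "l \<noteq> l'" for l l' :: int
  proof -
    have "1 \<le> \<bar>of_int (l - l') :: real\<bar>" using that by linarith
    then have "1 * real k \<le> \<bar>of_int (l - l') :: real\<bar> * real k" by (intro mult_right_mono) auto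
    then show ?thesis by (simp add: abs_mult flip: left_diff_distrib)
  qed
  have sep: "\<forall>l l'. l \<noteq> l' \<longrightarrow> real R + real R < \<bar>of_int l * real k - of_int l' * real k\<bar>"
    using dist by (fastforce simp: k_def)
  have fin: "finite {l. \<bar>of_int l * real k\<bar> \<le> M' + real R}" for M'
  proof (rule finite_subset)
    show "{l. \<bar>of_int l * real k\<bar> \<le> M' + real R} \<subseteq> {- \<lceil>M' + real R\<rceil>..\<lceil>M' + real R\<rceil>}"
    proof
      fix l assume "l \<in> {l. \<bar>of_int l * real k\<bar> \<le> M' + real R}"
      moreover have "\<bar>of_int l\<bar> * 1 \<le> \<bar>of_int l\<bar> * real k" by (intro mult_left_mono) (auto simp: k_def)
      ultimately have "\<bar>of_int l\<bar> \<le> M' + real R" by (simp add: abs_mult)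
      then show "l \<in> {- \<lceil>M' + real R\<rceil>..\<lceil>M' + real R\<rceil>}" by (simp add: abs_le_iff) linarith
    qed
  qed simp
  have supp: "\<forall>l x. real R < \<bar>x - of_int l * real k\<bar> \<longrightarrow> F l x = 0"
    using R by (simp add: F_def)
  note ls = separated_lsum[of F "\<lambda>_. real R" "\<lambda>l. of_int l * real k", OF sF supp sep fin]
  have val: "nth_deriv j (lsum F) x = 0 \<or>
      (\<exists>l. \<bar>x - of_int l * real k\<bar> \<le> real R \<and> nth_deriv j (lsum F) x = nth_deriv j g (x - of_int l * real k))" for j x
    using ls(2,3) dF by (metis not_le)
  have sP: "smooth (lsum F)" by (rule ls(1))
  have "lsum F \<in> O_M" unfolding O_M_iff
  proof (intro conjI allI sP)
    fix j
    obtain M' :: nat where "\<And>x i. i \<le> j \<Longrightarrow> cmod (nth_deriv i g x) \<le> real M'" using test_fun_bound[OF g(1)] by blast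
    then have "cmod (nth_deriv j (lsum F) x) \<le> real M' * (1 + \<bar>x\<bar>) ^ 0" for x
      using val[of j x] by auto
    then show "\<exists>C k. \<forall>x. cmod (nth_deriv j (lsum F) x) \<le> C * (1 + \<bar>x\<bar>) ^ k" by blast
  qed
  moreover have "(comp_op (\<lambda>x. x + 1) ^^ k) (lsum F) = lsum F"
  proof
    fix x
    have F1: "F (l + 1) (x + real k) = F l x" for l by (simp add: F_def algebra_simps)
    have "lsum F (x + real k) = (\<Sum>l\<in>(\<lambda>l. l + 1) ` {l. F l x \<noteq> 0}. F l (x + real k))"
      unfolding lsum_def
    proof (rule sum.cong)
      have "{n. F n (x + real k) \<noteq> 0} \<subseteq> (\<lambda>l. l + 1) ` {l. F l x \<noteq> 0}"
        using F1[of "_ - 1"] by (auto intro!: image_eqI[of _ _ "_ - 1"])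
      then show "{n. F n (x + real k) \<noteq> 0} = (\<lambda>l. l + 1) ` {l. F l x \<noteq> 0}" using F1 by auto
    qed simp
    also have "\<dots> = lsum F x" by (subst sum.reindex) (auto simp: F1 lsum_def)
    finally show "(comp_op (\<lambda>x. x + 1) ^^ k) (lsum F) x = lsum F x" by (simp add: comp_op_shift_power)
  qed
  ultimately have "lsum F \<in> periodic_points O_M_topology (comp_op (\<lambda>x. x + 1))"
    by (auto simp: periodic_points_def k_def intro!: exI[of _ k])
  moreover have "cmod (v x) * cmod (nth_deriv j (lsum F) x - nth_deriv j f x) \<le> e" if j: "j \<le> m" for x j
  proof -
    have "cmod (v x) * cmod (nth_deriv j (lsum F) x - nth_deriv j g x) \<le> e / 2"
    proof (cases "\<bar>x\<bar> \<le> real R")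
      case True
      then show ?thesis using ls(2)[of x 0 j] dF e by simp
    next
      case False
      then have g0: "nth_deriv j g x = 0" by (intro nth_deriv_outside_support[OF R]) auto
      consider "nth_deriv j (lsum F) x = 0"
        | l where "\<bar>x - of_int l * real k\<bar> \<le> real R" "nth_deriv j (lsum F) x = nth_deriv j g (x - of_int l * real k)"
        using val[of j x] by blast
      then show ?thesis
      proof cases
        case 1
        then show ?thesis using g0 e by simp
      next
        case (2 l)
        have "l \<noteq> 0" using 2(1) False by auto
        then have "real k \<le> \<bar>of_int l * real k\<bar>" using dist[of l 0] by simp
        then have "real n \<le> \<bar>x\<bar>" using 2(1) by (simp add: k_def)
        then have "cmod (v x) * real M \<le> e / 2" using n by simp
        moreover have "cmod (v x) * cmod (nth_deriv j (lsum F) x) \<le> cmod (v x) * real M"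
          unfolding 2(2) by (intro mult_left_mono M j) auto
        ultimately show ?thesis using g0 by simp
      qed
    qed
    then have "cmod (v x) * (cmod (nth_deriv j (lsum F) x - nth_deriv j g x) + cmod (nth_deriv j g x - nth_deriv j f x)) \<le> e"
      using g(2)[OF j, of x] by (simp add: distrib_left)
    moreover have "cmod (v x) * cmod (nth_deriv j (lsum F) x - nth_deriv j f x) \<le>
        cmod (v x) * (cmod (nth_deriv j (lsum F) x - nth_deriv j g x) + cmod (nth_deriv j g x - nth_deriv j f x))"
      using norm_triangle_ineq[of "nth_deriv j (lsum F) x - nth_deriv j g x" "nth_deriv j g x - nth_deriv j f x"]
      by (intro mult_left_mono) auto
    ultimately show ?thesis by linarith
  qed
  ultimately show "\<exists>g\<in>periodic_points O_M_topology (comp_op (\<lambda>x. x + 1)).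
      \<forall>x. \<forall>j\<le>m. cmod (v x) * cmod (nth_deriv j g x - nth_deriv j f x) \<le> e" by blast
qed

text \<open>The hypercyclic vector is the sum of the translates G l (x - n l) of a dense sequence, with
  gaps so large that all translates except the k-th one are pushed to the region where the
  weight is small when the sum is translated back by n k.\<close>

lemma translation_hypercyclic: "hypercyclic O_M_topology (comp_op (\<lambda>x. x + 1))"
proof -
  obtain G :: "nat \<Rightarrow> real \<Rightarrow> complex" where G: "\<And>k. test_fun (G k)" and
    dense: "\<And>f m v e K. f \<in> O_M \<Longrightarrow> v \<in> Schwartz \<Longrightarrow> 0 < e \<Longrightarrow>
      \<exists>k\<ge>K. \<forall>x. \<forall>j\<le>m. cmod (v x) * cmod (nth_deriv j (G k) x - nth_deriv j f x) \<le> e"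
    using dense_test_fun_sequence by blast
  obtain R :: "nat \<Rightarrow> nat" where R: "\<And>k x. real (R k) < \<bar>x\<bar> \<Longrightarrow> G k x = 0"
    using test_fun_support[OF G] by metis
  have "\<exists>M::nat. \<forall>j\<le>k. \<forall>x. cmod (nth_deriv j (G k) x) \<le> real M" for k
    by (rule test_fun_bound[OF G])
  then obtain M :: "nat \<Rightarrow> nat" where M: "\<And>k j x. j \<le> k \<Longrightarrow> cmod (nth_deriv j (G k) x) \<le> real (M k)"
    by metis
  \<comment> \<open>An increasing sequence that dominates the support radius of \<open>G k\<close>,
    its derivatives up to order k and, through the summand 1, the index k itself.\<close>
  define L where "L k = (\<Sum>i\<le>k. R i + M i + 1)" for k
  define n where "n k = (\<Sum>i\<le>k. 4 * L i)" for k
  have L_step: "L (Suc k) = L k + R (Suc k) + M (Suc k) + 1" for k by (simp add: L_def)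
  have L_ge: "R k \<le> L k" "M k \<le> L k" for k by (cases k; simp add: L_def)+
  have L_mono: "L l \<le> L k" if "l \<le> k" for l k
    using that by (rule lift_Suc_mono_le[of L, rotated]) (simp add: L_step)
  have L_gt: "k < L k" for k by (induction k) (auto simp: L_step, simp add: L_def)
  have n_ge: "4 * L k \<le> n k" for k by (cases k) (auto simp: n_def)
  have n_step: "n (Suc k) = n k + 4 * L (Suc k)" for k by (simp add: n_def)
  have n_mono: "n l \<le> n k" if "l \<le> k" for l k
    using that by (rule lift_Suc_mono_le[of n, rotated]) (simp add: n_step)
  have n_gap: "n l + 4 * L k \<le> n k" if "l < k" for l k
    using that n_mono[of l "k - 1"] n_step[of "k - 1"] by (cases k) auto
  have gap: "4 * real (max (L l) (L l')) \<le> \<bar>real (n l) - real (n l')\<bar>" if "l \<noteq> l'" for l l'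
  proof (cases "l < l'")
    case True
    then have "real (n l) + 4 * real (L l') \<le> real (n l')" using n_gap[OF True] by linarith
    then show ?thesis using L_mono[of l l'] True by (simp add: max_def)
  next
    case False
    then have l: "l' < l" using that by simp
    then have "real (n l') + 4 * real (L l) \<le> real (n l)" using n_gap[OF l] by linarith
    then show ?thesis using L_mono[of l' l] l by (simp add: max_def)
  qed
  define F where "F l x = G l (x + (- real (n l)))" for l x
  have sF: "smooth (F l)" for l
    unfolding F_def[abs_def] by (rule smooth_shift[OF test_fun_smooth[OF G]])
  have dF: "nth_deriv j (F l) x = nth_deriv j (G l) (x - real (n l))" for j l x
    unfolding F_def[abs_def] nth_deriv_shift[OF test_fun_smooth[OF G]] by simp
  have supp: "\<forall>l x. real (L l) < \<bar>x - real (n l)\<bar> \<longrightarrow> F l x = 0"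
  proof (intro allI impI)
    fix l x assume "real (L l) < \<bar>x - real (n l)\<bar>"
    then show "F l x = 0" unfolding F_def using L_ge(1)[of l] by (intro R) auto
  qed
  have sep: "\<forall>l l'. l \<noteq> l' \<longrightarrow> real (L l) + real (L l') < \<bar>real (n l) - real (n l')\<bar>"
  proof (intro allI impI)
    fix l l' :: nat assume "l \<noteq> l'"
    then show "real (L l) + real (L l') < \<bar>real (n l) - real (n l')\<bar>"
      using gap[of l l'] L_gt[of l] by (simp add: max_def split: if_splits)
  qed
  have fin: "finite {l. \<bar>real (n l)\<bar> \<le> M' + real (L l)}" for M'
  proof (rule finite_subset)
    show "{l. \<bar>real (n l)\<bar> \<le> M' + real (L l)} \<subseteq> {..nat \<lceil>M'\<rceil>}"
    proof
      fix l assume "l \<in> {l. \<bar>real (n l)\<bar> \<le> M' + real (L l)}"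
      moreover have "real (4 * L l) \<le> real (n l)" using n_ge[of l] by linarith
      ultimately have "real l \<le> M'" using L_gt[of l] by simp
      then show "l \<in> {..nat \<lceil>M'\<rceil>}" by simp linarith
    qed
  qed simp
  note ls = separated_lsum[of F "\<lambda>l. real (L l)" "\<lambda>l. real (n l)", OF sF supp sep fin]
  define f where "f = lsum F"
  have sf: "smooth f" unfolding f_def by (rule ls(1))
  have val: "nth_deriv j f x = 0 \<or>
      (\<exists>l. \<bar>x - real (n l)\<bar> \<le> real (L l) \<and> nth_deriv j f x = nth_deriv j (G l) (x - real (n l)))" for j x
    unfolding f_def using ls(2)[of x] ls(3)[of x j] dF by (metis not_le)
  \<comment> \<open>\<open>M l\<close> controls orders up to l only. For a fixed order m the
    finitely many l < m are exceptions, collected in C.\<close>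
  have Gb: "\<exists>C. 0 \<le> C \<and> (\<forall>l j x. j \<le> m \<longrightarrow> cmod (nth_deriv j (G l) x) \<le> C + real (L l))" for m
  proof -
    obtain B :: "nat \<Rightarrow> nat" where B: "\<And>l j x. j \<le> m \<Longrightarrow> cmod (nth_deriv j (G l) x) \<le> real (B l)"
      using test_fun_bound[OF G, of m] by metis
    have "cmod (nth_deriv j (G l) x) \<le> (\<Sum>i<m. real (B i)) + real (L l)" if "j \<le> m" for l j x
    proof (cases "l < m")
      case True
      then have "real (B l) \<le> (\<Sum>i<m. real (B i))" by (intro member_le_sum) auto
      then show ?thesis using B[OF that, of l x] by linarith
    next
      case False
      then have "cmod (nth_deriv j (G l) x) \<le> real (M l)" using that by (intro M) auto
      moreover have "0 \<le> (\<Sum>i<m. real (B i))" by (intro sum_nonneg) auto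
      ultimately show ?thesis using L_ge(2)[of l] by linarith
    qed
    then show ?thesis by (intro exI[of _ "\<Sum>i<m. real (B i)"]) (auto intro: sum_nonneg)
  qed
  have f: "f \<in> O_M" unfolding O_M_iff
  proof (intro conjI allI sf)
    fix j
    obtain C where C: "0 \<le> C" "\<And>l x. cmod (nth_deriv j (G l) x) \<le> C + real (L l)" using Gb[of j] by blast
    have "cmod (nth_deriv j f x) \<le> (C + 1) * (1 + \<bar>x\<bar>) ^ 1" for x
    proof -
      consider "nth_deriv j f x = 0"
        | l where "\<bar>x - real (n l)\<bar> \<le> real (L l)" "nth_deriv j f x = nth_deriv j (G l) (x - real (n l))"
        using val[of j x] by blast
      then have "cmod (nth_deriv j f x) \<le> C + \<bar>x\<bar>"
      proof cases
        case 1
        then show ?thesis using C(1) by simp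
      next
        case (2 l)
        have "real (4 * L l) \<le> real (n l)" using n_ge[of l] by linarith
        \<comment> \<open>The copies are unbounded in size, but the l-th one sits at distance at
          least 3 \<open>L l\<close> from 0, so the sum grows at most linearly.\<close>
        then have "real (L l) \<le> \<bar>x\<bar>" using 2(1) by auto
        then show ?thesis unfolding 2(2) using C(2)[of l "x - real (n l)"] by linarith
      qed
      also have "\<dots> \<le> (C + 1) * (1 + \<bar>x\<bar>) ^ 1" using C(1) by (simp add: algebra_simps)
      finally show ?thesis .
    qed
    then show "\<exists>C k. \<forall>x. cmod (nth_deriv j f x) \<le> C * (1 + \<bar>x\<bar>) ^ k" by blast
  qed
  have orbit: "(comp_op (\<lambda>x. x + 1) ^^ i) f \<in> O_M" for i
    unfolding comp_op_shift_power
  proof (rule O_M_compose[OF f])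
    have "(\<lambda>x. complex_of_real x + of_nat i) \<in> O_M" by (intro O_M_plus O_M_id O_M_const)
    then show "cplx (\<lambda>x. x + real i) \<in> O_M" by simp
  qed
  have "dense_in O_M_topology (range (\<lambda>i. (comp_op (\<lambda>x. x + 1) ^^ i) f))"
  proof (rule dense_in_O_M)
    show "range (\<lambda>i. (comp_op (\<lambda>x. x + 1) ^^ i) f) \<subseteq> O_M" using orbit by blast
    fix g m v e assume g: "g \<in> O_M" and v: "v \<in> Schwartz" and e: "0 < (e::real)"
    obtain C where C: "0 \<le> C" "\<And>l j x. j \<le> m \<Longrightarrow> cmod (nth_deriv j (G l) x) \<le> C + real (L l)" using Gb[of m] by blast
    obtain K :: nat where K: "\<And>x. real K \<le> \<bar>x\<bar> \<Longrightarrow> cmod (v x) * ((C + 1) * (1 + \<bar>x\<bar>) ^ 1) \<le> e / 2"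
      using weighted_small_at_infinity[OF v, of "e / 2" "C + 1" 1] e by auto
    obtain k where k: "K \<le> k" "\<And>x j. j \<le> m \<Longrightarrow> cmod (v x) * cmod (nth_deriv j (G k) x - nth_deriv j g x) \<le> e / 2"
      using dense[OF g v, of "e / 2" K m] e by auto
    let ?f = "\<lambda>x. f (x + real (n k))"
    have df: "nth_deriv j ?f x = nth_deriv j f (x + real (n k))" for j x
      by (simp add: nth_deriv_shift[OF sf])
    have "cmod (v x) * cmod (nth_deriv j ?f x - nth_deriv j g x) \<le> e" if j: "j \<le> m" for x j
    proof -
      have "cmod (v x) * cmod (nth_deriv j ?f x - nth_deriv j (G k) x) \<le> e / 2"
      proof (cases "\<bar>x\<bar> \<le> real (L k)")
        case True
        then have "\<bar>x + real (n k) - real (n k)\<bar> \<le> real (L k)" by simp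
        then have "nth_deriv j f (x + real (n k)) = nth_deriv j (F k) (x + real (n k))"
          unfolding f_def by (rule ls(2))
        then have "nth_deriv j ?f x = nth_deriv j (G k) x" by (simp add: df dF)
        then show ?thesis using e by simp
      next
        case False
        have G0: "nth_deriv j (G k) x = 0"
          using False L_ge(1)[of k] by (intro nth_deriv_outside_support[OF R]) auto
        consider "nth_deriv j ?f x = 0"
          | l where "\<bar>x + real (n k) - real (n l)\<bar> \<le> real (L l)"
              "nth_deriv j ?f x = nth_deriv j (G l) (x + real (n k) - real (n l))"
          using val[of j "x + real (n k)"] unfolding df by blast
        then show ?thesis
        proof cases
          case 1
          then show ?thesis using G0 e by simp
        next
          case (2 l)
          have "l \<noteq> k" using 2(1) False by auto
          then have gp: "4 * real (max (L l) (L k)) \<le> \<bar>real (n l) - real (n k)\<bar>" by (rule gap)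
          \<comment> \<open>The gap of 4 times the larger of \<open>L l\<close> and
            \<open>L k\<close> survives subtraction of the radius \<open>L l\<close>. Then K \<le> k
            < L k \<le> |x| puts x where the weight is small, which is why k \<ge> K was
            demanded.\<close>
          have "real (L l) \<le> \<bar>x\<bar>" "real (L k) \<le> \<bar>x\<bar>"
            using 2(1) gp by (auto simp: max_def split: if_splits)
          then have x: "real (L l) \<le> \<bar>x\<bar>" "real K \<le> \<bar>x\<bar>" using L_gt[of k] k(1) by auto
          have "cmod (nth_deriv j ?f x) \<le> C + real (L l)" unfolding 2(2) by (rule C(2)[OF j])
          also have "\<dots> \<le> C * (1 + \<bar>x\<bar>) + (1 + \<bar>x\<bar>)"
            using C(1) x(1) mult_left_mono[of 1 "1 + \<bar>x\<bar>" C] by simp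
          also have "\<dots> = (C + 1) * (1 + \<bar>x\<bar>) ^ 1" by (simp add: distrib_right)
          finally have "cmod (v x) * cmod (nth_deriv j ?f x) \<le> cmod (v x) * ((C + 1) * (1 + \<bar>x\<bar>) ^ 1)"
            by (rule mult_left_mono) simp
          then show ?thesis using K[OF x(2)] G0 by simp
        qed
      qed
      then have "cmod (v x) * (cmod (nth_deriv j ?f x - nth_deriv j (G k) x) + cmod (nth_deriv j (G k) x - nth_deriv j g x)) \<le> e"
        using k(2)[OF j, of x] by (simp add: distrib_left)
      moreover have "cmod (v x) * cmod (nth_deriv j ?f x - nth_deriv j g x) \<le>
          cmod (v x) * (cmod (nth_deriv j ?f x - nth_deriv j (G k) x) + cmod (nth_deriv j (G k) x - nth_deriv j g x))"
        using norm_triangle_ineq[of "nth_deriv j ?f x - nth_deriv j (G k) x" "nth_deriv j (G k) x - nth_deriv j g x"]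
        by (intro mult_left_mono) auto
      ultimately show ?thesis by linarith
    qed
    moreover have "?f \<in> range (\<lambda>i. (comp_op (\<lambda>x. x + 1) ^^ i) f)"
      unfolding comp_op_shift_power by blast
    ultimately show "\<exists>h\<in>range (\<lambda>i. (comp_op (\<lambda>x. x + 1) ^^ i) f).
        \<forall>x. \<forall>j\<le>m. cmod (v x) * cmod (nth_deriv j h x - nth_deriv j g x) \<le> e" by blast
  qed
  then show ?thesis unfolding hypercyclic_def using f by auto
qed

section \<open>A smooth solution of the Abel equation\<close>

lemma int_crossing:
  fixes g :: "int \<Rightarrow> real"
  assumes "l \<le> u" "g l \<le> c" "c < g u"
  obtains n where "l \<le> n" "n < u" "g n \<le> c" "c < g (n + 1)"
proof (rule ccontr)
  assume "\<not> thesis"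
  then have step: "g (n + 1) \<le> c" if "l \<le> n" "n < u" "g n \<le> c" for n
    using that \<open>\<And>n. l \<le> n \<Longrightarrow> n < u \<Longrightarrow> g n \<le> c \<Longrightarrow> c < g (n + 1) \<Longrightarrow> thesis\<close> not_le by blast
  have "n \<le> u \<longrightarrow> g n \<le> c" if "l \<le> n" for n
    using that by (induction n rule: int_ge_induct) (use assms(2) step in auto)
  from this[OF assms(1)] assms(3) show False by simp
qed

text \<open>An abstract group of iterates moving all points to the right. It is instantiated with
  the iterates of \<psi> or, if \<psi> moves points to the left, with those of its inverse.\<close>

locale abel_flow =
  fixes p :: "int \<Rightarrow> real \<Rightarrow> real"
  assumes zero: "p 0 x = x"
    and add: "p (m + n) x = p m (p n x)"
    and smooth_p: "smooth (cplx (p n))"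
    and less: "x < p 1 x"
    and mono1: "x < y \<Longrightarrow> p 1 x < p 1 y"
    and orbit_bound: "1 \<le> j \<Longrightarrow> \<exists>C k. \<forall>n x. \<bar>p n x\<bar> \<le> \<rho> \<longrightarrow>
        cmod (nth_deriv j (cplx (p n)) x) \<le> C * (1 + \<bar>x\<bar>) ^ k"
    and growth: "\<exists>C k. \<forall>n. \<bar>real_of_int n\<bar> \<le> C * (1 + \<bar>p n 0\<bar>) ^ k"
begin

lemma inverse: "p (- n) (p n x) = x" "p n (p (- n) x) = x"
  by (simp_all add: zero flip: add)

lemma mono: "x < y \<Longrightarrow> p n x < p n y"
proof (induction n arbitrary: x y rule: int_induct[where k=0])
  case base
  then show ?case by (simp add: zero)
next
  case (step1 i)
  then show ?case using mono1 by (simp add: add)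
next
  case (step2 i)
  have "p (- 1) x < p (- 1) y"
  proof (rule ccontr)
    assume "\<not> p (- 1) x < p (- 1) y"
    then have "p 1 (p (- 1) y) \<le> p 1 (p (- 1) x)"
      using mono1[of "p (- 1) y" "p (- 1) x"] by (cases "p (- 1) y = p (- 1) x") auto
    then show False using inverse(2)[of 1] step2.prems by simp
  qed
  then have "p i (p (- 1) x) < p i (p (- 1) y)" by (rule step2.IH)
  then show ?case using add[of i "- 1"] by simp
qed

lemma mono_le: "x \<le> y \<Longrightarrow> p n x \<le> p n y"
  using mono[of x y n] by (auto simp: le_less)

lemma increasing: "m < n \<Longrightarrow> p m x < p n x"
proof (induction n rule: int_gr_induct)
  case base
  show ?case using less[of "p m x"] by (simp add: add.commute flip: add)
next
  case (step i)
  then show ?case using less[of "p i x"] add[of 1 i x] by (simp add: add.commute)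
qed

lemma increasing_le: "m \<le> n \<Longrightarrow> p m x \<le> p n x"
  using increasing[of m n x] by (auto simp: le_less)

text \<open>By \<open>growth\<close>, |p n 0| cannot stay bounded as |n| grows; monotonicity in n
  determines the signs.\<close>

lemma escape: "\<exists>k\<ge>1. M \<le> p k 0 \<and> p (- k) 0 \<le> - M"
proof -
  obtain C r where C: "\<And>n. \<bar>real_of_int n\<bar> \<le> C * (1 + \<bar>p n 0\<bar>) ^ r" using growth by blast
  obtain k :: nat where k: "\<bar>C\<bar> * (1 + \<bar>M\<bar>) ^ r < real k" using reals_Archimedean2 by blast
  have big: "\<bar>M\<bar> < \<bar>p n 0\<bar>" if "\<bar>n\<bar> = int k" for n
  proof (rule ccontr)
    assume "\<not> \<bar>M\<bar> < \<bar>p n 0\<bar>"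
    then have "C * (1 + \<bar>p n 0\<bar>) ^ r \<le> \<bar>C\<bar> * (1 + \<bar>M\<bar>) ^ r"
      by (intro mult_mono power_mono) auto
    moreover have "\<bar>real_of_int n\<bar> = real k" using that by linarith
    ultimately show False using C[of n] k by linarith
  qed
  have "0 < real k" using k by (rule le_less_trans[rotated]) simp
  then have "1 \<le> int k" by simp
  moreover have "0 \<le> p (int k) 0" "p (- int k) 0 \<le> 0"
    using increasing_le[of 0 "int k" 0] increasing_le[of "- int k" 0 0] by (simp_all add: zero)
  ultimately show ?thesis using big[of "int k"] big[of "- int k"] by (intro exI[of _ "int k"]) auto
qed

text \<open>Two steps of the orbit of 0: an orbit that crosses 0 lands in (0, p 1 0], which must lie
  strictly below the upper end of the transition.\<close>

definition upper where "upper = p 2 0"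

lemma upper_pos: "0 < upper"
  using increasing[of 0 2 0] by (simp add: upper_def zero)

text \<open>Formally, the sum of the functions R o p n over all integers n, with R a transition function
  from 0 to 1, grows by 1 along p 1; subtracting 1 for n >= 0 makes it locally finite.  The
  transition interval is longer than one step of every orbit, so every orbit meets its interior.\<close>

definition summand :: "int \<Rightarrow> real \<Rightarrow> real" where
  "summand n x = transition 0 upper (p n x) - (if 0 \<le> n then 1 else 0)"

definition abel :: "real \<Rightarrow> real" where
  "abel x = (\<Sum>n | summand n x \<noteq> 0. summand n x)"

text \<open>Comparing x with \<open>p k 0\<close> and \<open>p (- k) 0\<close> traps its orbit: for
  n \<le> -k the transition is still 0, for n \<ge> k + 2 it has reached 1 and is cancelled by the
  correction. The 2 stems from \<open>upper = p 2 0\<close>.\<close>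

lemma window:
  "\<exists>k\<ge>1. (\<forall>n x. \<bar>x\<bar> < M \<longrightarrow> n \<le> - k \<longrightarrow> p n x \<le> 0) \<and>
     (\<forall>n x. \<bar>x\<bar> < M \<longrightarrow> k + 2 \<le> n \<longrightarrow> upper \<le> p n x) \<and>
     (\<forall>n x. \<bar>x\<bar> < M \<longrightarrow> n \<notin> {- k..k + 2} \<longrightarrow> summand n x = 0)"
proof -
  obtain k where k: "1 \<le> k" "M \<le> p k 0" "p (- k) 0 \<le> - M" using escape by blast
  have l: "p n x \<le> 0" if "\<bar>x\<bar> < M" "n \<le> - k" for n x
  proof -
    have "p n x \<le> p n (p k 0)" using that k by (intro mono_le) auto
    also have "\<dots> = p (n + k) 0" by (simp add: add)
    also have "\<dots> \<le> p 0 0" using that by (intro increasing_le) auto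
    finally show ?thesis by (simp add: zero)
  qed
  have r: "upper \<le> p n x" if "\<bar>x\<bar> < M" "k + 2 \<le> n" for n x
  proof -
    have "upper \<le> p (n + - k) 0" unfolding upper_def using that by (intro increasing_le) auto
    also have "\<dots> = p n (p (- k) 0)" by (rule add)
    also have "\<dots> \<le> p n x" using that k by (intro mono_le) auto
    finally show ?thesis .
  qed
  have "summand n x = 0" if "\<bar>x\<bar> < M" "n \<notin> {- k..k + 2}" for n x
  proof (cases "n < - k")
    case True
    then show ?thesis using l[OF that(1), of n] k(1) by (simp add: summand_def transition_left)
  next
    case False
    then have "k + 2 \<le> n" using that(2) by simp
    then show ?thesis using r[OF that(1), of n] k(1) upper_pos by (simp add: summand_def transition_right)
  qed
  with k(1) l r show ?thesis by (intro exI[of _ k] conjI allI impI)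
qed

lemma abel_eq_sum: "finite I \<Longrightarrow> (\<And>n. n \<notin> I \<Longrightarrow> summand n x = 0) \<Longrightarrow> abel x = (\<Sum>n\<in>I. summand n x)"
  unfolding abel_def by (rule sum.mono_neutral_left) auto

lemma abel_lsum: "cplx abel = lsum (\<lambda>n. cplx (summand n))"
  by (simp add: fun_eq_iff abel_def lsum_def)

lemma smooth_summand: "smooth (cplx (summand n))"
  unfolding summand_def[abs_def] of_real_diff
  by (intro smooth_diff smooth_compose[OF smooth_transition[OF upper_pos] smooth_p] smooth_const)

lemma locally_finite_summand: "locally_finite_family (\<lambda>n. cplx (summand n))"
  unfolding locally_finite_family_def
proof
  fix M
  obtain k where "\<And>n x. \<bar>x\<bar> < M \<Longrightarrow> n \<notin> {- k..k + 2} \<Longrightarrow> summand n x = 0" using window[of M] by blast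
  then show "\<exists>I. finite I \<and> (\<forall>n x. \<bar>x\<bar> < M \<longrightarrow> n \<notin> I \<longrightarrow> cplx (summand n) x = 0)"
    by (intro exI[of _ "{- k..k + 2}"]) auto
qed

lemma smooth_abel: "smooth (cplx abel)"
  unfolding abel_lsum by (rule smooth_lsum[OF locally_finite_summand smooth_summand])

lemma abel_step: "abel (p 1 x) = abel x + 1"
proof -
  define M where "M = max \<bar>x\<bar> \<bar>p 1 x\<bar> + 1"
  have M: "\<bar>x\<bar> < M" "\<bar>p 1 x\<bar> < M" by (simp_all add: M_def)
  obtain k where k: "1 \<le> k" "\<And>n x. \<bar>x\<bar> < M \<Longrightarrow> n \<notin> {- k..k + 2} \<Longrightarrow> summand n x = 0"
    using window[of M] by blast
  \<comment> \<open>The transition parts agree after the index shift; the correction terms differ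
    only at n = -1, which produces the 1 of the Abel equation.\<close>
  have "summand n (p 1 x) = summand (n + 1) x + (if n = - 1 then 1 else 0)" for n
    using add[of n 1 x] by (simp add: summand_def)
  \<comment> \<open>The range is widened by one index so that its shift still covers the window of
    x.\<close>
  moreover have "abel (p 1 x) = (\<Sum>n\<in>{- k - 1..k + 2}. summand n (p 1 x))"
    using k M by (intro abel_eq_sum) auto
  ultimately have "abel (p 1 x) = (\<Sum>n\<in>{- k - 1..k + 2}. summand (n + 1) x) + 1"
    using k(1) by (simp add: sum.distrib)
  also have "(\<Sum>n\<in>{- k - 1..k + 2}. summand (n + 1) x) = (\<Sum>n\<in>{- k..k + 3}. summand n x)"
    by (rule sum.reindex_bij_witness[of _ "\<lambda>n. n - 1" "\<lambda>n. n + 1"]) auto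
  also have "\<dots> = abel x" using k M by (intro abel_eq_sum[symmetric]) auto
  finally show ?thesis .
qed

lemma deriv_p_pos: "0 < deriv (p n) x"
proof -
  have d: "(p n has_real_derivative deriv (p n) x) (at x)" for n x
    by (rule smooth_cplx_deriv(1)[OF smooth_p])
  have "((\<lambda>x. p (- n) (p n x)) has_real_derivative deriv (p (- n)) (p n x) * deriv (p n) x) (at x)"
    by (rule DERIV_chain2[OF d d])
  then have "deriv (p (- n)) (p n x) * deriv (p n) x = 1"
    unfolding inverse using DERIV_unique[OF _ DERIV_ident] by blast
  then have "deriv (p n) x \<noteq> 0" by auto
  moreover have "\<not> deriv (p n) x < 0"
  proof
    assume "deriv (p n) x < 0"
    then obtain e where e: "0 < e" "\<And>h. 0 < h \<Longrightarrow> h < e \<Longrightarrow> p n (x + h) < p n x"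
      using DERIV_neg_dec_right[OF d, of n x] by blast
    show False using e(2)[of "e/2"] e(1) mono[of x "x + e / 2" n] by simp
  qed
  ultimately show ?thesis by simp
qed

lemma deriv_abel_pos: "0 < deriv abel x"
proof -
  define M where "M = \<bar>x\<bar> + 1"
  have M: "\<bar>x\<bar> < M" by (simp add: M_def)
  obtain k where k: "1 \<le> k" "\<And>n x. \<bar>x\<bar> < M \<Longrightarrow> n \<le> - k \<Longrightarrow> p n x \<le> 0"
    "\<And>n x. \<bar>x\<bar> < M \<Longrightarrow> k + 2 \<le> n \<Longrightarrow> upper \<le> p n x"
    "\<And>n x. \<bar>x\<bar> < M \<Longrightarrow> n \<notin> {- k..k + 2} \<Longrightarrow> summand n x = 0"
    using window[of M] by blast
  have "\<exists>d. (transition 0 upper has_real_derivative d) (at y) \<and> 0 \<le> d \<and> (0 < y \<longrightarrow> y < upper \<longrightarrow> 0 < d)" for y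
    by (rule DERIV_transition[OF upper_pos, of y]) blast
  then obtain d where d: "\<And>y. (transition 0 upper has_real_derivative d y) (at y)" "\<And>y. 0 \<le> d y"
    "\<And>y. 0 < y \<Longrightarrow> y < upper \<Longrightarrow> 0 < d y" by metis
  have "(summand n has_real_derivative d (p n x) * deriv (p n) x - 0) (at x)" for n
    unfolding summand_def[abs_def]
    by (intro DERIV_diff DERIV_const DERIV_chain2[OF d(1)] smooth_cplx_deriv(1)[OF smooth_p])
  then have "((\<lambda>x. \<Sum>n\<in>{- k..k + 2}. summand n x) has_real_derivative
      (\<Sum>n\<in>{- k..k + 2}. d (p n x) * deriv (p n) x)) (at x)"
    by (intro DERIV_sum) simp
  moreover have "open {y. \<bar>y\<bar> < M}" by (intro open_Collect_less continuous_intros)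
  ultimately have "(abel has_real_derivative (\<Sum>n\<in>{- k..k + 2}. d (p n x) * deriv (p n) x)) (at x)"
    by (rule has_field_derivative_transform_within_open)
       (use M k(4) in \<open>auto intro!: abel_eq_sum[symmetric]\<close>)
  then have "deriv abel x = (\<Sum>n\<in>{- k..k + 2}. d (p n x) * deriv (p n) x)" by (rule DERIV_imp_deriv)
  moreover have "0 < (\<Sum>n\<in>{- k..k + 2}. d (p n x) * deriv (p n) x)"
  proof -
    have "0 < p (k + 2) x" using k(3)[OF M, of "k + 2"] upper_pos by simp
    \<comment> \<open>Where the orbit crosses 0 it lands strictly inside the transition interval,
      and that summand has positive derivative; the other summands contribute
      non-negatively.\<close>
    then obtain n where n: "- k \<le> n" "n < k + 2" "p n x \<le> 0" "0 < p (n + 1) x"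
      using int_crossing[of "- k" "k + 2" "\<lambda>n. p n x" 0] k(1) k(2)[OF M, of "- k"] by auto
    have "p (n + 1) x \<le> p 1 0" using mono_le[OF n(3), of 1] add[of 1 n x] by (simp add: add.commute)
    also have "\<dots> < upper" unfolding upper_def by (rule increasing) simp
    finally have "0 < d (p (n + 1) x) * deriv (p (n + 1)) x"
      using n(4) d(3) deriv_p_pos by (intro mult_pos_pos) auto
    moreover have "n + 1 \<in> {- k..k + 2}" using n by auto
    moreover have "0 \<le> d (p i x) * deriv (p i) x" for i
      using d(2) deriv_p_pos[of i x] by simp
    ultimately show ?thesis by (intro sum_pos2[of _ "n + 1"]) simp_all
  qed
  ultimately show ?thesis by simp
qed

lemma abel_strict_mono: "x < y \<Longrightarrow> abel x < abel y"
  using DERIV_pos_imp_increasing[of x y abel] smooth_cplx_deriv(1)[OF smooth_abel] deriv_abel_pos by blast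

lemma abel_mono: "x \<le> y \<Longrightarrow> abel x \<le> abel y"
  using abel_strict_mono[of x y] by (auto simp: le_less)

lemma abel_orbit: "abel (p n 0) = abel 0 + of_int n"
proof (induction n rule: int_induct[where k=0])
  case base
  then show ?case by (simp add: zero)
next
  case (step1 i)
  then show ?case using abel_step[of "p i 0"] by (simp add: add.commute flip: add)
next
  case (step2 i)
  then show ?case using abel_step[of "p (i - 1) 0"] by (simp flip: add)
qed

lemma bij_abel: "bij abel"
proof (rule bijI)
  show "inj abel"
    using abel_strict_mono by (metis injI linorder_neqE_linordered_idom order_less_irrefl)
  have "\<exists>x. abel x = y" for y
  proof -
    define n where "n = \<lfloor>y - abel 0\<rfloor>"
    have "abel (p n 0) \<le> y" "y \<le> abel (p (n + 1) 0)" unfolding abel_orbit n_def by linarith+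
    moreover have "p n 0 \<le> p (n + 1) 0" by (rule increasing_le) simp
    ultimately show ?thesis
      using IVT'[of abel "p n 0" y "p (n + 1) 0"] smooth_cplx_continuous[OF smooth_abel] by blast
  qed
  then show "surj abel" by (metis surjI)
qed

text \<open>If x lies between \<open>p n 0\<close> and \<open>p (n + 1) 0\<close>, then
  \<open>abel x\<close> lies between abel 0 + n and abel 0 + n + 1, and \<open>growth\<close> bounds
  |n| polynomially along the orbit of 0.\<close>

lemma abel_growth: "\<exists>C k. \<forall>x. \<bar>abel x\<bar> \<le> C * (1 + \<bar>x\<bar>) ^ k"
proof -
  obtain C r where C: "\<And>n. \<bar>real_of_int n\<bar> \<le> C * (1 + \<bar>p n 0\<bar>) ^ r" using growth by blast
  have "\<bar>abel x\<bar> \<le> (\<bar>abel 0\<bar> + 2 + \<bar>C\<bar>) * (1 + \<bar>x\<bar>) ^ r" for x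
  proof -
    obtain k where k: "1 \<le> k" "\<bar>x\<bar> + 1 \<le> p k 0" "p (- k) 0 \<le> - (\<bar>x\<bar> + 1)" using escape by blast
    then have "- k \<le> k" "p (- k) 0 \<le> x" "x < p k 0" by auto
    then obtain n where n: "p n 0 \<le> x" "x < p (n + 1) 0"
      using int_crossing[of "- k" k "\<lambda>n. p n 0" x] by blast
    have *: "\<bar>real_of_int m\<bar> \<le> \<bar>C\<bar> * (1 + \<bar>x\<bar>) ^ r" if "\<bar>p m 0\<bar> \<le> \<bar>x\<bar>" for m
    proof -
      have "C * (1 + \<bar>p m 0\<bar>) ^ r \<le> \<bar>C\<bar> * (1 + \<bar>x\<bar>) ^ r"
        using that by (intro mult_mono power_mono) auto
      then show ?thesis using C[of m] by linarith
    qed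
    \<comment> \<open>Only the orbit point on the side of 0 is known to be at most |x| in absolute
      value: \<open>p n 0\<close> for n \<ge> 0, otherwise \<open>p (n + 1) 0\<close>, at the cost
      of 1.\<close>
    have n_le: "\<bar>real_of_int n\<bar> \<le> \<bar>C\<bar> * (1 + \<bar>x\<bar>) ^ r + 1"
    proof (cases "0 \<le> n")
      case True
      then have "0 \<le> p n 0" using increasing_le[of 0 n 0] by (simp add: zero)
      then show ?thesis using *[of n] n(1) by simp
    next
      case False
      then have "p (n + 1) 0 \<le> 0" using increasing_le[of "n + 1" 0 0] by (simp add: zero)
      then show ?thesis using *[of "n + 1"] n(2) False by simp
    qed
    have "abel 0 + of_int n \<le> abel x" "abel x \<le> abel 0 + of_int n + 1"
      using abel_mono[OF n(1)] abel_mono[OF less_imp_le[OF n(2)]] by (simp_all add: abel_orbit)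
    then have "\<bar>abel x\<bar> \<le> \<bar>abel 0\<bar> + 2 + \<bar>C\<bar> * (1 + \<bar>x\<bar>) ^ r" using n_le by linarith
    also have "\<dots> = (\<bar>abel 0\<bar> + 2) * 1 + \<bar>C\<bar> * (1 + \<bar>x\<bar>) ^ r" by simp
    also have "\<dots> \<le> (\<bar>abel 0\<bar> + 2) * (1 + \<bar>x\<bar>) ^ r + \<bar>C\<bar> * (1 + \<bar>x\<bar>) ^ r"
      by (intro add_right_mono mult_left_mono one_le_power) auto
    finally show ?thesis by (simp add: distrib_right)
  qed
  then show ?thesis by blast
qed

text \<open>At every point at most five summands have a non-vanishing derivative of order j.\<close>

lemma abel_deriv_growth:
  assumes "1 \<le> j"
  shows "\<exists>C k. \<forall>x. cmod (nth_deriv j (cplx abel) x) \<le> C * (1 + \<bar>x\<bar>) ^ k"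
proof -
  let ?R = "cplx (transition 0 upper)"
  have sR: "smooth ?R" by (rule smooth_transition[OF upper_pos])
  have "\<exists>C k. \<forall>y\<in>{(n, x). \<bar>p n x\<bar> \<le> upper}. cmod (nth_deriv i (cplx (p (fst y))) (snd y)) \<le> C * (1 + \<bar>snd y\<bar>) ^ k"
    if "i \<in> {1..j}" for i
    using orbit_bound[of i upper] that by auto
  then obtain B k where B: "1 \<le> B" and B': "\<forall>i\<in>{1..j}. \<forall>y\<in>{(n, x). \<bar>p n x\<bar> \<le> upper}.
      cmod (nth_deriv i (cplx (p (fst y))) (snd y)) \<le> B * (1 + \<bar>snd y\<bar>) ^ k"
    using polynomial_bound_common[of "{1..j}" "\<lambda>_. {(n, x). \<bar>p n x\<bar> \<le> upper}"
        "\<lambda>i y. cmod (nth_deriv i (cplx (p (fst y))) (snd y))" snd] by auto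
  have "\<exists>A. \<forall>t\<in>{0..upper}. cmod (nth_deriv i ?R t) \<le> A" for i
  proof -
    have "compact (nth_deriv i ?R ` {0..upper})"
      by (intro compact_continuous_image smooth_continuous_on sR compact_Icc)
    then show ?thesis using compact_imp_bounded bounded_iff by (metis imageI)
  qed
  then obtain a where a: "\<And>i t. t \<in> {0..upper} \<Longrightarrow> cmod (nth_deriv i ?R t) \<le> a i" by metis
  define A where "A = (\<Sum>i\<le>j. \<bar>a i\<bar>)"
  have A: "cmod (nth_deriv i ?R t) \<le> A" if "i \<le> j" "t \<in> {0..upper}" for i t
  proof -
    have "\<bar>a i\<bar> \<le> A" unfolding A_def using that by (intro member_le_sum) auto
    then show ?thesis using a[OF that(2), of i] by linarith
  qed
  obtain K where K: "0 \<le> K" "\<And>h q x A B. smooth h \<Longrightarrow> smooth (cplx q) \<Longrightarrow> 1 \<le> B \<Longrightarrow>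
     (\<forall>i\<le>j. cmod (nth_deriv i h (q x)) \<le> A) \<Longrightarrow>
     (\<forall>i\<in>{1..j}. cmod (nth_deriv i (cplx q) x) \<le> B) \<Longrightarrow>
     cmod (nth_deriv j (\<lambda>x. h (q x)) x) \<le> K * A * B ^ j"
    using nth_deriv_compose_bound[of j] by blast
  \<comment> \<open>Off the closed transition interval the summand is locally constant, and j \<ge>
    1.\<close>
  have zero_outside: "nth_deriv j (cplx (summand n)) x = 0" if "p n x \<notin> {0..upper}" for n x
  proof -
    have c: "continuous_on UNIV (p n)" by (rule smooth_cplx_continuous[OF smooth_p])
    define S where "S = (if p n x < 0 then {y. p n y < 0} else {y. upper < p n y})"
    have S: "open S" "x \<in> S" using that c by (auto simp: S_def intro!: open_Collect_less)
    have "nth_deriv j (cplx (summand n)) x = nth_deriv j (\<lambda>_. of_real (summand n x)) x"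
      by (rule nth_deriv_cong_open[OF S(1) _ S(2)])
         (use that upper_pos in \<open>auto simp: S_def summand_def transition_left transition_right split: if_splits\<close>)
    then show ?thesis using assms by (simp add: nth_deriv_const)
  qed
  have bound: "cmod (nth_deriv j (cplx (summand n)) x) \<le> K * A * (B * (1 + \<bar>x\<bar>) ^ k) ^ j"
    if "p n x \<in> {0..upper}" for n x
  proof -
    have "nth_deriv j (cplx (summand n)) x = nth_deriv j (\<lambda>x. ?R (p n x)) x"
      unfolding summand_def[abs_def] of_real_diff
      by (subst nth_deriv_diff[OF smooth_compose[OF sR smooth_p] smooth_const]) (use assms in \<open>simp add: nth_deriv_const\<close>)
    also have "cmod \<dots> \<le> K * A * (B * (1 + \<bar>x\<bar>) ^ k) ^ j"
    proof (rule K(2)[OF sR smooth_p])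
      show "1 \<le> B * (1 + \<bar>x\<bar>) ^ k"
        using mult_mono[OF B one_le_power[of "1 + \<bar>x\<bar>" k]] B by simp
      show "\<forall>i\<le>j. cmod (nth_deriv i ?R (p n x)) \<le> A" using A that by blast
      show "\<forall>i\<in>{1..j}. cmod (nth_deriv i (cplx (p n)) x) \<le> B * (1 + \<bar>x\<bar>) ^ k"
        using B' that by force
    qed
    finally show ?thesis .
  qed
  have A0: "0 \<le> A" unfolding A_def by (intro sum_nonneg) auto
  have "cmod (nth_deriv j (cplx abel) x) \<le> 5 * K * A * B ^ j * (1 + \<bar>x\<bar>) ^ (k * j)" for x
  proof -
    let ?b = "K * A * (B * (1 + \<bar>x\<bar>) ^ k) ^ j"
    have b0: "0 \<le> ?b" using K(1) A0 B by (intro mult_nonneg_nonneg zero_le_power) auto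
    have abel: "nth_deriv j (cplx abel) x = lsum (\<lambda>n. nth_deriv j (cplx (summand n))) x"
      unfolding abel_lsum by (simp only: nth_deriv_lsum[OF locally_finite_summand smooth_summand])
    have "cmod (nth_deriv j (cplx abel) x) \<le> 5 * ?b"
    proof (cases "\<exists>n. p n x \<in> {0..upper}")
      case False
      then have "nth_deriv j (cplx abel) x = 0" unfolding abel lsum_def using zero_outside by (intro sum.neutral) blast
      then show ?thesis using b0 by simp
    next
      case True
      then obtain n where n: "p n x \<in> {0..upper}" by blast
      \<comment> \<open>Three steps from a point \<ge> 0 lead to at least \<open>p 3 0\<close>,
        beyond \<open>upper = p 2 0\<close>.\<close>
      have close: "m' - m \<le> 2" if "p m x \<in> {0..upper}" "p m' x \<in> {0..upper}" for m m'
      proof (rule ccontr)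
        assume "\<not> m' - m \<le> 2"
        then have "p (3 + m) x \<le> p m' x" by (intro increasing_le) auto
        moreover have "p 3 0 \<le> p 3 (p m x)" using that(1) by (intro mono_le) auto
        moreover have "upper < p 3 0" unfolding upper_def by (rule increasing) simp
        ultimately show False using that(2) by (simp add: add)
      qed
      have "lsum (\<lambda>n. nth_deriv j (cplx (summand n))) x = (\<Sum>m\<in>{n - 2..n + 2}. nth_deriv j (cplx (summand m)) x)"
      proof (rule lsum_eq_sum)
        fix m assume "m \<notin> {n - 2..n + 2}"
        then have "p m x \<notin> {0..upper}" using close[OF n, of m] close[OF _ n, of m] by auto
        then show "nth_deriv j (cplx (summand m)) x = 0" by (rule zero_outside)
      qed simp
      moreover have "cmod (\<Sum>m\<in>{n - 2..n + 2}. nth_deriv j (cplx (summand m)) x) \<le> (\<Sum>m\<in>{n - 2..n + 2}. ?b)"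
        using bound zero_outside b0 by (intro sum_norm_le) (metis norm_zero)
      ultimately show ?thesis using abel by simp
    qed
    then show ?thesis unfolding power_mult by (simp only: power_mult_distrib mult_ac)
  qed
  then show ?thesis by blast
qed

lemma abel_O_M: "cplx abel \<in> O_M"
  unfolding O_M_iff
proof (intro conjI allI smooth_abel)
  show "\<exists>C k. \<forall>x. cmod (nth_deriv j (cplx abel) x) \<le> C * (1 + \<bar>x\<bar>) ^ k" for j
    using abel_growth abel_deriv_growth[of j] by (cases "j = 0") auto
qed

end

section \<open>Consequences of mixing\<close>

lemma comp_op_power: "(comp_op q ^^ n) f = (\<lambda>x. f ((q ^^ n) x))"
proof (induction n)
  case (Suc n)
  then show ?case by (simp add: comp_op_def fun_eq_iff funpow_swap1)
qed simp

lemma O_M_funpow: "cplx q \<in> O_M \<Longrightarrow> cplx (q ^^ n) \<in> O_M"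
proof (induction n)
  case 0
  then show ?case using O_M_id by simp
next
  case (Suc n)
  then show ?case using O_M_compose[OF Suc.IH[OF Suc.prems] Suc.prems] by (simp add: funpow_swap1)
qed

lemma mixing_approx:
  assumes "mixing O_M_topology (comp_op \<psi>)" "f0 \<in> O_M" "g0 \<in> O_M" "v \<in> Schwartz" "0 < e"
  shows "\<exists>N. \<forall>n\<ge>N. \<exists>f\<in>O_M_ball m v f0 e. (\<lambda>x. f ((\<psi> ^^ n) x)) \<in> O_M_ball m v g0 e"
proof -
  have "openin O_M_topology (O_M_ball m v f0 e)" "openin O_M_topology (O_M_ball m v g0 e)"
    "O_M_ball m v f0 e \<noteq> {}" "O_M_ball m v g0 e \<noteq> {}"
    using openin_O_M_ball[OF assms(4) _ assms(5)] O_M_ball_centre[OF _ assms(5)] assms(2,3) by blast+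
  then obtain N where "\<forall>n\<ge>N. (comp_op \<psi> ^^ n) ` O_M_ball m v f0 e \<inter> O_M_ball m v g0 e \<noteq> {}"
    using assms(1) unfolding mixing_def by meson
  then show ?thesis unfolding comp_op_power by blast
qed

text \<open>At a fixed point f and all f o \<psi>^n take the same value, which cannot be within 1 of
  both 0 and 2.\<close>

lemma mixing_no_fixpoint:
  assumes mix: "mixing O_M_topology (comp_op \<psi>)"
  shows "\<psi> p \<noteq> p"
proof
  assume p: "\<psi> p = p"
  obtain v where v: "v \<in> Schwartz" "\<And>x. \<bar>x\<bar> \<le> \<bar>p\<bar> \<Longrightarrow> 1 \<le> cmod (v x)"
    using Schwartz_ge_indicator[of "\<bar>p\<bar>"] by blast
  have fp: "(\<psi> ^^ n) p = p" for n by (induction n) (auto simp: p)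
  obtain N where "\<forall>n\<ge>N. \<exists>f\<in>O_M_ball 0 v (\<lambda>_. 0) 1. (\<lambda>x. f ((\<psi> ^^ n) x)) \<in> O_M_ball 0 v (\<lambda>_. 2) 1"
    using mixing_approx[OF mix O_M_const O_M_const v(1), of 1 0 0 2] by auto
  then obtain f where f: "f \<in> O_M_ball 0 v (\<lambda>_. 0) 1" "(\<lambda>x. f ((\<psi> ^^ N) x)) \<in> O_M_ball 0 v (\<lambda>_. 2) 1"
    by blast
  have "cmod (v p) * cmod (f p) < 1" "cmod (v p) * cmod (f p - 2) < 1"
    using O_M_ballD[OF f(1) O_M_const v(1), of 0 p] O_M_ballD[OF f(2) O_M_const v(1), of 0 p] by (simp_all add: fp)
  moreover have "1 * cmod (f p) \<le> cmod (v p) * cmod (f p)" "1 * cmod (f p - 2) \<le> cmod (v p) * cmod (f p - 2)"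
    using v(2)[of p] by (intro mult_right_mono; simp)+
  ultimately have "cmod (f p) < 1" "cmod (f p - 2) < 1" by linarith+
  then show False using norm_triangle_ineq4[of "f p" "f p - 2"] by simp
qed

text \<open>At a critical point f o \<psi>^n has derivative 0 for every n \<ge> 1, yet it would have
  to be close to the identity, whose derivative is 1. The index Suc N guarantees n \<ge> 1.\<close>

lemma mixing_deriv_nonzero:
  assumes mix: "mixing O_M_topology (comp_op \<psi>)" and \<psi>: "cplx \<psi> \<in> O_M"
  shows "deriv \<psi> p \<noteq> 0"
proof
  assume p: "deriv \<psi> p = 0"
  obtain v where v: "v \<in> Schwartz" "\<And>x. \<bar>x\<bar> \<le> \<bar>p\<bar> \<Longrightarrow> 1 \<le> cmod (v x)"
    using Schwartz_ge_indicator[of "\<bar>p\<bar>"] by blast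
  obtain N where "\<And>n. N \<le> n \<Longrightarrow> \<exists>f\<in>O_M_ball 1 v complex_of_real 1.
      (\<lambda>x. f ((\<psi> ^^ n) x)) \<in> O_M_ball 1 v complex_of_real 1"
    using mixing_approx[OF mix O_M_id O_M_id v(1), of 1 1] by auto
  from this[OF le_SucI[OF order_refl]] obtain f where f: "f \<in> O_M_ball 1 v complex_of_real 1"
    "(\<lambda>x. f ((\<psi> ^^ Suc N) x)) \<in> O_M_ball 1 v complex_of_real 1"
    by blast
  have s: "smooth (\<lambda>x. f ((\<psi> ^^ N) x))"
    by (rule O_M_smooth[OF O_M_compose[OF subsetD[OF O_M_ball_subset f(1)] O_M_funpow[OF \<psi>]]])
  have "nth_deriv 1 (\<lambda>x. f ((\<psi> ^^ Suc N) x)) p = D (\<lambda>x. f ((\<psi> ^^ N) (\<psi> x))) p"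
    by (simp add: nth_deriv_Suc funpow_swap1)
  also have "\<dots> = 0"
    using D_compose[OF s O_M_smooth[OF \<psi>]] smooth_cplx_deriv(2)[OF O_M_smooth[OF \<psi>], of p] p by simp
  finally have "cmod (v p) * 1 < 1"
    using O_M_ballD[OF f(2) O_M_id v(1), of 1 p] by (simp add: nth_deriv_of_real)
  then show False using v(2)[of p] by simp
qed

text \<open>If h is close to the identity on the bounded set reached by q n and h o q n is small, then
  the chain rule bounds the derivatives of q n, order by order.\<close>

lemma orbit_bound:
  fixes q :: "nat \<Rightarrow> real \<Rightarrow> real"
  assumes q: "\<And>n. smooth (cplx (q n))"
    and pre: "\<And>n. bounded {x. \<bar>q n x\<bar> \<le> \<rho>}"
    and approx: "\<And>v m. v \<in> Schwartz \<Longrightarrow> \<exists>N. \<forall>n\<ge>N. \<exists>h. smooth h \<and>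
      (\<forall>t j. \<bar>t\<bar> \<le> \<rho> \<longrightarrow> j \<le> m \<longrightarrow> cmod (nth_deriv j h t - nth_deriv j complex_of_real t) \<le> 1 / 2) \<and>
      (\<forall>x j. j \<le> m \<longrightarrow> cmod (v x) * cmod (nth_deriv j (\<lambda>x. h (q n x)) x) \<le> 1)"
  shows "1 \<le> j \<Longrightarrow> \<exists>C k. \<forall>n x. \<bar>q n x\<bar> \<le> \<rho> \<longrightarrow> cmod (nth_deriv j (cplx (q n)) x) \<le> C * (1 + \<bar>x\<bar>) ^ k"
proof (induction j rule: less_induct)
  case (less j)
  then obtain i where j: "j = Suc i" by (cases j) auto
  let ?X = "{(n, x). \<bar>q n x\<bar> \<le> \<rho>}"
  have "\<exists>C k. \<forall>y\<in>?X. cmod (nth_deriv l (cplx (q (fst y))) (snd y)) \<le> C * (1 + \<bar>snd y\<bar>) ^ k"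
    if "l \<in> {1..i}" for l
    using less.IH[of l] that j by auto
  then obtain B k where B: "1 \<le> B" and B': "\<forall>l\<in>{1..i}. \<forall>y\<in>?X.
      cmod (nth_deriv l (cplx (q (fst y))) (snd y)) \<le> B * (1 + \<bar>snd y\<bar>) ^ k"
    using polynomial_bound_common[of "{1..i}" "\<lambda>_. ?X"
        "\<lambda>l y. cmod (nth_deriv l (cplx (q (fst y))) (snd y))" snd] by auto
  obtain K where K: "0 \<le> K" "\<And>h q x A B. smooth h \<Longrightarrow> smooth (cplx q) \<Longrightarrow> 1 \<le> B \<Longrightarrow>
     (\<forall>l\<in>{1..Suc i}. cmod (nth_deriv l h (q x)) \<le> A) \<Longrightarrow>
     (\<forall>l\<in>{1..i}. cmod (nth_deriv l (cplx q) x) \<le> B) \<Longrightarrow>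
     cmod (nth_deriv (Suc i) (\<lambda>x. h (q x)) x - D h (q x) * nth_deriv (Suc i) (cplx q) x)
       \<le> K * A * B ^ Suc i"
    using nth_deriv_compose_remainder[of i] by blast
  define Z where "Z = (\<lambda>(n, x). (x, cmod (nth_deriv j (cplx (q n)) x))) ` ?X"
  have "\<exists>C k. 0 \<le> C \<and> (\<forall>(x, y)\<in>Z. y \<le> C * (1 + \<bar>x\<bar>) ^ k)"
  \<comment> \<open>The threshold N below depends on v, so the estimate is made for one v at a time,
    over all n jointly.\<close>
  proof (rule polynomial_bound_if_Schwartz_bounded)
    fix v assume v: "v \<in> Schwartz"
    obtain N where N: "\<And>n. N \<le> n \<Longrightarrow> \<exists>h. smooth h \<and>
      (\<forall>t l. \<bar>t\<bar> \<le> \<rho> \<longrightarrow> l \<le> j \<longrightarrow> cmod (nth_deriv l h t - nth_deriv l complex_of_real t) \<le> 1 / 2) \<and>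
      (\<forall>x l. l \<le> j \<longrightarrow> cmod (v x) * cmod (nth_deriv l (\<lambda>x. h (q n x)) x) \<le> 1)"
      using approx[OF v, of j] by blast
    \<comment> \<open>The exponent k j is that of the chain rule remainder, in which each of the j
      factors carries the bound for the lower derivatives.\<close>
    obtain S where S: "0 \<le> S" "\<And>x. (1 + \<bar>x\<bar>) ^ (k * j) * cmod (v x) \<le> S"
      using Schwartz_bound[OF v, of "k * j"] by blast
    have large: "cmod (v x) * cmod (nth_deriv j (cplx (q n)) x) \<le> 2 * (1 + K * 2 * B ^ j * S)"
      if n: "N \<le> n" and x: "\<bar>q n x\<bar> \<le> \<rho>" for n x
    proof -
      obtain h where h: "smooth h"
        "\<And>t l. \<bar>t\<bar> \<le> \<rho> \<Longrightarrow> l \<le> j \<Longrightarrow> cmod (nth_deriv l h t - nth_deriv l complex_of_real t) \<le> 1 / 2"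
        "\<And>x l. l \<le> j \<Longrightarrow> cmod (v x) * cmod (nth_deriv l (\<lambda>x. h (q n x)) x) \<le> 1"
        using N[OF n] by blast
      let ?d = "nth_deriv j (cplx (q n)) x" and ?c = "nth_deriv j (\<lambda>x. h (q n x)) x"
      have "cmod (D h (q n x) - 1) \<le> 1 / 2"
        using h(2)[OF x, of 1] j by (simp add: nth_deriv_of_real nth_deriv_Suc)
      \<comment> \<open>The factor of the leading term is bounded away from 0, so the top derivative
        of \<open>q n\<close> can be solved for at the cost of a factor 2.\<close>
      then have D: "1 / 2 \<le> cmod (D h (q n x))"
        using norm_triangle_ineq3[of 1 "1 - D h (q n x)"] by (simp add: norm_minus_commute)
      have A: "cmod (nth_deriv l h (q n x)) \<le> 2" if "l \<in> {1..Suc i}" for l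
      proof -
        have "cmod (nth_deriv l h (q n x) - nth_deriv l complex_of_real (q n x)) \<le> 1 / 2"
          using h(2)[OF x, of l] that j by auto
        moreover have "cmod (nth_deriv l complex_of_real (q n x)) \<le> 1"
          using that by (simp add: nth_deriv_of_real)
        ultimately show ?thesis
          using norm_triangle_ineq[of "nth_deriv l h (q n x) - nth_deriv l complex_of_real (q n x)"
              "nth_deriv l complex_of_real (q n x)"] by simp
      qed
      define E where "E = K * 2 * (B * (1 + \<bar>x\<bar>) ^ k) ^ j"
      have "cmod (?c - D h (q n x) * ?d) \<le> E"
        unfolding j E_def
      proof (rule K(2)[OF h(1) q])
        show "1 \<le> B * (1 + \<bar>x\<bar>) ^ k"
          using mult_mono[OF B one_le_power[of "1 + \<bar>x\<bar>" k]] B by simp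
        show "\<forall>l\<in>{1..Suc i}. cmod (nth_deriv l h (q n x)) \<le> 2" using A by blast
        show "\<forall>l\<in>{1..i}. cmod (nth_deriv l (cplx (q n)) x) \<le> B * (1 + \<bar>x\<bar>) ^ k"
          using B' x by force
      qed
      moreover have "cmod (D h (q n x) * ?d) \<le> cmod ?c + cmod (?c - D h (q n x) * ?d)"
        using norm_triangle_ineq4[of ?c "?c - D h (q n x) * ?d"] by simp
      moreover have "1 / 2 * cmod ?d \<le> cmod (D h (q n x) * ?d)"
        unfolding norm_mult by (intro mult_right_mono D) auto
      ultimately have "cmod ?d \<le> 2 * cmod ?c + 2 * E" by linarith
      then have "cmod ?d \<le> 2 * (cmod ?c + E)" by simp
      then have "cmod (v x) * cmod ?d \<le> cmod (v x) * (2 * (cmod ?c + E))"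
        by (rule mult_left_mono) simp
      also have "\<dots> = 2 * (cmod (v x) * cmod ?c + K * 2 * B ^ j * ((1 + \<bar>x\<bar>) ^ (k * j) * cmod (v x)))"
        unfolding power_mult E_def by (simp add: power_mult_distrib distrib_left mult_ac)
      also have "\<dots> \<le> 2 * (1 + K * 2 * B ^ j * S)"
        using K(1) B h(3)[of j x] by (intro mult_left_mono add_mono S(2)) auto
      finally show ?thesis .
    qed
    \<comment> \<open>For the finitely many n below the threshold mixing says nothing; there the set
      in question is bounded and continuity suffices.\<close>
    have "\<exists>b. \<forall>x. \<bar>q n x\<bar> \<le> \<rho> \<longrightarrow> cmod (v x) * cmod (nth_deriv j (cplx (q n)) x) \<le> b" for n
    proof -
      obtain r where r: "\<And>x. \<bar>q n x\<bar> \<le> \<rho> \<Longrightarrow> \<bar>x\<bar> \<le> r" using pre[of n] by (auto simp: bounded_iff)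
      have vs: "smooth v" using v by (simp add: Schwartz_iff)
      have "continuous_on {- r..r} (\<lambda>x. v x * nth_deriv j (cplx (q n)) x)"
        using smooth_continuous_on[OF vs, of _ 0] smooth_continuous_on[OF q] by (intro continuous_on_mult) auto
      then have "bounded ((\<lambda>x. v x * nth_deriv j (cplx (q n)) x) ` {- r..r})"
        by (intro compact_imp_bounded compact_continuous_image compact_Icc)
      then obtain b where "\<forall>y\<in>(\<lambda>x. v x * nth_deriv j (cplx (q n)) x) ` {- r..r}. cmod y \<le> b"
        by (auto simp: bounded_iff)
      then have "\<forall>x\<in>{- r..r}. cmod (v x) * cmod (nth_deriv j (cplx (q n)) x) \<le> b" by (simp add: norm_mult)
      moreover have "x \<in> {- r..r}" if "\<bar>q n x\<bar> \<le> \<rho>" for x using r[OF that] by auto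
      ultimately show ?thesis by blast
    qed
    then obtain b where b: "\<And>n x. \<bar>q n x\<bar> \<le> \<rho> \<Longrightarrow> cmod (v x) * cmod (nth_deriv j (cplx (q n)) x) \<le> b n" by metis
    have "cmod (v x) * cmod (nth_deriv j (cplx (q n)) x) \<le> 2 * (1 + K * 2 * B ^ j * S) + (\<Sum>n<N. \<bar>b n\<bar>)"
      if "\<bar>q n x\<bar> \<le> \<rho>" for n x
    proof (cases "N \<le> n")
      case True
      have "0 \<le> (\<Sum>n<N. \<bar>b n\<bar>)" by (intro sum_nonneg) auto
      then show ?thesis using large[OF True that] by linarith
    next
      case False
      then have "\<bar>b n\<bar> \<le> (\<Sum>n<N. \<bar>b n\<bar>)" by (intro member_le_sum) auto
      moreover have "0 \<le> 2 * (1 + K * 2 * B ^ j * S)"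
        using K(1) B S(1) by (intro mult_nonneg_nonneg add_nonneg_nonneg) auto
      ultimately show ?thesis using b[OF that] by linarith
    qed
    then show "\<exists>b. \<forall>(x, y)\<in>Z. cmod (v x) * y \<le> b" unfolding Z_def by auto
  qed
  then show ?case unfolding Z_def by auto
qed

section \<open>Integer iterates, monotonicity and growth of the orbit of 0\<close>

definition int_iterate :: "(real \<Rightarrow> real) \<Rightarrow> int \<Rightarrow> real \<Rightarrow> real" where
  "int_iterate \<psi> n = (if 0 \<le> n then \<psi> ^^ nat n else inv \<psi> ^^ nat (- n))"

lemma int_iterate_nat [simp]: "int_iterate \<psi> (int n) = \<psi> ^^ n"
  by (simp add: int_iterate_def)

lemma int_iterate_neg_nat [simp]: "int_iterate \<psi> (- int n) = inv \<psi> ^^ n"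
  by (cases n) (auto simp: int_iterate_def nat_add_distrib)

lemma int_iterate_Suc:
  assumes "bij \<psi>" shows "int_iterate \<psi> (n + 1) x = \<psi> (int_iterate \<psi> n x)"
proof (cases "0 \<le> n")
  case True
  then show ?thesis by (simp add: int_iterate_def nat_add_distrib)
next
  case False
  define k where "k = nat (- n - 1)"
  have k: "n = - int (Suc k)" using False by (simp add: k_def)
  have "\<psi> (inv \<psi> y) = y" for y using assms by (simp add: bij_is_surj surj_f_inv_f)
  then have "\<psi> (int_iterate \<psi> n x) = (inv \<psi> ^^ k) x" unfolding k int_iterate_neg_nat by simp
  moreover have "n + 1 = - int k" using k by simp
  ultimately show ?thesis by simp
qed

lemma int_iterate_add:
  assumes "bij \<psi>" shows "int_iterate \<psi> (m + n) x = int_iterate \<psi> m (int_iterate \<psi> n x)"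
proof (induction m rule: int_induct[where k=0])
  case base
  show ?case by (simp add: int_iterate_def)
next
  case (step1 i)
  then show ?case using int_iterate_Suc[OF assms, of "i + n" x] int_iterate_Suc[OF assms, of i]
    by (simp add: add_ac)
next
  case (step2 i)
  have "\<psi> (int_iterate \<psi> (i - 1 + n) x) = \<psi> (int_iterate \<psi> (i - 1) (int_iterate \<psi> n x))"
    using step2 int_iterate_Suc[OF assms, of "i - 1 + n" x] int_iterate_Suc[OF assms, of "i - 1"] by simp
  then show ?case using assms by (simp add: bij_is_inj inj_eq)
qed

text \<open>By the intermediate value theorem \<psi>(x) - x has constant sign. A continuous
  injective function is monotone, and a decreasing one would violate this sign far out.\<close>

lemma strict_mono_if_no_fixpoint:
  fixes \<psi> :: "real \<Rightarrow> real"
  assumes c: "continuous_on UNIV \<psi>" and inj: "inj \<psi>" and fp: "\<And>x. \<psi> x \<noteq> x" and "x < y"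
  shows "\<psi> x < \<psi> y"
    and "(\<forall>x. x < \<psi> x) \<or> (\<forall>x. \<psi> x < x)"
proof -
  show sign: "(\<forall>x. x < \<psi> x) \<or> (\<forall>x. \<psi> x < x)"
  proof (rule ccontr)
    assume "\<not> ?thesis"
    then obtain a b where ab: "\<psi> a \<le> a" "b \<le> \<psi> b" by (auto simp: not_less)
    have cg: "continuous_on S (\<lambda>x. \<psi> x - x)" for S
      using c by (intro continuous_intros) (auto intro: continuous_on_subset)
    have "\<exists>x. \<psi> x - x = 0"
    proof (cases "a \<le> b")
      case True
      then show ?thesis using IVT'[of "\<lambda>x. \<psi> x - x" a 0 b] ab cg by auto
    next
      case False
      then show ?thesis using IVT2'[of "\<lambda>x. \<psi> x - x" a 0 b] ab cg by auto
    qed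
    then show False using fp by auto
  qed
  have alt: "(\<psi> a < \<psi> b \<and> \<psi> b < \<psi> d) \<or> (\<psi> d < \<psi> b \<and> \<psi> b < \<psi> a)" if "a < b" "b < d" for a b d
    using continuous_inj_imp_mono[OF that] continuous_on_subset[OF c] inj_on_subset[OF inj] by blast
  from sign show "\<psi> x < \<psi> y"
  proof
    assume up: "\<forall>x. x < \<psi> x"
    \<comment> \<open>Far enough to the right that \<psi> z > z > \<psi> x, which rules out a
      decreasing \<psi> on x < y < z.\<close>
    define z where "z = max y (\<psi> x) + 1"
    have "y < z" "\<psi> x < \<psi> z" using up[rule_format, of z] by (auto simp: z_def)
    then show ?thesis using alt[OF assms(4), of z] by auto
  next
    assume down: "\<forall>x. \<psi> x < x"
    define z where "z = min x (\<psi> y) - 1"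
    have "z < x" "\<psi> z < \<psi> y" using down[rule_format, of z] by (auto simp: z_def)
    then show ?thesis using alt[OF _ assms(4), of z] by auto
  qed
qed

text \<open>Convergent sequences are bounded, so the pairs (s n, n) are bounded against every
  Schwartz weight.\<close>

lemma growth_from_limit:
  fixes s :: "nat \<Rightarrow> real"
  assumes "\<And>v. v \<in> Schwartz \<Longrightarrow> (\<lambda>n. v (s n) * of_nat n) \<longlonglongrightarrow> 0"
  shows "\<exists>C k. 0 \<le> C \<and> (\<forall>n. real n \<le> C * (1 + \<bar>s n\<bar>) ^ k)"
proof -
  have "\<exists>C k. 0 \<le> C \<and> (\<forall>(x, y)\<in>range (\<lambda>n. (s n, real n)). y \<le> C * (1 + \<bar>x\<bar>) ^ k)"
  proof (rule polynomial_bound_if_Schwartz_bounded)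
    fix v assume "v \<in> Schwartz"
    then have "Bseq (\<lambda>n. v (s n) * of_nat n)" using assms convergentI convergent_imp_Bseq by blast
    then obtain B where "\<And>n. cmod (v (s n) * of_nat n) \<le> B" unfolding Bseq_def by blast
    then show "\<exists>B. \<forall>(x, y)\<in>range (\<lambda>n. (s n, real n)). cmod (v x) * y \<le> B"
      by (auto simp: norm_mult)
  qed
  then show ?thesis by auto
qed

lemma mixing_abel_equation:
  fixes \<psi> :: "real \<Rightarrow> real"
  assumes \<psi>: "cplx \<psi> \<in> O_M" and bij: "bij \<psi>" and mix: "mixing O_M_topology (comp_op \<psi>)"
    and pos: "\<And>v. v \<in> Schwartz \<Longrightarrow> (\<lambda>n. v ((\<psi> ^^ n) 0) * of_nat n) \<longlonglongrightarrow> 0"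
    and neg: "\<And>v. v \<in> Schwartz \<Longrightarrow> (\<lambda>n. v (inv (\<psi> ^^ n) 0) * of_nat n) \<longlonglongrightarrow> 0"
  shows "\<exists>H. cplx H \<in> O_M \<and> bij H \<and> (\<forall>x. deriv H x \<noteq> 0) \<and> (\<forall>x. H (\<psi> x) = H x + 1)"
proof -
  define p where "p = int_iterate \<psi>"
  have s\<psi>: "smooth (cplx \<psi>)" by (rule O_M_smooth[OF \<psi>])
  have sinv: "smooth (cplx (inv \<psi>))"
    by (rule smooth_inv[OF s\<psi> bij mixing_deriv_nonzero[OF mix \<psi>]])
  have sfun: "smooth (cplx (q ^^ n))" if "smooth (cplx q)" for q n
  proof (induction n)
    case 0
    then show ?case using smooth_of_real by simp
  next
    case (Suc n)
    then show ?case using smooth_compose[OF Suc that] by (simp add: funpow_swap1)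
  qed
  have sp: "smooth (cplx (p n))" for n
    using sfun[OF s\<psi>] sfun[OF sinv] by (simp add: p_def int_iterate_def)
  have p0: "p 0 x = x" for x by (simp add: p_def int_iterate_def)
  have p_add: "p (m + n) x = p m (p n x)" for m n x unfolding p_def by (rule int_iterate_add[OF bij])
  have p_inv: "p (- n) (p n x) = x" "p n (p (- n) x) = x" for n x
    by (simp_all add: p0 flip: p_add)
  have p1: "p 1 = \<psi>" using int_iterate_nat[of \<psi> 1] by (simp add: p_def)
  have pre: "bounded {x. \<bar>p n x\<bar> \<le> \<rho>}" for n \<rho>
  proof (rule bounded_subset)
    show "bounded (p (- n) ` {- \<rho>..\<rho>})"
      by (intro compact_imp_bounded compact_continuous_image smooth_cplx_continuous sp compact_Icc)
    show "{x. \<bar>p n x\<bar> \<le> \<rho>} \<subseteq> p (- n) ` {- \<rho>..\<rho>}"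
      using p_inv(1)[of n, symmetric] by (auto intro!: image_eqI)
  qed
  have near: "cmod (nth_deriv j h t - nth_deriv j complex_of_real t) \<le> 1 / 2"
    if "h \<in> O_M_ball m w complex_of_real (1 / 2)" "w \<in> Schwartz" "1 \<le> cmod (w t)" "j \<le> m" for h w m t j
  proof -
    have "1 * cmod (nth_deriv j h t - nth_deriv j complex_of_real t)
        \<le> cmod (w t) * cmod (nth_deriv j h t - nth_deriv j complex_of_real t)"
      using that(3) by (intro mult_right_mono) auto
    then show ?thesis using O_M_ballD[OF that(1) O_M_id that(2,4), of t] by simp
  qed
  have small: "cmod (v x) * cmod (nth_deriv j f x) \<le> 1"
    if "f \<in> O_M_ball m w (\<lambda>_. 0) (1 / 2)" "w \<in> Schwartz" "cmod (v x) \<le> cmod (w x)" "j \<le> m"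
    for f w m v x j
  proof -
    have "cmod (v x) * cmod (nth_deriv j f x) \<le> cmod (w x) * cmod (nth_deriv j f x)"
      using that(3) by (intro mult_right_mono) auto
    then show ?thesis using O_M_ballD[OF that(1) O_M_const that(2,4), of x] by (simp add: nth_deriv_const)
  qed
  have ob_pos: "\<exists>C k. \<forall>n x. \<bar>p (int n) x\<bar> \<le> \<rho> \<longrightarrow>
      cmod (nth_deriv j (cplx (p (int n))) x) \<le> C * (1 + \<bar>x\<bar>) ^ k" if "1 \<le> j" for \<rho> j
  proof (rule orbit_bound[OF sp pre _ that])
    fix v m assume v: "v \<in> Schwartz"
    obtain u where u: "u \<in> Schwartz" "\<And>x. \<bar>x\<bar> \<le> \<rho> \<Longrightarrow> 1 \<le> cmod (u x)"
      using Schwartz_ge_indicator[of \<rho>] by blast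
    \<comment> \<open>One weight serves both purposes: dominating v makes f o \<psi>^n small, and
      being at least 1 on [-\<rho>, \<rho>] makes f uniformly close to the identity there.\<close>
    obtain w where w: "w \<in> Schwartz" "\<And>x. cmod (v x) \<le> cmod (w x)" "\<And>x. cmod (u x) \<le> cmod (w x)"
      using Schwartz_majorant2[OF v u(1)] by blast
    obtain N where N: "\<And>n. N \<le> n \<Longrightarrow> \<exists>f\<in>O_M_ball m w complex_of_real (1 / 2).
        (\<lambda>x. f ((\<psi> ^^ n) x)) \<in> O_M_ball m w (\<lambda>_. 0) (1 / 2)"
      using mixing_approx[OF mix O_M_id O_M_const[of 0] w(1), of "1 / 2" m] by auto
    have "\<exists>h. smooth h \<and>
      (\<forall>t j. \<bar>t\<bar> \<le> \<rho> \<longrightarrow> j \<le> m \<longrightarrow> cmod (nth_deriv j h t - nth_deriv j complex_of_real t) \<le> 1 / 2) \<and>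
      (\<forall>x j. j \<le> m \<longrightarrow> cmod (v x) * cmod (nth_deriv j (\<lambda>x. h (p (int n) x)) x) \<le> 1)" if n: "N \<le> n" for n
    proof -
      obtain f where f: "f \<in> O_M_ball m w complex_of_real (1 / 2)"
        "(\<lambda>x. f (p (int n) x)) \<in> O_M_ball m w (\<lambda>_. 0) (1 / 2)"
        using N[OF n] by (auto simp: p_def)
      show ?thesis
      proof (intro exI[of _ f] conjI allI impI)
        show "smooth f" by (rule O_M_smooth[OF subsetD[OF O_M_ball_subset f(1)]])
        show "cmod (nth_deriv j f t - nth_deriv j complex_of_real t) \<le> 1 / 2" if "\<bar>t\<bar> \<le> \<rho>" "j \<le> m" for t j
          by (rule near[OF f(1) w(1) order_trans[OF u(2)[OF that(1)] w(3)] that(2)])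
        show "cmod (v x) * cmod (nth_deriv j (\<lambda>x. f (p (int n) x)) x) \<le> 1" if "j \<le> m" for x j
          by (rule small[OF f(2) w(1,2) that])
      qed
    qed
    then show "\<exists>N. \<forall>n\<ge>N. \<exists>h. smooth h \<and>
      (\<forall>t j. \<bar>t\<bar> \<le> \<rho> \<longrightarrow> j \<le> m \<longrightarrow> cmod (nth_deriv j h t - nth_deriv j complex_of_real t) \<le> 1 / 2) \<and>
      (\<forall>x j. j \<le> m \<longrightarrow> cmod (v x) * cmod (nth_deriv j (\<lambda>x. h (p (int n) x)) x) \<le> 1)" by blast
  qed
  \<comment> \<open>The targets are exchanged: f is close to 0 and f o \<psi>^n close to the
    identity. Then h = f o \<psi>^n is the admissible function, and h o \<psi>^(-n) = f is
    small.\<close>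
  have ob_neg: "\<exists>C k. \<forall>n x. \<bar>p (- int n) x\<bar> \<le> \<rho> \<longrightarrow>
      cmod (nth_deriv j (cplx (p (- int n))) x) \<le> C * (1 + \<bar>x\<bar>) ^ k" if "1 \<le> j" for \<rho> j
  proof (rule orbit_bound[OF sp pre _ that])
    fix v m assume v: "v \<in> Schwartz"
    obtain u where u: "u \<in> Schwartz" "\<And>x. \<bar>x\<bar> \<le> \<rho> \<Longrightarrow> 1 \<le> cmod (u x)"
      using Schwartz_ge_indicator[of \<rho>] by blast
    obtain w where w: "w \<in> Schwartz" "\<And>x. cmod (v x) \<le> cmod (w x)" "\<And>x. cmod (u x) \<le> cmod (w x)"
      using Schwartz_majorant2[OF v u(1)] by blast
    obtain N where N: "\<And>n. N \<le> n \<Longrightarrow> \<exists>f\<in>O_M_ball m w (\<lambda>_. 0) (1 / 2).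
        (\<lambda>x. f ((\<psi> ^^ n) x)) \<in> O_M_ball m w complex_of_real (1 / 2)"
      using mixing_approx[OF mix O_M_const[of 0] O_M_id w(1), of "1 / 2" m] by auto
    have "\<exists>h. smooth h \<and>
      (\<forall>t j. \<bar>t\<bar> \<le> \<rho> \<longrightarrow> j \<le> m \<longrightarrow> cmod (nth_deriv j h t - nth_deriv j complex_of_real t) \<le> 1 / 2) \<and>
      (\<forall>x j. j \<le> m \<longrightarrow> cmod (v x) * cmod (nth_deriv j (\<lambda>x. h (p (- int n) x)) x) \<le> 1)" if n: "N \<le> n" for n
    proof -
      obtain f where f: "f \<in> O_M_ball m w (\<lambda>_. 0) (1 / 2)"
        "(\<lambda>x. f (p (int n) x)) \<in> O_M_ball m w complex_of_real (1 / 2)"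
        using N[OF n] by (auto simp: p_def)
      let ?h = "\<lambda>x. f (p (int n) x)"
      show ?thesis
      proof (intro exI[of _ ?h] conjI allI impI)
        show "smooth ?h" by (rule O_M_smooth[OF subsetD[OF O_M_ball_subset f(2)]])
        show "cmod (nth_deriv j ?h t - nth_deriv j complex_of_real t) \<le> 1 / 2" if "\<bar>t\<bar> \<le> \<rho>" "j \<le> m" for t j
          by (rule near[OF f(2) w(1) order_trans[OF u(2)[OF that(1)] w(3)] that(2)])
        show "cmod (v x) * cmod (nth_deriv j (\<lambda>x. ?h (p (- int n) x)) x) \<le> 1" if "j \<le> m" for x j
          unfolding p_inv by (rule small[OF f(1) w(1,2) that])
      qed
    qed
    then show "\<exists>N. \<forall>n\<ge>N. \<exists>h. smooth h \<and>
      (\<forall>t j. \<bar>t\<bar> \<le> \<rho> \<longrightarrow> j \<le> m \<longrightarrow> cmod (nth_deriv j h t - nth_deriv j complex_of_real t) \<le> 1 / 2) \<and>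
      (\<forall>x j. j \<le> m \<longrightarrow> cmod (v x) * cmod (nth_deriv j (\<lambda>x. h (p (- int n) x)) x) \<le> 1)" by blast
  qed
  have two: "a * (1 + \<bar>x\<bar>) ^ k \<le> (\<bar>a\<bar> + \<bar>b\<bar>) * (1 + \<bar>x\<bar>) ^ (k + l)"
    "b * (1 + \<bar>x\<bar>) ^ l \<le> (\<bar>a\<bar> + \<bar>b\<bar>) * (1 + \<bar>x\<bar>) ^ (k + l)" for a b x :: real and k l
    by (intro mult_mono power_increasing; simp)+
  have ob: "\<exists>C k. \<forall>n x. \<bar>p n x\<bar> \<le> \<rho> \<longrightarrow> cmod (nth_deriv j (cplx (p n)) x) \<le> C * (1 + \<bar>x\<bar>) ^ k"
    if j: "1 \<le> j" for \<rho> j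
  proof -
    obtain a k b l where
      1: "\<And>n x. \<bar>p (int n) x\<bar> \<le> \<rho> \<Longrightarrow> cmod (nth_deriv j (cplx (p (int n))) x) \<le> a * (1 + \<bar>x\<bar>) ^ k" and
      2: "\<And>n x. \<bar>p (- int n) x\<bar> \<le> \<rho> \<Longrightarrow> cmod (nth_deriv j (cplx (p (- int n))) x) \<le> b * (1 + \<bar>x\<bar>) ^ l"
      using ob_pos[OF j, of \<rho>] ob_neg[OF j, of \<rho>] by blast
    have "cmod (nth_deriv j (cplx (p n)) x) \<le> (\<bar>a\<bar> + \<bar>b\<bar>) * (1 + \<bar>x\<bar>) ^ (k + l)" if "\<bar>p n x\<bar> \<le> \<rho>" for n x
      using that by (cases n rule: int_cases2) (auto intro: order_trans[OF 1 two(1)] order_trans[OF 2 two(2)])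
    then show ?thesis by blast
  qed
  have gr: "\<exists>C k. \<forall>n. \<bar>real_of_int n\<bar> \<le> C * (1 + \<bar>p n 0\<bar>) ^ k"
  proof -
    obtain a k where 1: "\<And>n. real n \<le> a * (1 + \<bar>p (int n) 0\<bar>) ^ k"
      using growth_from_limit[of "\<lambda>n. (\<psi> ^^ n) 0", OF pos] by (auto simp: p_def)
    obtain b l where 2: "\<And>n. real n \<le> b * (1 + \<bar>p (- int n) 0\<bar>) ^ l"
      using growth_from_limit[of "\<lambda>n. inv (\<psi> ^^ n) 0", OF neg] by (auto simp: p_def inv_fn[OF bij])
    have "\<bar>real_of_int n\<bar> \<le> (\<bar>a\<bar> + \<bar>b\<bar>) * (1 + \<bar>p n 0\<bar>) ^ (k + l)" for n
      by (cases n rule: int_cases2) (auto intro: order_trans[OF 1 two(1)] order_trans[OF 2 two(2)])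
    then show ?thesis by blast
  qed
  have mono: "\<psi> x < \<psi> y" if "x < y" for x y
    by (rule strict_mono_if_no_fixpoint(1)[OF smooth_cplx_continuous[OF s\<psi>] bij_is_inj[OF bij]
          mixing_no_fixpoint[OF mix] that])
  consider "\<forall>x. x < \<psi> x" | "\<forall>x. \<psi> x < x"
    using strict_mono_if_no_fixpoint(2)[OF smooth_cplx_continuous[OF s\<psi>] bij_is_inj[OF bij]
          mixing_no_fixpoint[OF mix] zero_less_one] by blast
  then show ?thesis
  proof cases
    case 1
    interpret abel_flow p
      using p0 p_add sp ob gr mono 1 by unfold_locales (simp_all add: p1)
    have "abel (\<psi> x) = abel x + 1" for x using abel_step[of x] by (simp add: p1)
    moreover have "deriv abel x \<noteq> 0" for x using deriv_abel_pos[of x] by simp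
    ultimately show ?thesis
      using abel_O_M bij_abel by (intro exI[of _ abel]) auto
  next
    case 2
    \<comment> \<open>Reversing time makes all points move to the right. The resulting function
      decreases by 1 along \<psi>, so its negative solves the Abel equation.\<close>
    interpret abel_flow "\<lambda>n. p (- n)"
    proof
      show "x < p (- 1) x" for x using 2[rule_format, of "p (- 1) x"] p_inv(2)[of 1 x] by (simp add: p1)
      show "p (- 1) x < p (- 1) y" if "x < y" for x y
      proof (rule ccontr)
        assume "\<not> p (- 1) x < p (- 1) y"
        then have "\<psi> (p (- 1) y) \<le> \<psi> (p (- 1) x)"
          using mono[of "p (- 1) y" "p (- 1) x"] by (cases "p (- 1) y = p (- 1) x") auto
        then show False using p_inv(2)[of 1] that by (simp add: p1)
      qed
      show "p (- (m + n)) x = p (- m) (p (- n) x)" for m n x by (simp flip: p_add)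
      show "\<exists>C k. \<forall>n x. \<bar>p (- n) x\<bar> \<le> \<rho> \<longrightarrow> cmod (nth_deriv j (cplx (p (- n))) x) \<le> C * (1 + \<bar>x\<bar>) ^ k"
        if "1 \<le> j" for j \<rho> using ob[OF that, of \<rho>] by meson
      obtain C k where "\<And>n. \<bar>real_of_int n\<bar> \<le> C * (1 + \<bar>p n 0\<bar>) ^ k" using gr by blast
      from this[of "- n" for n] show "\<exists>C k. \<forall>n. \<bar>real_of_int n\<bar> \<le> C * (1 + \<bar>p (- n) 0\<bar>) ^ k" by auto
    qed (simp_all add: p0 sp)
    have "abel (\<psi> x) = abel x - 1" for x
      using abel_step[of "\<psi> x"] p_inv(1)[of 1 x] by (simp add: p1)
    moreover have "bij (\<lambda>x. - abel x)"
      using bij_comp[OF bij_abel bij_uminus] by (simp add: o_def)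
    moreover have "deriv (\<lambda>x. - abel x) x \<noteq> 0" for x
      using DERIV_imp_deriv[OF DERIV_minus[OF smooth_cplx_deriv(1)[OF smooth_abel]], of x] deriv_abel_pos[of x]
      by simp
    moreover have "cplx (\<lambda>x. - abel x) \<in> O_M" using O_M_uminus[OF abel_O_M] by simp
    ultimately show ?thesis by (intro exI[of _ "\<lambda>x. - abel x"]) auto
  qed
qed

section \<open>Transfer along a quasi-conjugacy\<close>

lemma dense_in_mono: "dense_in E A \<Longrightarrow> A \<subseteq> B \<Longrightarrow> B \<subseteq> topspace E \<Longrightarrow> dense_in E B"
  using closure_of_mono[of A B E] closure_of_subset_topspace[of E B] by (auto simp: dense_in_def)

text \<open>By continuity the closure of the image of A contains the whole range of \<Phi>, which is
  itself dense.\<close>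

lemma dense_in_image:
  assumes \<Phi>: "continuous_map F E \<Phi>" "dense_in E (\<Phi> ` topspace F)" and A: "dense_in F A"
  shows "dense_in E (\<Phi> ` A)"
  unfolding dense_in_def
proof
  show sub: "\<Phi> ` A \<subseteq> topspace E"
    using A continuous_map_image_subset_topspace[OF \<Phi>(1)] by (auto simp: dense_in_def)
  have "\<Phi> ` topspace F \<subseteq> E closure_of (\<Phi> ` A)"
    using continuous_map_image_closure_subset[OF \<Phi>(1), of A] A by (simp add: dense_in_def)
  then have "topspace E \<subseteq> E closure_of (E closure_of (\<Phi> ` A))"
    using \<Phi>(2) closure_of_mono unfolding dense_in_def by metis
  then show "E closure_of (\<Phi> ` A) = topspace E"
    using closure_of_subset_topspace[of E] by (simp add: subset_antisym)
qed

theorem corollary16: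
  fixes \<psi> :: "real \<Rightarrow> real"
  assumes "(\<lambda>x. complex_of_real (\<psi> x)) \<in> O_M"
    and "bij \<psi>"
    and "mixing O_M_topology (comp_op \<psi>)"
    and "\<And>v. v \<in> Schwartz \<Longrightarrow> (\<lambda>n. v ((\<psi> ^^ n) 0) * of_nat n) \<longlonglongrightarrow> 0"
    and "\<And>v. v \<in> Schwartz \<Longrightarrow> (\<lambda>n. v (inv (\<psi> ^^ n) 0) * of_nat n) \<longlonglongrightarrow> 0"
  shows "quasi_conjugate O_M_topology (comp_op \<psi>) O_M_topology (comp_op (\<lambda>x. x + 1))
       \<and> hypercyclic O_M_topology (comp_op \<psi>)
       \<and> chaotic O_M_topology (comp_op \<psi>)"
proof -
  obtain H where H: "cplx H \<in> O_M" "bij H" "\<And>x. deriv H x \<noteq> 0" "\<And>x. H (\<psi> x) = H x + 1"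
    using mixing_abel_equation[OF assms] by blast
  have inv: "inv H (H x) = x" "H (inv H x) = x" for x
    using H(2) by (simp_all add: bij_is_inj bij_is_surj surj_f_inv_f)
  have cont: "continuous_map O_M_topology O_M_topology (comp_op H)"
  proof (rule continuous_map_comp_op[OF H(1)])
    fix v k assume v: "v \<in> Schwartz"
    \<comment> \<open>The weight transported along H. It decays rapidly because y = H x is
      polynomially bounded in x, so decay in x implies decay in y.\<close>
    define u where "u y = cmod (v (inv H y)) * (1 + \<bar>inv H y\<bar>) ^ k" for y
    obtain B r where B: "1 \<le> B" "\<And>i x. i \<le> 0 \<Longrightarrow> cmod (nth_deriv i (cplx H) x) \<le> B * (1 + \<bar>x\<bar>) ^ r"
      using O_M_bound[OF H(1), of 0] by blast
    have "rapid u" unfolding rapid_def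
    proof
      fix l
      obtain S where S: "0 \<le> S" "\<And>x. (1 + \<bar>x\<bar>) ^ (r * l + k) * cmod (v x) \<le> S"
        using Schwartz_bound[OF v, of "r * l + k"] by blast
      have "(1 + \<bar>y\<bar>) ^ l * u y \<le> (2 * B) ^ l * S" for y
      proof -
        define x where "x = inv H y"
        have ge1: "1 \<le> B * (1 + \<bar>x\<bar>) ^ r"
          using mult_mono[OF B(1) one_le_power[of "1 + \<bar>x\<bar>" r]] B(1) by simp
        have "\<bar>y\<bar> \<le> B * (1 + \<bar>x\<bar>) ^ r" using B(2)[of 0 x] by (simp add: x_def inv)
        then have "1 + \<bar>y\<bar> \<le> 2 * B * (1 + \<bar>x\<bar>) ^ r" using ge1 by linarith
        then have "(1 + \<bar>y\<bar>) ^ l * u y \<le> (2 * B * (1 + \<bar>x\<bar>) ^ r) ^ l * u y"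
          by (intro mult_right_mono power_mono) (auto simp: u_def)
        also have "\<dots> = (2 * B) ^ l * ((1 + \<bar>x\<bar>) ^ (r * l + k) * cmod (v x))"
          unfolding u_def power_add power_mult power_mult_distrib by (simp only: mult_ac flip: x_def)
        also have "\<dots> \<le> (2 * B) ^ l * S" using B(1) by (intro mult_left_mono S) auto
        finally show ?thesis .
      qed
      then show "\<exists>C. \<forall>y. (1 + \<bar>y\<bar>) ^ l * u y \<le> C" by blast
    qed
    then obtain w where w: "w \<in> Schwartz" "\<And>y. u y \<le> cmod (w y)"
      by (rule Schwartz_majorant) (auto simp: u_def)
    have "cmod (v x) * (1 + \<bar>x\<bar>) ^ k \<le> cmod (w (H x))" for x
      using w(2)[of "H x"] by (simp add: u_def inv)
    with w(1) show "\<exists>w\<in>Schwartz. \<forall>x. cmod (v x) * (1 + \<bar>x\<bar>) ^ k \<le> cmod (w (H x))" by blast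
  qed
  have range: "dense_in O_M_topology (comp_op H ` topspace O_M_topology)"
  proof (rule dense_in_O_M)
    show "comp_op H ` topspace O_M_topology \<subseteq> O_M"
      using continuous_map_image_subset_topspace[OF cont] by simp
    fix f m v e assume "f \<in> O_M" "v \<in> Schwartz" "0 < (e::real)"
    then obtain g where g: "test_fun g"
      "\<forall>x. \<forall>j\<le>m. cmod (v x) * cmod (nth_deriv j g x - nth_deriv j f x) \<le> e"
      using test_fun_dense by blast
    \<comment> \<open>H maps the compact support to a compact set and its inverse is smooth, so
      every test function g is the image of the test function g o H^(-1).\<close>
    have "test_fun (\<lambda>y. g (inv H y))"
    proof -
      obtain R :: nat where R: "\<forall>x. real R < \<bar>x\<bar> \<longrightarrow> g x = 0" using test_fun_support[OF g(1)] by blast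
      have "bounded (H ` {- real R..real R})"
        by (intro compact_imp_bounded compact_continuous_image smooth_cplx_continuous O_M_smooth H compact_Icc)
      then obtain r where r: "\<And>y. y \<in> H ` {- real R..real R} \<Longrightarrow> \<bar>y\<bar> \<le> r" by (auto simp: bounded_iff)
      have "g (inv H y) = 0" if "r < \<bar>y\<bar>" for y
      proof (rule ccontr)
        assume "g (inv H y) \<noteq> 0"
        then have "\<bar>inv H y\<bar> \<le> real R" using R by (meson not_le)
        then have "H (inv H y) \<in> H ` {- real R..real R}" by (intro imageI) auto
        then show False using r[of y] that by (simp add: inv)
      qed
      moreover have "smooth (\<lambda>y. g (inv H y))"
        by (rule smooth_compose[OF test_fun_smooth[OF g(1)] smooth_inv[OF O_M_smooth[OF H(1)] H(2,3)]])
      ultimately show ?thesis unfolding test_fun_def by blast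
    qed
    then have "comp_op H (\<lambda>y. g (inv H y)) \<in> comp_op H ` topspace O_M_topology"
      using test_fun_O_M by simp
    moreover have "comp_op H (\<lambda>y. g (inv H y)) = g" by (simp add: comp_op_def o_def inv)
    ultimately show "\<exists>g\<in>comp_op H ` topspace O_M_topology.
        \<forall>x. \<forall>j\<le>m. cmod (v x) * cmod (nth_deriv j g x - nth_deriv j f x) \<le> e" using g(2) by auto
  qed
  have conj: "comp_op \<psi> (comp_op H f) = comp_op H (comp_op (\<lambda>x. x + 1) f)" for f
    by (simp add: comp_op_def fun_eq_iff H(4))
  have conj_n: "(comp_op \<psi> ^^ n) (comp_op H f) = comp_op H ((comp_op (\<lambda>x. x + 1) ^^ n) f)" for n f
    by (induction n) (simp_all add: conj)
  have maps: "comp_op H f \<in> O_M" if "f \<in> O_M" for f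
    using continuous_map_image_subset_topspace[OF cont] that by auto
  have "quasi_conjugate O_M_topology (comp_op \<psi>) O_M_topology (comp_op (\<lambda>x. x + 1))"
    unfolding quasi_conjugate_def using cont range conj by blast
  moreover have "hypercyclic O_M_topology (comp_op \<psi>)"
  proof -
    obtain f where f: "f \<in> O_M" "dense_in O_M_topology (range (\<lambda>n. (comp_op (\<lambda>x. x + 1) ^^ n) f))"
      using translation_hypercyclic by (auto simp: hypercyclic_def)
    have "dense_in O_M_topology (comp_op H ` range (\<lambda>n. (comp_op (\<lambda>x. x + 1) ^^ n) f))"
      by (rule dense_in_image[OF cont range f(2)])
    then have "dense_in O_M_topology (range (\<lambda>n. (comp_op \<psi> ^^ n) (comp_op H f)))"
      by (simp add: conj_n image_image)
    then show ?thesis unfolding hypercyclic_def using maps[OF f(1)] by auto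
  qed
  moreover have "topologically_transitive O_M_topology (comp_op \<psi>)"
    unfolding topologically_transitive_def
  proof (intro allI impI)
    fix U V assume "openin O_M_topology U \<and> U \<noteq> {} \<and> openin O_M_topology V \<and> V \<noteq> {}"
    then obtain N where N: "\<And>n. N \<le> n \<Longrightarrow> (comp_op \<psi> ^^ n) ` U \<inter> V \<noteq> {}"
      using assms(3) unfolding mixing_def by meson
    \<comment> \<open>Transitivity comes directly from mixing; Suc N is taken since N may be
      0.\<close>
    then show "\<exists>n\<ge>1. (comp_op \<psi> ^^ n) ` U \<inter> V \<noteq> {}" by (intro exI[of _ "Suc N"] conjI N) simp_all
  qed
  moreover have "dense_in O_M_topology (periodic_points O_M_topology (comp_op \<psi>))"
  proof (rule dense_in_mono)
    show "dense_in O_M_topology (comp_op H ` periodic_points O_M_topology (comp_op (\<lambda>x. x + 1)))"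
      by (rule dense_in_image[OF cont range translation_periodic_dense])
    show "comp_op H ` periodic_points O_M_topology (comp_op (\<lambda>x. x + 1))
        \<subseteq> periodic_points O_M_topology (comp_op \<psi>)"
      using maps by (force simp: periodic_points_def conj_n)
    show "periodic_points O_M_topology (comp_op \<psi>) \<subseteq> topspace O_M_topology"
      by (auto simp: periodic_points_def)
  qed
  ultimately show ?thesis by (simp add: chaotic_def)
qed

end
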